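(* Let $G$ be a finite $2$-group of nilpotency class $3$. (1) If $\mathrm{d}(G)\neq 3$ and $Z(G)$ is not cyclic, then $G$ has a non-inner automorphism of order $2$ that fixes every element of $\Phi(G)$. (2) If $\mathrm{d}(G)=3$ and $\mathrm{d}(Z(G))>2$, then $G$ has a non-inner automorphism of order $2$ that fixes every element of $\Phi(G)$.
   Context: For a finite group $H$, $\mathrm{d}(H)$ is the minimum number of generators of $H$, $Z(H)$ is its center and $\Phi(H)$ is its Frattini subgroup. A non-inner automorphism is one that is not conjugation by a group element. *)

theory Defs
  imports "HOL-Algebra.Algebra"
begin

text \<open>Subgroups are passed to \<open>min_gens\<close>, \<open>cyclic_group\<close> etc. as the
  groups \<open>G\<lparr>carrier := H\<rparr>\<close>, as is usual in HOL-Algebra.\<close>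

definition center :: "('a, 'b) monoid_scheme \<Rightarrow> 'a set" where
  "center G = {z \<in> carrier G. \<forall>x\<in>carrier G. z \<otimes>\<^bsub>G\<^esub> x = x \<otimes>\<^bsub>G\<^esub> z}"

definition maximal_subgroup :: "'a set \<Rightarrow> ('a, 'b) monoid_scheme \<Rightarrow> bool" where
  "maximal_subgroup M G \<longleftrightarrow>
     subgroup M G \<and> M \<noteq> carrier G \<and>
     (\<forall>H. subgroup H G \<longrightarrow> M \<subseteq> H \<longrightarrow> H = M \<or> H = carrier G)"

text \<open>Intersecting with the carrier gives the whole group when there are no maximal subgroups.\<close>

definition frattini :: "('a, 'b) monoid_scheme \<Rightarrow> 'a set" where
  "frattini G = carrier G \<inter> \<Inter>{M. maximal_subgroup M G}"

text \<open>The minimum number of generators; meaningful for finitely generated groups only.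
  The trivial group has value 0.\<close>

definition min_gens :: "('a, 'b) monoid_scheme \<Rightarrow> nat" where
  "min_gens G =
     (LEAST n. \<exists>S. S \<subseteq> carrier G \<and> finite S \<and> card S = n \<and> generate G S = carrier G)"

text \<open>The indexing starts at 0, so \<open>lower_central G i\<close> is usually written
  \<open>\<gamma>\<close> with index \<open>i + 1\<close>.\<close>

primrec lower_central :: "('a, 'b) monoid_scheme \<Rightarrow> nat \<Rightarrow> 'a set" where
  "lower_central G 0 = carrier G"
| "lower_central G (Suc i) =
     generate G {x \<otimes>\<^bsub>G\<^esub> y \<otimes>\<^bsub>G\<^esub> inv\<^bsub>G\<^esub> x \<otimes>\<^bsub>G\<^esub> inv\<^bsub>G\<^esub> y | x y. x \<in> lower_central G i \<and> y \<in> carrier G}"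

definition nilpotent_of_class :: "('a, 'b) monoid_scheme \<Rightarrow> nat \<Rightarrow> bool" where
  "nilpotent_of_class G c \<longleftrightarrow>
     lower_central G c = {\<one>\<^bsub>G\<^esub>} \<and> (\<forall>i<c. lower_central G i \<noteq> {\<one>\<^bsub>G\<^esub>})"

text \<open>The functions are restricted to the carrier, since the elements of \<open>AutoGroup G\<close>
  are extensional.\<close>

definition inner_auts :: "('a, 'b) monoid_scheme \<Rightarrow> ('a \<Rightarrow> 'a) set" where
  "inner_auts G = {\<lambda>x\<in>carrier G. g \<otimes>\<^bsub>G\<^esub> x \<otimes>\<^bsub>G\<^esub> inv\<^bsub>G\<^esub> g | g. g \<in> carrier G}"

end

theory Submission
  imports Defs
begin

text \<open>
  Let \<open>\<Phi>\<close> be the subgroup generated by the squares, \<open>2 ^ d\<close> its index, \<open>\<Omega>\<close> the group of central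
  elements of order at most 2 and \<open>Z\<^sub>2\<close> the second center. An automorphism of order 2 fixing \<open>\<Phi>\<close>
  arises as \<open>x \<mapsto> f x x\<close> from a derivation \<open>f\<close> of \<open>G / \<Phi>\<close> into the involutions of \<open>Z(\<Phi>)\<close>.
  Suppose that all of these are inner.

  For homomorphisms into \<open>\<Omega>\<close> this gives \<open>K / Z \<cong> Hom(G, \<Omega>)\<close>, where \<open>K\<close> consists of the
  \<open>k \<in> Z\<^sub>2\<close> with \<open>k\<^sup>2 \<in> Z\<close>, so \<open>K / Z\<close> has order \<open>\<bar>\<Omega>\<bar> ^ d\<close>. As \<open>Z(G / Z)\<close> has rank at most
  \<open>d (d + 1) / 2\<close>, this contradicts
  \<open>\<bar>\<Omega>\<bar> \<ge> 4\<close> if \<open>d \<le> 2\<close>, and \<open>\<bar>\<Omega>\<bar> \<ge> 8\<close> if \<open>d = 3\<close>.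

  For \<open>d \<ge> 4\<close>, let \<open>L\<close> be the group of elements of order at most 2 in \<open>Z\<^sub>2\<close>; it has at least
  \<open>\<bar>\<Omega>\<bar> ^ d\<close> elements. A derivation into \<open>L\<close> is a choice of \<open>d\<close> values in \<open>L\<close> subject to
  \<open>d (d + 1) / 2\<close> conditions in \<open>\<Omega>\<close>, and those with values in \<open>\<Omega>\<close> number \<open>\<bar>\<Omega>\<bar> ^ d\<close>. The elements
  inducing them are involutions modulo \<open>Z\<^sub>2\<close>, of which there are at most \<open>2 ^ d\<close> cosets. For
  \<open>\<bar>\<Omega>\<bar> \<ge> 4\<close> this forces \<open>\<bar>\<Omega>\<bar> ^ (d (d - 3) / 2) \<le> 2 ^ d\<close>, so equality holds in every estimate. If
  \<open>2 ^ a\<close> is the exponent of \<open>G / Z\<^sub>2\<close>, the equalities allow one to correct the powers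
  \<open>x ^ (2 ^ (a - 1))\<close> of the generators modulo \<open>Z\<^sub>2\<close> to the values of a further derivation. This one
  cannot be inner, since its values do not all lie in \<open>Z\<^sub>2\<close>.
\<close>

section \<open>Counting a finite set by the fibres of a map\<close>

lemma card_eq_fibres:
  assumes "finite A" "\<And>a. a \<in> A \<Longrightarrow> card {x \<in> A. \<phi> x = \<phi> a} = c"
  shows "card A = c * card (\<phi> ` A)"
proof -
  have "card A = (\<Sum>y\<in>\<phi> ` A. card {x \<in> A. \<phi> x = y})"
    using sum.image_gen[OF assms(1), of "\<lambda>_. 1::nat" \<phi>] by simp
  also have "\<dots> = (\<Sum>y\<in>\<phi> ` A. c)"
    by (rule sum.cong) (auto simp: assms(2))
  finally show ?thesis by simp
qed

lemma card_le_fibres: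
  assumes "finite A" "\<And>a. a \<in> A \<Longrightarrow> card {x \<in> A. \<phi> x = \<phi> a} \<le> c"
  shows "card A \<le> c * card (\<phi> ` A)"
proof -
  have "card A = (\<Sum>y\<in>\<phi> ` A. card {x \<in> A. \<phi> x = y})"
    using sum.image_gen[OF assms(1), of "\<lambda>_. 1::nat" \<phi>] by simp
  also have "\<dots> \<le> (\<Sum>y\<in>\<phi> ` A. c)"
    by (rule sum_mono) (auto simp: assms(2))
  finally show ?thesis by (simp add: mult.commute)
qed

section \<open>Commutators and the center of an arbitrary group\<close>

context group
begin

text \<open>This is the convention of \<open>lower_central\<close>. With it conjugation by
  \<open>g\<close> sends \<open>x\<close> to \<open>com g x \<otimes> x\<close>, so inner
  automorphisms correspond to the maps \<open>com g\<close>.\<close>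

definition com :: "'a \<Rightarrow> 'a \<Rightarrow> 'a" where
  "com x y = x \<otimes> y \<otimes> inv x \<otimes> inv y"

lemma cancel_words:
  "x \<in> carrier G \<Longrightarrow> y \<in> carrier G \<Longrightarrow> x \<otimes> (inv x \<otimes> y) = y"
  "x \<in> carrier G \<Longrightarrow> y \<in> carrier G \<Longrightarrow> inv x \<otimes> (x \<otimes> y) = y"
  by (simp_all flip: m_assoc)

text \<open>Simp rules that bring group words to a reduced, right-associated form; identities valid
  in free groups then become trivial.\<close>

lemmas words = m_assoc inv_mult_group cancel_words

lemma com_closed [simp]: "x \<in> carrier G \<Longrightarrow> y \<in> carrier G \<Longrightarrow> com x y \<in> carrier G"
  by (simp add: com_def)

lemma conj_com: "x \<in> carrier G \<Longrightarrow> y \<in> carrier G \<Longrightarrow> x \<otimes> y \<otimes> inv x = com x y \<otimes> y"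
  by (simp add: com_def words)

lemma mult_com: "x \<in> carrier G \<Longrightarrow> y \<in> carrier G \<Longrightarrow> x \<otimes> y = com x y \<otimes> y \<otimes> x"
  by (simp add: com_def words)

lemma com_eq_one: "x \<in> carrier G \<Longrightarrow> y \<in> carrier G \<Longrightarrow> com x y = \<one> \<longleftrightarrow> x \<otimes> y = y \<otimes> x"
proof
  assume x: "x \<in> carrier G" and y: "y \<in> carrier G"
  show "x \<otimes> y = y \<otimes> x" if "com x y = \<one>"
    using mult_com[OF x y] that x y by simp
  show "com x y = \<one>" if "x \<otimes> y = y \<otimes> x"
    unfolding com_def that using x y by (simp add: words)
qed

lemma com_inverse: "x \<in> carrier G \<Longrightarrow> y \<in> carrier G \<Longrightarrow> inv (com x y) = com y x"
  by (simp add: com_def words)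

lemma com_self [simp]: "x \<in> carrier G \<Longrightarrow> com x x = \<one>"
  by (simp add: com_eq_one)

lemma com_one [simp]: "x \<in> carrier G \<Longrightarrow> com x \<one> = \<one>" "x \<in> carrier G \<Longrightarrow> com \<one> x = \<one>"
  by (simp_all add: com_eq_one)

lemma com_mult_left:
  "x \<in> carrier G \<Longrightarrow> y \<in> carrier G \<Longrightarrow> z \<in> carrier G \<Longrightarrow>
     com (x \<otimes> y) z = x \<otimes> com y z \<otimes> inv x \<otimes> com x z"
  by (simp add: com_def words)

lemma com_mult_right:
  "x \<in> carrier G \<Longrightarrow> y \<in> carrier G \<Longrightarrow> z \<in> carrier G \<Longrightarrow>
     com x (y \<otimes> z) = com x y \<otimes> (y \<otimes> com x z \<otimes> inv y)"
  by (simp add: com_def words)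

lemma centerD: "z \<in> center G \<Longrightarrow> z \<in> carrier G" "z \<in> center G \<Longrightarrow> x \<in> carrier G \<Longrightarrow> z \<otimes> x = x \<otimes> z"
  by (auto simp: center_def)

lemma center_iff_com: "z \<in> carrier G \<Longrightarrow> z \<in> center G \<longleftrightarrow> (\<forall>x\<in>carrier G. com z x = \<one>)"
  by (auto simp: center_def com_eq_one)

lemma com_center: "z \<in> center G \<Longrightarrow> x \<in> carrier G \<Longrightarrow> com z x = \<one>" 
   "z \<in> center G \<Longrightarrow> x \<in> carrier G \<Longrightarrow> com x z = \<one>"
  by (auto simp: center_def com_eq_one)

lemma conj_center: "z \<in> center G \<Longrightarrow> x \<in> carrier G \<Longrightarrow> x \<otimes> z \<otimes> inv x = z"
  by (simp add: conj_com com_center centerD(1))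

lemma subgroup_center: "subgroup (center G) G"
proof (rule subgroupI)
  have "\<one> \<in> center G" by (simp add: center_def)
  then show "center G \<noteq> {}" by blast
next
  show "center G \<subseteq> carrier G" by (rule subsetI) (rule centerD(1))
next
  fix a assume a: "a \<in> center G"
  note ac = centerD(1)[OF a]
  have "inv a \<otimes> x = x \<otimes> inv a" if x: "x \<in> carrier G" for x
  proof -
    have "inv (a \<otimes> inv x) = inv (inv x \<otimes> a)"
      using centerD(2)[OF a, of "inv x"] x by simp
    then show ?thesis
      using ac x by (simp add: inv_mult_group)
  qed
  then show "inv a \<in> center G" using ac by (simp add: center_def)
next
  fix a b assume a: "a \<in> center G" and b: "b \<in> center G"
  note c = centerD(1)[OF a] centerD(1)[OF b]
  have "a \<otimes> b \<otimes> x = x \<otimes> (a \<otimes> b)" if x: "x \<in> carrier G" for x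
  proof -
    have "a \<otimes> b \<otimes> x = a \<otimes> (b \<otimes> x)" using c x by (simp add: m_assoc)
    also have "\<dots> = a \<otimes> (x \<otimes> b)" using centerD(2)[OF b x] by (rule arg_cong)
    also have "\<dots> = (a \<otimes> x) \<otimes> b" using c x by (simp add: m_assoc)
    also have "\<dots> = (x \<otimes> a) \<otimes> b" using centerD(2)[OF a x] by (rule arg_cong)
    also have "\<dots> = x \<otimes> (a \<otimes> b)" using c x by (simp add: m_assoc)
    finally show ?thesis .
  qed
  then show "a \<otimes> b \<in> center G" using c by (simp add: center_def)
qed

section \<open>Subgroups of finite groups\<close>

lemma finite_subgroupI:
  assumes "finite (carrier G)" "H \<subseteq> carrier G" "H \<noteq> {}" "\<And>x y. x \<in> H \<Longrightarrow> y \<in> H \<Longrightarrow> x \<otimes> y \<in> H"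
  shows "subgroup H G"
proof (rule subgroupI)
  fix a assume a: "a \<in> H"
  then have ac: "a \<in> carrier G" using assms by auto
  have pow: "a [^] Suc n \<in> H" for n :: nat
    by (induction n) (use a assms(4) ac in auto)
  define n where "n = order G"
  have n: "n > 0" unfolding n_def using assms(1) order_gt_0_iff_finite by blast
  \<comment> \<open>The exponent is twice the order, so that \<open>n + n - 1\<close> is at least 1
    even in the trivial group; \<open>pow\<close> covers positive exponents only.\<close>
  have 1: "a [^] (n + n) = \<one>"
    using ac by (simp add: n_def pow_order_eq_1 flip: nat_pow_mult)
  have "a [^] (n + n - 1) \<in> H"
    using pow[of "n + n - 2"] n by (cases n) auto
  moreover have "a [^] (n + n - 1) \<otimes> a = \<one>"
    using 1 n by (cases n) auto
  then have "inv a = a [^] (n + n - 1)"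
    using ac by (simp add: inv_equality)
  ultimately show "inv a \<in> H" by simp
qed (use assms in auto)

text \<open>Lagrange's theorem for a map whose fibres are the left cosets of \<open>N\<close>. The
  map need not be a homomorphism, so tuples of commutators, squares and cosets can all serve as
  \<open>\<phi>\<close>.\<close>

lemma card_quotient_image:
  assumes "finite (carrier G)" "subgroup A G" "subgroup N G" "N \<subseteq> A"
    "\<And>a b. a \<in> A \<Longrightarrow> b \<in> A \<Longrightarrow> \<phi> a = \<phi> b \<longleftrightarrow> inv a \<otimes> b \<in> N"
  shows "card A = card N * card (\<phi> ` A)"
proof (rule card_eq_fibres)
  show "finite A" using assms(1,2) finite_subset subgroup.subset by blast
next
  fix a assume a: "a \<in> A"
  have sub: "A \<subseteq> carrier G" "N \<subseteq> carrier G" using assms(2,3) by (blast dest: subgroup.subset)+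
  have "{x \<in> A. \<phi> x = \<phi> a} = (\<lambda>n. a \<otimes> n) ` N"
  proof (intro equalityI subsetI)
    fix x assume x: "x \<in> {x \<in> A. \<phi> x = \<phi> a}"
    then have "inv a \<otimes> x \<in> N" using assms(5)[OF a, of x] by auto
    moreover have "x = a \<otimes> (inv a \<otimes> x)" using a x sub by (auto simp: cancel_words subsetD)
    ultimately show "x \<in> (\<lambda>n. a \<otimes> n) ` N" by blast
  next
    fix x assume "x \<in> (\<lambda>n. a \<otimes> n) ` N"
    then obtain n where n: "n \<in> N" "x = a \<otimes> n" by auto
    then have "x \<in> A" using a assms(2,4) by (auto intro: subgroup.m_closed)
    moreover have "inv a \<otimes> x = n" using n a sub by (auto simp: cancel_words subsetD)
    ultimately show "x \<in> {x \<in> A. \<phi> x = \<phi> a}" using assms(5)[OF a, of x] n by auto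
  qed
  moreover have "inj_on (\<lambda>n. a \<otimes> n) N" using a sub by (intro inj_onI) (simp add: subsetD)
  ultimately show "card {x \<in> A. \<phi> x = \<phi> a} = card N" by (simp add: card_image)
qed

text \<open>The element \<open>y\<close> normalizes \<open>H\<close> and has order at most 2 modulo
  it, so the cosets \<open>H\<close> and \<open>H y\<close> already form a subgroup.\<close>

lemma adjoin_involution:
  assumes "finite (carrier G)" "subgroup H G" "y \<in> carrier G" "y \<otimes> y \<in> H"
    "\<And>h. h \<in> H \<Longrightarrow> y \<otimes> h \<otimes> inv y \<in> H"
  shows "generate G (insert y H) = H \<union> {h \<otimes> y |h. h \<in> H}"
proof -
  have sub: "H \<subseteq> carrier G" using assms subgroup.subset by auto
  let ?U = "H \<union> {h \<otimes> y |h. h \<in> H}"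
  have 1: "subgroup ?U G"
  proof (rule finite_subgroupI)
    fix u v assume uv: "u \<in> ?U" "v \<in> ?U"
    consider "u \<in> H" "v \<in> H" | h where "u \<in> H" "v = h \<otimes> y" "h \<in> H"
      | k where "u = k \<otimes> y" "k \<in> H" "v \<in> H" | h k where "u = k \<otimes> y" "v = h \<otimes> y" "h \<in> H" "k \<in> H"
      using uv by blast
    then show "u \<otimes> v \<in> ?U"
    proof cases
      case 1 then show ?thesis using assms(2) by (auto intro: subgroup.m_closed)
    next
      case (2 h)
      then have "u \<otimes> v = (u \<otimes> h) \<otimes> y" using sub assms(3) by (simp add: m_assoc subsetD)
      then show ?thesis using assms(2) 2 by (auto intro: subgroup.m_closed)
    next
      case (3 k)
      have "u \<otimes> v = (k \<otimes> (y \<otimes> v \<otimes> inv y)) \<otimes> y" using 3 sub assms(3) by (simp add: words subsetD)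
      then show ?thesis using assms(2) assms(5)[of v] 3 by (auto intro: subgroup.m_closed)
    next
      case (4 h k)
      have "u \<otimes> v = k \<otimes> ((y \<otimes> h \<otimes> inv y) \<otimes> (y \<otimes> y))" using 4 sub assms(3) by (simp add: words subsetD)
      then show ?thesis using assms(2,4) assms(5)[of h] 4 by (auto intro: subgroup.m_closed)
    qed
  qed (use assms sub in auto)
  have 2: "y = \<one> \<otimes> y" "\<one> \<in> H" using assms by (auto simp: subgroup.one_closed)
  show ?thesis
  proof (rule generateI[OF 1, symmetric])
    show "insert y H \<subseteq> ?U" using 2 by auto
  next
    fix K assume "subgroup K G" "insert y H \<subseteq> K"
    then show "?U \<subseteq> K" by (auto intro: subgroup.m_closed)
  qed
qed

section \<open>Involutions in extensions built by adjoining elements one at a time\<close>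

lemma generate_idem_Un:
  assumes "A \<subseteq> carrier G" "B \<subseteq> carrier G"
  shows "generate G (generate G A \<union> B) = generate G (A \<union> B)"
proof (rule equalityI)
  have s: "subgroup (generate G (A \<union> B)) G" using assms by (auto intro: generate_is_subgroup)
  show "generate G (generate G A \<union> B) \<subseteq> generate G (A \<union> B)"
    by (rule generate_subgroup_incl[OF _ s]) (auto intro: generate.incl mono_generate[THEN subsetD, rotated])
  show "generate G (A \<union> B) \<subseteq> generate G (generate G A \<union> B)"
    by (rule mono_generate) (auto intro: generate.incl)
qed

text \<open>Normality of \<open>N\<close> lets the powers of \<open>s\<close> be moved to the right.
  Natural exponents suffice because the group is finite.\<close>

lemma generate_insert_normal:
  assumes fin: "finite (carrier G)" and N: "subgroup N G" and s: "s \<in> carrier G"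
    and conj: "\<And>n g. n \<in> N \<Longrightarrow> g \<in> carrier G \<Longrightarrow> g \<otimes> n \<otimes> inv g \<in> N"
  shows "generate G (insert s N) = {n \<otimes> s [^] i |n (i::nat). n \<in> N}"
proof -
  have sub: "N \<subseteq> carrier G" using N by (rule subgroup.subset)
  let ?U = "{n \<otimes> s [^] i |n (i::nat). n \<in> N}"
  have 1: "subgroup ?U G"
  proof (rule finite_subgroupI)
    fix u v assume "u \<in> ?U" "v \<in> ?U"
    then obtain n i m j where u: "u = n \<otimes> s [^] (i::nat)" "n \<in> N" and v: "v = m \<otimes> s [^] (j::nat)" "m \<in> N" by blast
    have "u \<otimes> v = (n \<otimes> (s [^] i \<otimes> m \<otimes> inv (s [^] i))) \<otimes> s [^] (i + j)"
      using u v s sub by (simp add: words subsetD flip: nat_pow_mult)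
    moreover have "n \<otimes> (s [^] i \<otimes> m \<otimes> inv (s [^] i)) \<in> N"
      using u v s conj N by (auto intro: subgroup.m_closed)
    ultimately show "u \<otimes> v \<in> ?U" by blast
  next
    show "?U \<noteq> {}" using subgroup.one_closed[OF N] by blast
  qed (use fin sub s in auto)
  show ?thesis
  proof (rule generateI[OF 1, symmetric])
    have "s = \<one> \<otimes> s [^] (1::nat)" "n = n \<otimes> s [^] (0::nat)" if "n \<in> N" for n
      using s sub that by auto
    then show "insert s N \<subseteq> ?U" using subgroup.one_closed[OF N] by blast
  next
    fix K assume K: "subgroup K G" "insert s N \<subseteq> K"
    have "s [^] i \<in> K" for i :: nat
      by (induction i) (use K in \<open>auto intro: subgroup.m_closed subgroup.one_closed\<close>)
    then show "?U \<subseteq> K" using K by (auto intro: subgroup.m_closed)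
  qed
qed

text \<open>The number \<open>t\<close> is the least positive exponent with \<open>s [^] t\<close>
  in \<open>N\<close>; division with remainder does the rest.\<close>

lemma pow_mem_dvd:
  assumes fin: "finite (carrier G)" and N: "subgroup N G" and s: "s \<in> carrier G"
  obtains t :: nat where "\<And>i :: nat. s [^] i \<in> N \<longleftrightarrow> t dvd i"
proof -
  define t where "t = (LEAST t. 0 < t \<and> s [^] (t::nat) \<in> N)"
  have "order G > 0" using fin order_gt_0_iff_finite by blast
  then have "0 < order G \<and> s [^] order G \<in> N"
    using s N by (simp add: pow_order_eq_1 subgroup.one_closed)
  then have t: "0 < t \<and> s [^] t \<in> N" unfolding t_def by (rule LeastI)
  have mult: "s [^] (t * q) \<in> N" for q
  proof (induction q)
    case (Suc q)
    then show ?case using t N s by (auto intro: subgroup.m_closed simp flip: nat_pow_mult)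
  qed (use N in \<open>auto intro: subgroup.one_closed\<close>)
  have "s [^] i \<in> N \<longleftrightarrow> t dvd i" for i :: nat
  proof
    assume i: "s [^] i \<in> N"
    have "s [^] i = s [^] (t * (i div t)) \<otimes> s [^] (i mod t)"
      using s by (simp add: nat_pow_mult)
    then have "s [^] (i mod t) = inv (s [^] (t * (i div t))) \<otimes> s [^] i"
      using s by (simp add: cancel_words)
    then have "s [^] (i mod t) \<in> N"
      using i mult N by (auto intro: subgroup.m_closed subgroup.m_inv_closed)
    moreover have "i mod t < t" using t by simp
    ultimately have "i mod t = 0"
      using not_less_Least[of "i mod t" "\<lambda>t. 0 < t \<and> s [^] t \<in> N"] unfolding t_def by auto
    then show "t dvd i" by auto
  next
    assume "t dvd i"
    then show "s [^] i \<in> N" using mult by (auto elim: dvdE)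
  qed
  then show ?thesis by (rule that)
qed

text \<open>The quotient by \<open>N\<close> of the subgroup generated by \<open>N\<close> and \<open>s\<close> is cyclic, so it has at most
  one involution.\<close>

lemma involutions_cyclic_extension:
  assumes fin: "finite (carrier G)" and N: "subgroup N G" and s: "s \<in> carrier G"
    and conj: "\<And>n g. n \<in> N \<Longrightarrow> g \<in> carrier G \<Longrightarrow> g \<otimes> n \<otimes> inv g \<in> N"
    and a: "a \<in> generate G (insert s N)" "a \<notin> N" "a \<otimes> a \<in> N"
    and b: "b \<in> generate G (insert s N)" "b \<notin> N" "b \<otimes> b \<in> N"
  shows "a \<otimes> b \<in> N"
proof -
  have sub: "N \<subseteq> carrier G" using N by (rule subgroup.subset)
  obtain t :: nat where t: "\<And>i :: nat. s [^] i \<in> N \<longleftrightarrow> t dvd i"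
    using pow_mem_dvd[OF fin N s] by blast
  have mult: "(n \<otimes> s [^] i) \<otimes> (m \<otimes> s [^] j) \<in> N \<longleftrightarrow> t dvd i + j" if n: "n \<in> N" and m: "m \<in> N" for n m and i j :: nat
  proof -
    let ?c = "n \<otimes> (s [^] i \<otimes> m \<otimes> inv (s [^] i))"
    have "(n \<otimes> s [^] i) \<otimes> (m \<otimes> s [^] j) = ?c \<otimes> s [^] (i + j)"
      using n m s sub by (simp add: words subsetD flip: nat_pow_mult)
    moreover have c: "?c \<in> N"
      using n m s conj N by (auto intro: subgroup.m_closed)
    have "?c \<otimes> s [^] (i + j) \<in> N \<longleftrightarrow> s [^] (i + j) \<in> N"
    proof
      assume "?c \<otimes> s [^] (i + j) \<in> N"
      then have "inv ?c \<otimes> (?c \<otimes> s [^] (i + j)) \<in> N"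
        using c N by (blast intro: subgroup.m_closed subgroup.m_inv_closed)
      then show "s [^] (i + j) \<in> N" using c sub s by (simp add: cancel_words(2) subsetD)
    qed (use c N in \<open>auto intro: subgroup.m_closed\<close>)
    ultimately show ?thesis using t by simp
  qed
  have mem: "n \<otimes> s [^] i \<in> N \<longleftrightarrow> t dvd i" if "n \<in> N" for n and i :: nat
    using mult[of \<one> n 0 i] that N sub s by (simp add: subgroup.one_closed subsetD)
  note gen = generate_insert_normal[OF fin N s conj]
  obtain n i where n: "a = n \<otimes> s [^] (i::nat)" "n \<in> N" using a(1) gen by auto
  obtain m j where m: "b = m \<otimes> s [^] (j::nat)" "m \<in> N" using b(1) gen by auto
  have dvds: "t dvd i + i" "\<not> t dvd i" "t dvd j + j" "\<not> t dvd j"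
    using a b n m mult mem by auto
  \<comment> \<open>Both \<open>i\<close> and \<open>j\<close> turn out to be odd multiples of
    \<open>t / 2\<close>, so their sum is a multiple of \<open>t\<close>.\<close>
  have half: "\<exists>p. k + k = t * p \<and> odd p" if dv: "t dvd k + k" "\<not> t dvd k" for k
  proof -
    obtain p where p: "k + k = t * p" using dv(1) by (rule dvdE)
    have "odd p"
    proof
      assume "even p"
      then obtain r where "p = 2 * r" by (rule evenE)
      then have "k = t * r" using p by simp
      then show False using dv(2) by simp
    qed
    then show ?thesis using p by blast
  qed
  obtain p where p: "i + i = t * p" "odd p" using half dvds by blast
  obtain q where q: "j + j = t * q" "odd q" using half dvds by blast
  obtain r where r: "p + q = 2 * r" using p q by (meson evenE odd_even_add)
  have "2 * (i + j) = t * (p + q)" using p(1) q(1) by (simp add: distrib_left)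
  then have "i + j = t * r" by (simp add: r)
  then have "t dvd i + j" by simp
  then show ?thesis using mult n m by simp
qed

text \<open>Two elements of \<open>K\<close> in the cyclic extension that lie outside
  \<open>N\<close> multiply into \<open>N\<close>. So all of them fill at most one further coset of
  \<open>K \<inter> N\<close>.\<close>

lemma card_involutions_insert:
  assumes fin: "finite (carrier G)" and N: "subgroup N G" and s: "s \<in> carrier G"
    and conj: "\<And>n g. n \<in> N \<Longrightarrow> g \<in> carrier G \<Longrightarrow> g \<otimes> n \<otimes> inv g \<in> N"
    and K: "subgroup K G" "\<And>k. k \<in> K \<Longrightarrow> k \<otimes> k \<in> N"
  shows "card (K \<inter> generate G (insert s N)) \<le> 2 * card (K \<inter> N)"
proof -
  have sub: "N \<subseteq> carrier G" "K \<subseteq> carrier G" using N K by (auto dest: subgroup.subset)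
  have finK: "finite (K \<inter> N)" using sub fin finite_subset by blast
  show ?thesis
  proof (cases "K \<inter> generate G (insert s N) \<subseteq> N")
    case True
    then have "card (K \<inter> generate G (insert s N)) \<le> card (K \<inter> N)"
      by (intro card_mono finK) auto
    then show ?thesis by simp
  next
    case False
    then obtain c where c: "c \<in> K" "c \<in> generate G (insert s N)" "c \<notin> N" by auto
    have "K \<inter> generate G (insert s N) \<subseteq> (K \<inter> N) \<union> (\<lambda>n. n \<otimes> inv c) ` (K \<inter> N)"
    proof
      fix k assume k: "k \<in> K \<inter> generate G (insert s N)"
      show "k \<in> (K \<inter> N) \<union> (\<lambda>n. n \<otimes> inv c) ` (K \<inter> N)"
      proof (cases "k \<in> N")
        case False
        then have "k \<otimes> c \<in> N"
          using involutions_cyclic_extension[OF fin N s conj, of k c] k c K by auto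
        moreover have "k \<otimes> c \<in> K" using k c K by (auto intro: subgroup.m_closed)
        moreover have "k = (k \<otimes> c) \<otimes> inv c" using k c sub by (auto simp: m_assoc subsetD)
        ultimately show ?thesis by blast
      qed (use k in auto)
    qed
    then have "card (K \<inter> generate G (insert s N)) \<le> card ((K \<inter> N) \<union> (\<lambda>n. n \<otimes> inv c) ` (K \<inter> N))"
      using finK by (intro card_mono) auto
    also have "\<dots> \<le> card (K \<inter> N) + card ((\<lambda>n. n \<otimes> inv c) ` (K \<inter> N))" by (rule card_Un_le)
    also have "\<dots> \<le> card (K \<inter> N) + card (K \<inter> N)" using finK by (intro add_left_mono card_image_le)
    finally show ?thesis by simp
  qed
qed

text \<open>Adding the generators one at a time builds a series with cyclic factors, each
  contributing a factor of at most 2. Since the order of adding them is left open, every subset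
  \<open>T\<close> has to generate a normal subgroup together with \<open>N\<close>.\<close>

lemma card_involutions_generate:
  assumes fin: "finite (carrier G)" and N: "subgroup N G" and S: "finite S" "S \<subseteq> carrier G"
    and conj: "\<And>T n g. T \<subseteq> S \<Longrightarrow> n \<in> generate G (N \<union> T) \<Longrightarrow> g \<in> carrier G \<Longrightarrow> g \<otimes> n \<otimes> inv g \<in> generate G (N \<union> T)"
    and K: "subgroup K G" "\<And>k. k \<in> K \<Longrightarrow> k \<otimes> k \<in> N"
  shows "card (K \<inter> generate G (N \<union> S)) \<le> 2 ^ card S * card (K \<inter> N)"
  using S conj
proof (induction S rule: finite_induct)
  case empty
  have "generate G N = N" using generateI[OF N, of N] by auto
  then show ?case by simp
next
  case (insert s S)
  have sub: "N \<subseteq> carrier G" using N by (rule subgroup.subset)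
  have M: "subgroup (generate G (N \<union> S)) G" using insert.prems sub by (intro generate_is_subgroup) auto
  have "generate G (N \<union> insert s S) = generate G (insert s (generate G (N \<union> S)))"
    using generate_idem_Un[of "N \<union> S" "{s}"] insert.prems sub by simp
  then have "card (K \<inter> generate G (N \<union> insert s S)) = card (K \<inter> generate G (insert s (generate G (N \<union> S))))"
    by simp
  also have "\<dots> \<le> 2 * card (K \<inter> generate G (N \<union> S))"
  proof (rule card_involutions_insert[OF fin M _ _ K(1)])
    fix n g assume "n \<in> generate G (N \<union> S)" "g \<in> carrier G"
    then show "g \<otimes> n \<otimes> inv g \<in> generate G (N \<union> S)" using insert.prems(2)[of S] by blast
  next
    fix k assume "k \<in> K" then show "k \<otimes> k \<in> generate G (N \<union> S)" using K(2) by (auto intro: generate.incl)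
  qed (use insert.prems in auto)
  also have "\<dots> \<le> 2 * (2 ^ card S * card (K \<inter> N))"
    using insert.IH insert.prems(1) insert.prems(2) by (intro mult_left_mono) (auto simp: subset_insertI2)
  finally show ?case using insert.hyps by simp
qed

end

section \<open>Two-groups of class at most three\<close>

text \<open>The class is at most three, and not exactly three, so that the center, as a group with
  restricted carrier, is an instance as well.\<close>

locale class3_two_group = group +
  assumes finite_carrier: "finite (carrier G)"
    and order_two_power: "\<exists>n. order G = 2 ^ n"
    and com_com_central: "\<And>x y z. x \<in> carrier G \<Longrightarrow> y \<in> carrier G \<Longrightarrow> z \<in> carrier G \<Longrightarrow> com (com x y) z \<in> center G"
begin

definition Z2 :: "'a set" where
  "Z2 = {g \<in> carrier G. \<forall>x\<in>carrier G. com g x \<in> center G}"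

text \<open>For the groups of this locale this is the Frattini subgroup:
  \<open>maximal_subgroup_square\<close> puts it into every maximal subgroup, and
  \<open>frattini_subset_Phi\<close> gives the converse inclusion.\<close>

definition Phi :: "'a set" where
  "Phi = generate G {x \<otimes> x |x. x \<in> carrier G}"

lemma finite_sub: "A \<subseteq> carrier G \<Longrightarrow> finite A"
  using finite_carrier finite_subset by blast

lemma subgroup_mult_closedI:
  "H \<subseteq> carrier G \<Longrightarrow> \<one> \<in> H \<Longrightarrow> (\<And>x y. x \<in> H \<Longrightarrow> y \<in> H \<Longrightarrow> x \<otimes> y \<in> H) \<Longrightarrow> subgroup H G"
  using finite_subgroupI[OF finite_carrier] by blast

lemma generate_carrier_induct:
  assumes "generate G S = carrier G" "x \<in> carrier G" "P \<one>" "\<And>x. x \<in> S \<Longrightarrow> P x" "S \<subseteq> carrier G"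
    "\<And>x y. x \<in> carrier G \<Longrightarrow> y \<in> carrier G \<Longrightarrow> P x \<Longrightarrow> P y \<Longrightarrow> P (x \<otimes> y)"
  shows "P x"
proof -
  have "subgroup {x \<in> carrier G. P x} G"
    by (rule subgroup_mult_closedI) (use assms in auto)
  then have "generate G S \<subseteq> {x \<in> carrier G. P x}"
    using assms by (intro generate_subgroup_incl) auto
  then show ?thesis using assms by auto
qed

lemma Z2_carrier: "g \<in> Z2 \<Longrightarrow> g \<in> carrier G"
  by (simp add: Z2_def)

lemma com_Z2: "g \<in> Z2 \<Longrightarrow> x \<in> carrier G \<Longrightarrow> com g x \<in> center G"
  by (simp add: Z2_def)

lemma com_Z2_right: "g \<in> Z2 \<Longrightarrow> x \<in> carrier G \<Longrightarrow> com x g \<in> center G"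
  using com_Z2[of g x] subgroup.m_inv_closed[OF subgroup_center] com_inverse[of g x] Z2_carrier by metis

lemma com_in_Z2: "x \<in> carrier G \<Longrightarrow> y \<in> carrier G \<Longrightarrow> com x y \<in> Z2"
  by (simp add: Z2_def com_com_central)

lemma center_subset_Z2: "center G \<subseteq> Z2"
  by (auto simp: Z2_def com_center centerD(1) subgroup.one_closed[OF subgroup_center])

text \<open>The conjugation in \<open>com_mult_left\<close> disappears because
  \<open>com h x\<close> is central.\<close>

lemma com_left_mult_Z2:
  assumes "g \<in> carrier G" "h \<in> Z2" "x \<in> carrier G"
  shows "com (g \<otimes> h) x = com h x \<otimes> com g x"
  using assms com_Z2[of h x] by (simp add: com_mult_left conj_center Z2_carrier)

lemma com_right_mult_Z2:
  assumes "g \<in> Z2" "x \<in> carrier G" "y \<in> carrier G"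
  shows "com g (x \<otimes> y) = com g x \<otimes> com g y"
  using assms com_Z2[of g y] by (simp add: com_mult_right conj_center Z2_carrier)

lemma com_right_mult_Z2':
  assumes "x \<in> carrier G" "g \<in> carrier G" "h \<in> Z2"
  shows "com x (g \<otimes> h) = com x g \<otimes> com x h"
  using assms com_Z2_right[of h x] by (simp add: com_mult_right conj_center Z2_carrier)

lemma subgroup_Z2: "subgroup Z2 G"
proof (rule subgroup_mult_closedI)
  fix g h assume "g \<in> Z2" "h \<in> Z2"
  then show "g \<otimes> h \<in> Z2"
    unfolding Z2_def
    by (auto simp: com_left_mult_Z2 Z2_def intro!: subgroup.m_closed[OF subgroup_center])
qed (use center_subset_Z2 subgroup.one_closed[OF subgroup_center] Z2_carrier in auto)

lemma pow_order_two: obtains n :: nat where "order G = 2 ^ n" "\<And>x. x \<in> carrier G \<Longrightarrow> x [^] ((2::nat) ^ n) = \<one>"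
  using order_two_power pow_order_eq_1 by metis

text \<open>A maximal subgroup \<open>M\<close> is normal: if it misses a term of the series
  \<open>center G \<le> Z2 \<le> carrier G\<close>, an element outside \<open>M\<close> of the first such term normalizes \<open>M\<close>.\<close>

lemma maximal_subgroup_square:
  assumes M: "maximal_subgroup M G" and x: "x \<in> carrier G"
  shows "x \<otimes> x \<in> M"
proof (rule ccontr)
  assume nx: "x \<otimes> x \<notin> M"
  have sM: "subgroup M G" and neq: "M \<noteq> carrier G"
    and max: "\<And>H. subgroup H G \<Longrightarrow> M \<subseteq> H \<Longrightarrow> H = M \<or> H = carrier G"
    using M by (auto simp: maximal_subgroup_def)
  have sub: "M \<subseteq> carrier G" using sM by (rule subgroup.subset)
  obtain s where s: "s \<in> carrier G" "s \<notin> M" "\<And>m. m \<in> M \<Longrightarrow> com s m \<in> M"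
  proof -
    consider s where "s \<in> center G" "s \<notin> M" | s where "s \<in> Z2" "s \<notin> M" "center G \<subseteq> M" | "Z2 \<subseteq> M" by auto
    then show thesis
    proof cases
      case (1 s)
      then show ?thesis
        using that[of s] sub by (auto simp: com_center centerD(1) subgroup.one_closed[OF sM] subsetD)
    next
      case (2 s)
      then show ?thesis
        using that[of s] sub com_Z2[of s] Z2_carrier by (auto simp: subset_iff)
    next
      case 3
      obtain s where "s \<in> carrier G" "s \<notin> M" using neq sub by auto
      then show ?thesis using that[of s] 3 sub com_in_Z2[of s] by (auto simp: subset_iff)
    qed
  qed
  \<comment> \<open>This is the normalizer of \<open>M\<close>. It contains \<open>M\<close> and
    also \<open>s\<close>, so by maximality it is the whole group.\<close>
  let ?N = "{g \<in> carrier G. \<forall>m\<in>M. g \<otimes> m \<otimes> inv g \<in> M}"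
  have sN: "subgroup ?N G"
  proof (rule subgroup_mult_closedI)
    fix g h assume "g \<in> ?N" "h \<in> ?N"
    moreover have "g \<otimes> h \<otimes> m \<otimes> inv (g \<otimes> h) = g \<otimes> (h \<otimes> m \<otimes> inv h) \<otimes> inv g"
      if "m \<in> M" "g \<in> carrier G" "h \<in> carrier G" for m
      using that sub by (simp add: words subsetD)
    ultimately show "g \<otimes> h \<in> ?N" by auto
  qed (use sub in \<open>auto simp: subsetD\<close>)
  have "M \<subseteq> ?N" using sM sub by (auto intro: subgroup.m_closed subgroup.m_inv_closed)
  moreover have "s \<in> ?N"
    using s sub sM by (auto simp: conj_com subsetD intro: subgroup.m_closed)
  ultimately have "?N = carrier G" using max[OF sN] s by auto
  then have conj: "g \<otimes> m \<otimes> inv g \<in> M" if "g \<in> carrier G" "m \<in> M" for g m using that by blast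
  obtain n :: nat where n: "x [^] ((2::nat) ^ n) = \<one>" using pow_order_two x by metis
  \<comment> \<open>Repeated squaring of \<open>x\<close> ends in \<open>M\<close>. The last power
    \<open>y\<close> before that is outside \<open>M\<close> with its square inside.\<close>
  define k where "k = (LEAST k. x [^] ((2::nat) ^ k) \<in> M)"
  have k: "x [^] ((2::nat) ^ k) \<in> M"
    unfolding k_def by (rule LeastI[of _ n]) (simp add: n subgroup.one_closed[OF sM])
  have "k \<noteq> 0"
  proof
    assume "k = 0"
    then have "x \<in> M" using k x by simp
    then show False using nx sM by (auto intro: subgroup.m_closed)
  qed
  define y where "y = x [^] ((2::nat) ^ (k - 1))"
  have yc: "y \<in> carrier G" using x by (simp add: y_def)
  have ny: "y \<notin> M" using not_less_Least[of "k - 1" "\<lambda>k. x [^] ((2::nat) ^ k) \<in> M"] \<open>k \<noteq> 0\<close>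
    unfolding y_def k_def by simp
  have "y \<otimes> y = x [^] ((2::nat) ^ k)"
    unfolding y_def using x \<open>k \<noteq> 0\<close> by (cases k) (simp_all add: nat_pow_mult mult_2)
  then have yy: "y \<otimes> y \<in> M" using k by simp
  \<comment> \<open>Maximality turns this union of two cosets into all of \<open>G\<close>, so
    \<open>M\<close> has index two and contains every square.\<close>
  have gen: "generate G (insert y M) = M \<union> {h \<otimes> y |h. h \<in> M}"
    by (rule adjoin_involution[OF finite_carrier sM yc yy]) (use conj yc in auto)
  have "subgroup (generate G (insert y M)) G" using yc sub by (intro generate_is_subgroup) auto
  moreover have "M \<subseteq> generate G (insert y M)" "y \<in> generate G (insert y M)" by (auto intro: generate.incl)
  ultimately have "generate G (insert y M) = carrier G" using max ny by blast
  then have "x \<in> M \<union> {h \<otimes> y |h. h \<in> M}" using gen x by simp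
  then show False
  proof
    assume "x \<in> M" then show False using nx sM by (auto intro: subgroup.m_closed)
  next
    assume "x \<in> {h \<otimes> y |h. h \<in> M}"
    then obtain h where h: "x = h \<otimes> y" "h \<in> M" by auto
    have "x \<otimes> x = h \<otimes> ((y \<otimes> h \<otimes> inv y) \<otimes> (y \<otimes> y))" using h yc sub by (simp add: words subsetD)
    moreover have "h \<otimes> ((y \<otimes> h \<otimes> inv y) \<otimes> (y \<otimes> y)) \<in> M"
      using h yy conj[OF yc, of h] sM by (auto intro: subgroup.m_closed)
    ultimately show False using nx by simp
  qed
qed

lemma subgroup_Phi: "subgroup Phi G"
  unfolding Phi_def by (rule generate_is_subgroup) auto

lemma Phi_carrier: "Phi \<subseteq> carrier G"
  using subgroup_Phi by (rule subgroup.subset)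

lemma square_Phi: "x \<in> carrier G \<Longrightarrow> x \<otimes> x \<in> Phi"
  unfolding Phi_def by (auto intro: generate.incl)

text \<open>A commutator is a product of three squares, those of \<open>x\<close>,
  \<open>inv x \<otimes> y\<close> and \<open>inv y\<close>.\<close>

lemma com_Phi: assumes x: "x \<in> carrier G" and y: "y \<in> carrier G" shows "com x y \<in> Phi"
proof -
  have "com x y = (x \<otimes> x) \<otimes> ((inv x \<otimes> y) \<otimes> (inv x \<otimes> y)) \<otimes> (inv y \<otimes> inv y)"
    using x y by (simp add: com_def words)
  then show ?thesis
    using x y by (simp add: square_Phi subgroup.m_closed[OF subgroup_Phi])
qed

lemma subset_Phi_induct:
  assumes "subgroup H G" "\<And>x. x \<in> carrier G \<Longrightarrow> x \<otimes> x \<in> H"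
  shows "Phi \<subseteq> H"
  unfolding Phi_def using assms by (intro generate_subgroup_incl) auto

lemma conj_closed_of_com:
  assumes "subgroup H G" "\<And>h g. h \<in> H \<Longrightarrow> g \<in> carrier G \<Longrightarrow> com g h \<in> H" "h \<in> H" "g \<in> carrier G"
  shows "g \<otimes> h \<otimes> inv g \<in> H"
  using assms by (metis conj_com subgroup.mem_carrier subgroup.m_closed)

lemma conj_closed_of_Phi:
  assumes "subgroup H G" "Phi \<subseteq> H" "h \<in> H" "g \<in> carrier G"
  shows "g \<otimes> h \<otimes> inv g \<in> H"
  using assms by (intro conj_closed_of_com) (auto intro!: com_Phi[THEN subsetD[OF assms(2)]] simp: subgroup.mem_carrier)

lemma adjoin_Phi:
  assumes "subgroup H G" "Phi \<subseteq> H" "y \<in> carrier G"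
  shows "generate G (insert y H) = H \<union> {h \<otimes> y |h. h \<in> H}"
  using assms by (intro adjoin_involution finite_carrier) (auto intro: conj_closed_of_Phi square_Phi[THEN subsetD[OF assms(2)]])

lemma exists_maximal_subgroup:
  assumes "subgroup H G" "H \<noteq> carrier G"
  shows "\<exists>M. maximal_subgroup M G \<and> H \<subseteq> M"
proof -
  let ?S = "{M. subgroup M G \<and> H \<subseteq> M \<and> M \<noteq> carrier G}"
  have "finite ?S" by (rule finite_subset[of _ "Pow (carrier G)"]) (auto simp: finite_carrier dest: subgroup.subset)
  moreover have "?S \<noteq> {}" using assms by auto
  ultimately have "\<exists>M\<in>?S. \<forall>M'\<in>?S. M \<subseteq> M' \<longrightarrow> M = M'" by (rule finite_has_maximal)
  then obtain M where M: "M \<in> ?S" "\<And>M'. M' \<in> ?S \<Longrightarrow> M \<subseteq> M' \<Longrightarrow> M = M'" by auto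
  then have "maximal_subgroup M G" unfolding maximal_subgroup_def by blast
  then show ?thesis using M(1) by blast
qed

text \<open>The elements of \<open>Phi\<close> are non-generators: if \<open>S\<close> generated a
  proper subgroup, this would lie in a maximal subgroup, which contains \<open>Phi\<close>
  too.\<close>

lemma generate_modulo_Phi:
  assumes "S \<subseteq> carrier G" "generate G (Phi \<union> S) = carrier G"
  shows "generate G S = carrier G"
proof (rule ccontr)
  assume "generate G S \<noteq> carrier G"
  then obtain M where M: "maximal_subgroup M G" "generate G S \<subseteq> M"
    using exists_maximal_subgroup[OF generate_is_subgroup[OF assms(1)]] by blast
  then have sM: "subgroup M G" and "M \<noteq> carrier G" by (auto simp: maximal_subgroup_def)
  moreover have "Phi \<subseteq> M" using maximal_subgroup_square[OF M(1)] by (rule subset_Phi_induct[OF sM])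
  moreover have "S \<subseteq> M" using M(2) by (auto intro: generate.incl)
  ultimately show False using generate_subgroup_incl[of "Phi \<union> S" M] assms(2) subgroup.subset[OF sM] by auto
qed

text \<open>In the vector space \<open>G / Phi\<close> over the field of two elements this is a
  hyperplane containing a given subspace and missing a given vector. Take \<open>M\<close> maximal
  among the subgroups containing \<open>H\<close> and missing \<open>x\<close>; adjoining an element
  \<open>g\<close> outside \<open>M\<close> captures \<open>x\<close>, so \<open>g\<close> lies in
  \<open>M x\<close>.\<close>

lemma index_two_avoiding:
  assumes "subgroup H G" "Phi \<subseteq> H" "x \<in> carrier G" "x \<notin> H"
  obtains M where "subgroup M G" "H \<subseteq> M" "x \<notin> M" "carrier G = M \<union> {m \<otimes> x |m. m \<in> M}"
proof -
  let ?S = "{M. subgroup M G \<and> H \<subseteq> M \<and> x \<notin> M}"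
  have "finite ?S" by (rule finite_subset[of _ "Pow (carrier G)"]) (auto simp: finite_carrier dest: subgroup.subset)
  moreover have "?S \<noteq> {}" using assms by auto
  ultimately have "\<exists>M\<in>?S. \<forall>M'\<in>?S. M \<subseteq> M' \<longrightarrow> M = M'" by (rule finite_has_maximal)
  then obtain M where M: "M \<in> ?S" and max: "\<And>M'. M' \<in> ?S \<Longrightarrow> M \<subseteq> M' \<Longrightarrow> M = M'" by auto
  have sM: "subgroup M G" and HM: "H \<subseteq> M" and xM: "x \<notin> M" using M by auto
  have sub: "M \<subseteq> carrier G" using sM by (rule subgroup.subset)
  have PM: "Phi \<subseteq> M" using HM assms(2) by auto
  have "g \<in> M \<union> {m \<otimes> x |m. m \<in> M}" if g: "g \<in> carrier G" for g
  proof (cases "g \<in> M")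
    case False
    have gen: "generate G (insert g M) = M \<union> {h \<otimes> g |h. h \<in> M}" by (rule adjoin_Phi[OF sM PM g])
    have "subgroup (generate G (insert g M)) G" using g sub by (intro generate_is_subgroup) auto
    moreover have "M \<subseteq> generate G (insert g M)" "g \<in> generate G (insert g M)" by (auto intro: generate.incl)
    ultimately have "x \<in> generate G (insert g M)" using max[of "generate G (insert g M)"] HM False by blast
    then obtain h where h: "h \<in> M" "x = h \<otimes> g" using gen xM by auto
    then have "g = inv h \<otimes> x" using g sub by (simp add: cancel_words subsetD)
    then show ?thesis using h subgroup.m_inv_closed[OF sM] by blast
  qed auto
  then have "carrier G = M \<union> {m \<otimes> x |m. m \<in> M}" using sub assms(3) by auto
  then show thesis using that sM HM xM by blast
qed

text \<open>An \<open>x\<close> outside \<open>Phi\<close> is missed by some subgroup of index two,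
  which is maximal.\<close>

lemma frattini_subset_Phi: "frattini G \<subseteq> Phi"
proof
  fix x assume x: "x \<in> frattini G"
  show "x \<in> Phi"
  proof (rule ccontr)
    assume "x \<notin> Phi"
    moreover have xc: "x \<in> carrier G" using x by (simp add: frattini_def)
    ultimately obtain M where M: "subgroup M G" "x \<notin> M" and dec: "carrier G = M \<union> {m \<otimes> x |m. m \<in> M}"
      using index_two_avoiding[OF subgroup_Phi] by blast
    have "maximal_subgroup M G"
      unfolding maximal_subgroup_def
    proof (intro conjI allI impI)
      show "M \<noteq> carrier G" using M xc by auto
      fix H assume H: "subgroup H G" "M \<subseteq> H"
      show "H = M \<or> H = carrier G"
      proof (rule disjCI)
        assume "H \<noteq> carrier G"
        have "x \<notin> H"
        proof
          assume "x \<in> H"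
          then have "carrier G \<subseteq> H" using dec H by (auto intro: subgroup.m_closed)
          then show False using \<open>H \<noteq> carrier G\<close> subgroup.subset[OF H(1)] by auto
        qed
        have "h \<in> M" if h: "h \<in> H" for h
        proof (rule ccontr)
          assume "h \<notin> M"
          then obtain m where m: "m \<in> M" "h = m \<otimes> x" using dec h subgroup.subset[OF H(1)] by blast
          then have "x = inv m \<otimes> h" using subgroup.mem_carrier[OF M(1)] xc by (simp add: cancel_words)
          moreover have "inv m \<otimes> h \<in> H" using m(1) h H by (blast intro: subgroup.m_closed subgroup.m_inv_closed)
          ultimately show False using \<open>x \<notin> H\<close> by simp
        qed
        then show "H = M" using H by auto
      qed
    qed (use M in auto)
    then show False using x M(2) by (auto simp: frattini_def)
  qed
qed

section \<open>Dimension modulo \<open>Phi\<close> and the number of generators\<close>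

lemma card_adjoin_Phi:
  assumes "subgroup H G" "Phi \<subseteq> H" "y \<in> carrier G"
  shows "card (generate G (insert y H)) \<le> 2 * card H"
    and "y \<notin> H \<Longrightarrow> card (generate G (insert y H)) = 2 * card H"
proof -
  have sub: "H \<subseteq> carrier G" using assms(1) by (rule subgroup.subset)
  have eq: "{h \<otimes> y |h. h \<in> H} = (\<lambda>h. h \<otimes> y) ` H" by auto
  have "inj_on (\<lambda>h. h \<otimes> y) H" using sub assms(3) by (intro inj_onI) (simp add: subsetD)
  then have c: "card {h \<otimes> y |h. h \<in> H} = card H" unfolding eq by (rule card_image)
  have fin: "finite H" "finite {h \<otimes> y |h. h \<in> H}" using finite_sub[OF sub] eq by auto
  show "card (generate G (insert y H)) \<le> 2 * card H"
    unfolding adjoin_Phi[OF assms] using card_Un_le[of H "{h \<otimes> y |h. h \<in> H}"] c by simp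
  assume y: "y \<notin> H"
  have "h \<otimes> y \<notin> H" if "h \<in> H" for h
  proof
    assume "h \<otimes> y \<in> H"
    then have "inv h \<otimes> (h \<otimes> y) \<in> H" using that assms(1) by (blast intro: subgroup.m_closed subgroup.m_inv_closed)
    then show False using y that sub assms(3) by (simp add: cancel_words subsetD)
  qed
  then have "H \<inter> {h \<otimes> y |h. h \<in> H} = {}" by auto
  then show "card (generate G (insert y H)) = 2 * card H"
    unfolding adjoin_Phi[OF assms] using card_Un_disjoint[OF fin] c by simp
qed

lemma card_generate_Phi_le:
  assumes "subgroup N G" "Phi \<subseteq> N" "finite S" "S \<subseteq> carrier G"
  shows "card (generate G (N \<union> S)) \<le> 2 ^ card S * card N"
  using assms(3,4)
proof (induction S rule: finite_induct)
  case empty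
  then show ?case using generateI[OF assms(1), of N] by auto
next
  case (insert s S)
  have sub: "N \<union> S \<subseteq> carrier G" using insert.prems subgroup.subset[OF assms(1)] by auto
  have "generate G (N \<union> insert s S) = generate G (insert s (generate G (N \<union> S)))"
    using generate_idem_Un[of "N \<union> S" "{s}"] insert.prems sub by simp
  then have "card (generate G (N \<union> insert s S)) = card (generate G (insert s (generate G (N \<union> S))))" by simp
  also have "\<dots> \<le> 2 * card (generate G (N \<union> S))"
    by (rule card_adjoin_Phi(1)) (use insert.prems sub assms(2) in \<open>auto intro: generate_is_subgroup generate.incl\<close>)
  also have "\<dots> \<le> 2 * (2 ^ card S * card N)" using insert by (intro mult_left_mono) auto
  finally show ?case using insert.hyps by simp
qed

text \<open>Linear independence modulo \<open>N\<close>, for \<open>N\<close> containing \<open>Phi\<close>.\<close>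

definition independent :: "'a set \<Rightarrow> nat \<Rightarrow> (nat \<Rightarrow> 'a) \<Rightarrow> bool" where
  "independent N k x \<longleftrightarrow> (\<forall>i<k. x i \<in> carrier G \<and> x i \<notin> generate G (N \<union> x ` {..<i}))"

lemma generate_Suc:
  assumes "N \<subseteq> carrier G" "\<And>i. i \<le> k \<Longrightarrow> x i \<in> carrier G"
  shows "generate G (N \<union> x ` {..<Suc k}) = generate G (insert (x k) (generate G (N \<union> x ` {..<k})))"
  using generate_idem_Un[of "N \<union> x ` {..<k}" "{x k}"] assms by (simp add: image_subset_iff lessThan_Suc)

lemma card_independent:
  assumes N: "subgroup N G" "Phi \<subseteq> N" and "independent N k x"
  shows "card (generate G (N \<union> x ` {..<k})) = 2 ^ k * card N"
  using assms(3)
proof (induction k)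
  case 0
  then show ?case using generateI[OF assms(1), of N] by auto
next
  case (Suc k)
  have sub: "N \<subseteq> carrier G" using N by (intro subgroup.subset)
  have x: "\<And>i. i \<le> k \<Longrightarrow> x i \<in> carrier G" "x k \<notin> generate G (N \<union> x ` {..<k})"
    using Suc.prems by (auto simp: independent_def less_Suc_eq_le)
  have "card (generate G (N \<union> x ` {..<Suc k})) = 2 * card (generate G (N \<union> x ` {..<k}))"
    unfolding generate_Suc[where k = k and x = x, OF sub x(1), simplified]
    by (rule card_adjoin_Phi(2)) (use x sub N(2) in \<open>auto intro!: generate_is_subgroup intro: generate.incl\<close>)
  moreover have "independent N k x" using Suc.prems by (simp add: independent_def)
  ultimately show ?case using Suc.IH by simp
qed

text \<open>An independent sequence that does not generate can be prolonged. One of length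
  \<open>k\<close> spans a subgroup with \<open>2 ^ k * card N\<close> elements, so the prolonging
  must stop.\<close>

lemma exists_basis:
  assumes N: "subgroup N G" "Phi \<subseteq> N"
  obtains d x where "independent N d x" "generate G (N \<union> x ` {..<d}) = carrier G" "card (carrier G) = 2 ^ d * card N"
proof -
  have sub: "N \<subseteq> carrier G" using N by (intro subgroup.subset)
  have pos: "card N > 0" using finite_sub[OF sub] subgroup.one_closed[OF N(1)] by (auto simp: card_gt_0_iff)
  have step: "(\<exists>d x. independent N d x \<and> generate G (N \<union> x ` {..<d}) = carrier G) \<or> (\<exists>x. independent N k x)" for k
  proof (induction k)
    case 0 show ?case by (auto simp: independent_def)
  next
    case (Suc k)
    show ?case
    proof (rule disjCI)
      assume no: "\<not> (\<exists>x. independent N (Suc k) x)"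
      show "\<exists>d x. independent N d x \<and> generate G (N \<union> x ` {..<d}) = carrier G"
      proof (rule ccontr)
        assume neg: "\<not> ?thesis"
        then obtain x where x: "independent N k x" using Suc by blast
        have "generate G (N \<union> x ` {..<k}) \<subseteq> carrier G"
          using x sub by (intro generate_incl) (auto simp: independent_def)
        then obtain y where y: "y \<in> carrier G" "y \<notin> generate G (N \<union> x ` {..<k})" using neg x by blast
        have im: "(x(k := y)) ` {..<i} = x ` {..<i}" if "i \<le> k" for i using that by auto
        have "independent N (Suc k) (x(k := y))"
          using x y unfolding independent_def by (auto simp: less_Suc_eq im simp del: fun_upd_apply image_cong) (auto simp: im simp del: image_cong)
        then show False using no by blast
      qed
    qed
  qed
  \<comment> \<open>The length \<open>card (carrier G)\<close> is too large because
    \<open>n < 2 ^ n\<close>.\<close>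
  have "\<not> independent N (card (carrier G)) x" for x
  proof
    assume i: "independent N (card (carrier G)) x"
    have "2 ^ card (carrier G) * card N \<le> card (carrier G)"
      unfolding card_independent[OF N i, symmetric]
      using i sub by (intro card_mono finite_carrier generate_incl) (auto simp: independent_def)
    moreover have "card (carrier G) < 2 ^ card (carrier G)" by (rule less_exp)
    moreover have "2 ^ card (carrier G) * 1 \<le> 2 ^ card (carrier G) * card N" using pos by (intro mult_left_mono) auto
    ultimately show False by linarith
  qed
  then obtain d x where "independent N d x" "generate G (N \<union> x ` {..<d}) = carrier G" using step by blast
  then show thesis using that card_independent[OF N] by metis
qed

text \<open>Burnside's basis theorem: a basis modulo \<open>Phi\<close> generates \<open>G\<close>,
  and fewer than \<open>d\<close> elements cannot, since each of them at most doubles the subgroup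
  spanned together with \<open>Phi\<close>.\<close>

lemma min_gens_eq:
  assumes "card (carrier G) = 2 ^ d * card Phi"
  shows "min_gens G = d"
proof -
  have pos: "card Phi > 0" using finite_sub[OF Phi_carrier] subgroup.one_closed[OF subgroup_Phi] by (auto simp: card_gt_0_iff)
  obtain e x where x: "independent Phi e x" "generate G (Phi \<union> x ` {..<e}) = carrier G" "card (carrier G) = 2 ^ e * card Phi"
    using exists_basis[OF subgroup_Phi] by blast
  have [simp]: "e = d" using x(3) assms pos by simp
  have xc: "x ` {..<d} \<subseteq> carrier G" using x(1) by (auto simp: independent_def)
  have ne: "x i \<noteq> x j" if "i < j" "j < d" for i j
    using x(1) that generate.incl[of "x i" "Phi \<union> x ` {..<j}" G] by (auto simp: independent_def)
  have "inj_on x {..<d}"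
    by (rule inj_onI) (metis lessThan_iff linorder_neqE_nat ne)
  then have "card (x ` {..<d}) = d" by (simp add: card_image)
  moreover have "generate G (x ` {..<d}) = carrier G" using generate_modulo_Phi[OF xc] x by simp
  ultimately have 1: "\<exists>S. S \<subseteq> carrier G \<and> finite S \<and> card S = d \<and> generate G S = carrier G"
    using xc by blast
  have 2: "d \<le> n" if n: "\<exists>S. S \<subseteq> carrier G \<and> finite S \<and> card S = n \<and> generate G S = carrier G" for n
  proof -
    obtain S where S: "S \<subseteq> carrier G" "finite S" "card S = n" "generate G S = carrier G" using n by blast
    have "carrier G \<subseteq> generate G (Phi \<union> S)" using S(4) mono_generate[of S "Phi \<union> S"] by auto
    then have "card (carrier G) \<le> card (generate G (Phi \<union> S))"
      using S Phi_carrier by (intro card_mono finite_sub generate_incl) auto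
    also have "\<dots> \<le> 2 ^ n * card Phi" using card_generate_Phi_le[OF subgroup_Phi, of S] S by auto
    finally show "d \<le> n" using assms pos by simp
  qed
  show ?thesis unfolding min_gens_def by (rule Least_equality) (use 1 2 in auto)
qed

end

section \<open>Derivations and automorphisms\<close>

context class3_two_group
begin

definition act :: "'a \<Rightarrow> 'a \<Rightarrow> 'a" where
  "act x v = x \<otimes> v \<otimes> inv x"

text \<open>The elements of order at most 2 in the center of \<open>Phi\<close>. They form an
  elementary abelian group on which \<open>Phi\<close> acts trivially by conjugation, hence a module
  for \<open>G / Phi\<close>.\<close>

definition V0 :: "'a set" where
  "V0 = {v \<in> Phi. v \<otimes> v = \<one> \<and> (\<forall>p\<in>Phi. v \<otimes> p = p \<otimes> v)}"

text \<open>A crossed homomorphism from \<open>N / Phi\<close> to \<open>V\<close>. The domain is a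
  parameter because derivations are extended one generator at a time.\<close>

definition derivation :: "'a set \<Rightarrow> 'a set \<Rightarrow> ('a \<Rightarrow> 'a) \<Rightarrow> bool" where
  "derivation V N f \<longleftrightarrow> (\<forall>x\<in>N. f x \<in> V) \<and> (\<forall>x\<in>N. \<forall>y\<in>N. f (x \<otimes> y) = f x \<otimes> act x (f y)) \<and> (\<forall>x\<in>Phi. f x = \<one>)"

lemma act_closed [simp]: "x \<in> carrier G \<Longrightarrow> v \<in> carrier G \<Longrightarrow> act x v \<in> carrier G"
  by (simp add: act_def)

lemma act_one [simp]: "x \<in> carrier G \<Longrightarrow> act x \<one> = \<one>" "v \<in> carrier G \<Longrightarrow> act \<one> v = v"
  by (simp_all add: act_def)

lemma act_mult: "x \<in> carrier G \<Longrightarrow> y \<in> carrier G \<Longrightarrow> v \<in> carrier G \<Longrightarrow> act (x \<otimes> y) v = act x (act y v)"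
  by (simp add: act_def words)

lemma act_distrib: "x \<in> carrier G \<Longrightarrow> u \<in> carrier G \<Longrightarrow> v \<in> carrier G \<Longrightarrow> act x (u \<otimes> v) = act x u \<otimes> act x v"
  by (simp add: act_def words)

lemma act_com: "x \<in> carrier G \<Longrightarrow> v \<in> carrier G \<Longrightarrow> act x v = com x v \<otimes> v"
  by (simp add: act_def conj_com)

lemma act_commute: "x \<in> carrier G \<Longrightarrow> v \<in> carrier G \<Longrightarrow> x \<otimes> v = v \<otimes> x \<Longrightarrow> act x v = v"
  by (simp add: act_def m_assoc)

lemma V0_D: "v \<in> V0 \<Longrightarrow> v \<in> Phi" "v \<in> V0 \<Longrightarrow> v \<in> carrier G" "v \<in> V0 \<Longrightarrow> v \<otimes> v = \<one>"
  "v \<in> V0 \<Longrightarrow> p \<in> Phi \<Longrightarrow> v \<otimes> p = p \<otimes> v"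
  using Phi_carrier by (auto simp: V0_def)

lemma V0_commute: "u \<in> V0 \<Longrightarrow> v \<in> V0 \<Longrightarrow> u \<otimes> v = v \<otimes> u"
  using V0_D by blast

lemma act_V0:
  assumes x: "x \<in> carrier G" and v: "v \<in> V0" shows "act x v \<in> V0"
proof -
  have 1: "act x v \<in> Phi" unfolding act_def using conj_closed_of_Phi[OF subgroup_Phi subset_refl] x v V0_D by blast
  have 2: "act x v \<otimes> act x v = \<one>" using x v V0_D by (simp flip: act_distrib)
  have "act x v \<otimes> p = p \<otimes> act x v" if p: "p \<in> Phi" for p
  proof -
    have pc: "p \<in> carrier G" using p Phi_carrier by auto
    let ?q = "inv x \<otimes> p \<otimes> inv (inv x)"
    have q: "?q \<in> Phi" using conj_closed_of_Phi[OF subgroup_Phi subset_refl p, of "inv x"] x by blast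
    have "p = act x ?q" using x pc by (simp add: act_def words)
    then have "act x v \<otimes> p = act x (v \<otimes> ?q)"
      using x v pc V0_D by (simp add: act_distrib)
    also have "v \<otimes> ?q = ?q \<otimes> v" using v q V0_D by blast
    also have "act x (?q \<otimes> v) = act x ?q \<otimes> act x v"
      using x v pc V0_D(2) by (intro act_distrib) auto
    also have "act x ?q = p" using \<open>p = act x ?q\<close> by simp
    finally show ?thesis .
  qed
  with 1 2 show ?thesis unfolding V0_def by blast
qed

lemma act_Phi: "p \<in> Phi \<Longrightarrow> v \<in> V0 \<Longrightarrow> act p v = v"
  using V0_D Phi_carrier by (intro act_commute) auto

text \<open>Interchanging \<open>x\<close> and \<open>y\<close> costs a commutator, which lies in
  \<open>Phi\<close> and acts trivially.\<close>

lemma act_swap: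
  assumes "x \<in> carrier G" "y \<in> carrier G" "v \<in> V0"
  shows "act x (act y v) = act y (act x v)"
proof -
  have "act x (act y v) = act (com x y \<otimes> y \<otimes> x) v"
    using assms V0_D(2) by (simp add: act_mult[symmetric] flip: mult_com)
  also have "\<dots> = act (com x y) (act y (act x v))"
    using assms V0_D(2) by (simp add: act_mult)
  also have "\<dots> = act y (act x v)"
    using assms by (intro act_Phi com_Phi act_V0)
  finally show ?thesis .
qed

lemma subgroup_V0: "subgroup V0 G"
proof (rule subgroup_mult_closedI)
  show "\<one> \<in> V0" using Phi_carrier subgroup.one_closed[OF subgroup_Phi] by (auto simp: V0_def)
next
  fix u v assume u: "u \<in> V0" and v: "v \<in> V0"
  note c = V0_D(2)[OF u] V0_D(2)[OF v]
  have "(u \<otimes> v) \<otimes> (u \<otimes> v) = u \<otimes> (v \<otimes> u) \<otimes> v" using c by (simp add: m_assoc)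
  also have "v \<otimes> u = u \<otimes> v" by (rule V0_commute[OF v u])
  also have "u \<otimes> (u \<otimes> v) \<otimes> v = (u \<otimes> u) \<otimes> (v \<otimes> v)" using c by (simp add: m_assoc)
  finally have "(u \<otimes> v) \<otimes> (u \<otimes> v) = \<one>" using V0_D(3)[OF u] V0_D(3)[OF v] by simp
  moreover have "(u \<otimes> v) \<otimes> p = p \<otimes> (u \<otimes> v)" if p: "p \<in> Phi" for p
  proof -
    have pc: "p \<in> carrier G" using p Phi_carrier by auto
    have "(u \<otimes> v) \<otimes> p = u \<otimes> (v \<otimes> p)" using c pc by (simp add: m_assoc)
    also have "v \<otimes> p = p \<otimes> v" using v p by (rule V0_D(4))
    also have "u \<otimes> (p \<otimes> v) = (u \<otimes> p) \<otimes> v" using c pc by (simp add: m_assoc)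
    also have "u \<otimes> p = p \<otimes> u" using u p by (rule V0_D(4))
    finally show ?thesis using c pc by (simp add: m_assoc)
  qed
  moreover have "u \<otimes> v \<in> Phi" using u v V0_D by (intro subgroup.m_closed[OF subgroup_Phi])
  ultimately show "u \<otimes> v \<in> V0" unfolding V0_def by blast
qed (use V0_D in auto)

text \<open>\<open>F\<close> is forced to be \<open>F (h \<otimes> g) = f h \<otimes> act h v\<close>. The hypotheses say that this respects
  \<open>g \<otimes> g \<in> Phi\<close> and the commutation of \<open>g\<close> with \<open>N\<close> modulo \<open>Phi\<close>.\<close>

lemma derivation_step:
  assumes V: "subgroup V G" "V \<subseteq> V0" "\<And>x v. x \<in> carrier G \<Longrightarrow> v \<in> V \<Longrightarrow> act x v \<in> V"
    and N: "subgroup N G" "Phi \<subseteq> N" and g: "g \<in> carrier G" "g \<notin> N"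
    and f: "derivation V N f" and v: "v \<in> V" "act g v = v"
    and compat: "\<And>x. x \<in> N \<Longrightarrow> f x \<otimes> act x v = v \<otimes> act g (f x)"
  shows "\<exists>F. derivation V (generate G (insert g N)) F \<and> (\<forall>x\<in>N. F x = f x) \<and> F g = v"
proof -
  have sub: "N \<subseteq> carrier G" using N(1) by (rule subgroup.subset)
  define F where "F y = (if y \<in> N then f y else f (y \<otimes> inv g) \<otimes> act (y \<otimes> inv g) v)" for y
  have FN: "F x = f x" if "x \<in> N" for x using that by (simp add: F_def)
  have notN: "x \<otimes> g \<notin> N" if "x \<in> N" for x
  proof
    assume "x \<otimes> g \<in> N"
    then have "inv x \<otimes> (x \<otimes> g) \<in> N" using that N(1) by (blast intro: subgroup.m_closed subgroup.m_inv_closed)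
    then show False using that g sub by (simp add: cancel_words subsetD)
  qed
  have Fg: "F (x \<otimes> g) = f x \<otimes> act x v" if "x \<in> N" for x
    using notN[OF that] that g sub by (simp add: F_def words subsetD)
  have fV: "f x \<in> V" "f x \<in> V0" "f x \<in> carrier G" if "x \<in> N" for x
    using f that V(2) V0_D(2) by (auto simp: derivation_def)
  have fm: "f (x \<otimes> y) = f x \<otimes> act x (f y)" if "x \<in> N" "y \<in> N" for x y
    using f that by (auto simp: derivation_def)
  have fP: "f p = \<one>" if "p \<in> Phi" for p using f that by (auto simp: derivation_def)
  have vV: "v \<in> V0" "v \<in> carrier G" using v(1) V(2) V0_D(2) by auto
  have f1: "f \<one> = \<one>" using fP subgroup.one_closed[OF subgroup_Phi] by simp
  have gen: "generate G (insert g N) = N \<union> {h \<otimes> g |h. h \<in> N}" by (rule adjoin_Phi[OF N g(1)])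
  have vals: "F x \<in> V" if "x \<in> N \<union> {h \<otimes> g |h. h \<in> N}" for x
    using that fV(1) v V sub by (auto simp: FN Fg subsetD intro!: subgroup.m_closed)
  \<comment> \<open>Moving \<open>g\<close> past \<open>b\<close> replaces \<open>b\<close> by
    \<open>com g b \<otimes> b\<close>; the factor from \<open>Phi\<close> affects neither
    \<open>f\<close> nor the action.\<close>
  have conjF: "f (com g b \<otimes> b) = f b" "act (com g b \<otimes> b) u = act b u" "com g b \<otimes> b \<in> N" if b: "b \<in> N" and u: "u \<in> V0" for b u
  proof -
    have bc: "b \<in> carrier G" using b sub by auto
    have c: "com g b \<in> Phi" "com g b \<in> N" using com_Phi[OF g(1) bc] N(2) by auto
    show "f (com g b \<otimes> b) = f b" using fm[OF c(2) b] fP[OF c(1)] act_Phi[OF c(1) fV(2)[OF b]] fV(3)[OF b] by simp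
    show "act (com g b \<otimes> b) u = act b u"
      using act_mult[of "com g b" b u] act_Phi[OF c(1) act_V0[OF bc u]] g bc V0_D(2)[OF u] by simp
    show "com g b \<otimes> b \<in> N" using c b N(1) by (auto intro: subgroup.m_closed)
  qed
  have cocycle: "F (a \<otimes> b) = F a \<otimes> act a (F b)"
    if a: "a \<in> N \<union> {h \<otimes> g |h. h \<in> N}" and b: "b \<in> N \<union> {h \<otimes> g |h. h \<in> N}" for a b
  proof -
    consider "a \<in> N" "b \<in> N" | y where "a \<in> N" "y \<in> N" "b = y \<otimes> g"
      | x where "x \<in> N" "a = x \<otimes> g" "b \<in> N" | x y where "x \<in> N" "y \<in> N" "a = x \<otimes> g" "b = y \<otimes> g"
      using a b by blast
    then show ?thesis
    proof cases
      case 1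
      then show ?thesis using N(1) by (simp add: FN fm subgroup.m_closed)
    next
      case (2 y)
      have c: "a \<in> carrier G" "y \<in> carrier G" using 2 sub by auto
      have "a \<otimes> b = (a \<otimes> y) \<otimes> g" using 2 c g by (simp add: m_assoc)
      then have "F (a \<otimes> b) = f (a \<otimes> y) \<otimes> act (a \<otimes> y) v"
        using 2 N(1) by (simp add: Fg subgroup.m_closed)
      also have "\<dots> = f a \<otimes> act a (f y \<otimes> act y v)"
        using 2 c vV fV(3) by (simp add: fm act_mult act_distrib m_assoc)
      finally show ?thesis using 2 by (simp add: FN Fg)
    next
      case (3 x)
      have c: "x \<in> carrier G" "b \<in> carrier G" using 3 sub by auto
      note cb = conjF[OF \<open>b \<in> N\<close> vV(1)]
      have "a \<otimes> b = (x \<otimes> (com g b \<otimes> b)) \<otimes> g" using 3 c g by (simp add: com_def words)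
      then have "F (a \<otimes> b) = f (x \<otimes> (com g b \<otimes> b)) \<otimes> act (x \<otimes> (com g b \<otimes> b)) v"
        using 3 N(1) cb by (simp add: Fg subgroup.m_closed)
      also have "\<dots> = f x \<otimes> act x (f b) \<otimes> act x (act b v)"
        using 3 cb c vV g by (simp add: fm act_mult[of x])
      also have "\<dots> = f x \<otimes> act x (f b \<otimes> act b v)"
        using 3 c vV fV(3) by (simp add: act_distrib m_assoc)
      also have "f b \<otimes> act b v = v \<otimes> act g (f b)" using 3 compat by blast
      also have "f x \<otimes> act x (v \<otimes> act g (f b)) = (f x \<otimes> act x v) \<otimes> act (x \<otimes> g) (f b)"
        using 3 c vV g fV(3) by (simp add: act_distrib act_mult m_assoc)
      finally show ?thesis using 3 by (simp add: FN Fg)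
    next
      case (4 x y)
      have c: "x \<in> carrier G" "y \<in> carrier G" using 4 sub by auto
      note cy = conjF[OF \<open>y \<in> N\<close> vV(1)]
      have gg: "g \<otimes> g \<in> Phi" "g \<otimes> g \<in> N" using square_Phi[OF g(1)] N(2) by auto
      have n: "(com g y \<otimes> y) \<otimes> (g \<otimes> g) \<in> N" using cy gg N(1) by (auto intro: subgroup.m_closed)
      have "a \<otimes> b = x \<otimes> ((com g y \<otimes> y) \<otimes> (g \<otimes> g))" using 4 c g by (simp add: com_def words)
      then have "F (a \<otimes> b) = f (x \<otimes> ((com g y \<otimes> y) \<otimes> (g \<otimes> g)))"
        using 4 N(1) n by (simp add: FN subgroup.m_closed)
      also have "\<dots> = f x \<otimes> act x (f ((com g y \<otimes> y) \<otimes> (g \<otimes> g)))" using 4 n by (simp add: fm)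
      also have "f ((com g y \<otimes> y) \<otimes> (g \<otimes> g)) = f y"
        using cy(1,3) gg 4 c g fV(3)[of y] by (simp add: fm[of "com g y \<otimes> y"] fP)
      finally have 1: "F (a \<otimes> b) = f x \<otimes> act x (f y)" .
      \<comment> \<open>The factor \<open>g \<otimes> g\<close> has been absorbed by
        \<open>Phi\<close>, so the contributions of the two factors \<open>g\<close> must cancel:
        after \<open>compat\<close> two copies of \<open>act y v\<close> meet, and \<open>v\<close>
        has order at most 2.\<close>
      have "v \<otimes> act g (f y \<otimes> act y v) = (v \<otimes> act g (f y)) \<otimes> act g (act y v)"
        using 4 c vV g fV(3) by (simp add: act_distrib m_assoc)
      also have "\<dots> = (f y \<otimes> act y v) \<otimes> act y v"
        using compat[of y] act_swap[OF g(1) c(2) vV(1)] v(2) 4 by simp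
      also have "\<dots> = f y \<otimes> act y (v \<otimes> v)"
        using 4 c vV fV(3) by (simp add: act_distrib m_assoc)
      also have "\<dots> = f y" using V0_D(3)[OF vV(1)] 4 c fV(3) by simp
      finally have 2: "v \<otimes> act g (f y \<otimes> act y v) = f y" .
      have "F a \<otimes> act a (F b) = (f x \<otimes> act x v) \<otimes> act x (act g (f y \<otimes> act y v))"
        using 4 c g vV fV(3) by (simp add: Fg act_mult)
      also have "\<dots> = f x \<otimes> act x (v \<otimes> act g (f y \<otimes> act y v))"
        using 4 c g vV fV(3) by (simp add: act_distrib[of x] m_assoc)
      finally show ?thesis using 1 2 by simp
    qed
  qed
  have "F g = v" using Fg[OF subgroup.one_closed[OF N(1)]] g vV f1 by simp
  moreover have "derivation V (generate G (insert g N)) F"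
    unfolding derivation_def gen using vals cocycle fP FN N(2) by (auto simp: subset_iff)
  ultimately show ?thesis using FN by blast
qed

text \<open>Values at a basis extend as soon as they respect the relations of
  \<open>G / Phi\<close>. That \<open>x i\<close> fixes \<open>v i\<close> reflects that
  \<open>x i \<otimes> x i\<close> lies in \<open>Phi\<close>; the symmetric condition reflects that
  \<open>x i\<close> and \<open>x j\<close> commute modulo \<open>Phi\<close>.\<close>

lemma exists_derivation:
  assumes V: "subgroup V G" "V \<subseteq> V0" "\<And>x v. x \<in> carrier G \<Longrightarrow> v \<in> V \<Longrightarrow> act x v \<in> V"
    and x: "independent Phi d x"
    and v: "\<And>i. i < d \<Longrightarrow> v i \<in> V" "\<And>i. i < d \<Longrightarrow> act (x i) (v i) = v i"
    "\<And>i j. i < j \<Longrightarrow> j < d \<Longrightarrow> v i \<otimes> act (x i) (v j) = v j \<otimes> act (x j) (v i)"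
  shows "\<exists>f. derivation V (generate G (Phi \<union> x ` {..<d})) f \<and> (\<forall>i<d. f (x i) = v i)"
  using x v
proof (induction d)
  case 0
  have "\<one> \<in> V" using V(1) by (rule subgroup.one_closed)
  moreover have "generate G Phi = Phi" using generateI[OF subgroup_Phi, of Phi] by auto
  ultimately show ?case
    using Phi_carrier by (intro exI[of _ "\<lambda>_. \<one>"]) (auto simp: derivation_def subset_iff)
next
  case (Suc d)
  let ?N = "generate G (Phi \<union> x ` {..<d})"
  have xc: "x i \<in> carrier G" if "i \<le> d" for i using Suc.prems(1) that by (auto simp: independent_def)
  have sub: "Phi \<union> x ` {..<d} \<subseteq> carrier G" using xc Phi_carrier by (auto intro: less_imp_le)
  have N: "subgroup ?N G" "Phi \<subseteq> ?N" using sub by (auto intro: generate_is_subgroup generate.incl)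
  have Nsub: "?N \<subseteq> carrier G" using N(1) by (rule subgroup.subset)
  have nd: "x d \<notin> ?N" using Suc.prems(1) by (auto simp: independent_def)
  have "independent Phi d x" using Suc.prems(1) by (auto simp: independent_def)
  then have "\<exists>f. derivation V ?N f \<and> (\<forall>i<d. f (x i) = v i)"
    by (rule Suc.IH) (auto intro: Suc.prems(2-4))
  then obtain f where f: "derivation V ?N f" "\<And>i. i < d \<Longrightarrow> f (x i) = v i" by blast
  have fV: "f y \<in> V" "f y \<in> V0" "f y \<in> carrier G" if "y \<in> ?N" for y
    using f that V(2) V0_D(2) by (auto simp: derivation_def)
  have vd: "v d \<in> V" "v d \<in> V0" "v d \<in> carrier G" using Suc.prems(2)[of d] V(2) V0_D(2) by auto
  \<comment> \<open>The compatibility needed for adjoining \<open>x d\<close> is given on generators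
    only; the elements satisfying it form a subgroup.\<close>
  let ?S = "{y \<in> ?N. f y \<otimes> act y (v d) = v d \<otimes> act (x d) (f y)}"
  have sS: "subgroup ?S G"
  proof (rule subgroup_mult_closedI)
    show "?S \<subseteq> carrier G" using Nsub by auto
    have "f \<one> = \<one>" using f(1) subgroup.one_closed[OF subgroup_Phi] by (auto simp: derivation_def)
    then show "\<one> \<in> ?S" using subgroup.one_closed[OF N(1)] vd xc by simp
    fix y z assume yz: "y \<in> ?S" "z \<in> ?S"
    have c: "y \<in> ?N" "z \<in> ?N" "y \<in> carrier G" "z \<in> carrier G" "x d \<in> carrier G" using yz Nsub xc by auto
    have m: "f (y \<otimes> z) = f y \<otimes> act y (f z)" using f(1) c by (auto simp: derivation_def)
    have "f (y \<otimes> z) \<otimes> act (y \<otimes> z) (v d) = f y \<otimes> act y (f z \<otimes> act z (v d))"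
      using c vd fV(3) by (simp add: m act_distrib act_mult m_assoc)
    also have "f z \<otimes> act z (v d) = v d \<otimes> act (x d) (f z)" using yz by auto
    also have "f y \<otimes> act y (v d \<otimes> act (x d) (f z)) = (f y \<otimes> act y (v d)) \<otimes> act y (act (x d) (f z))"
      using c vd fV(3) by (simp add: act_distrib m_assoc)
    also have "f y \<otimes> act y (v d) = v d \<otimes> act (x d) (f y)" using yz by auto
    also have "act y (act (x d) (f z)) = act (x d) (act y (f z))"
      using c fV(2) by (intro act_swap) auto
    also have "v d \<otimes> act (x d) (f y) \<otimes> act (x d) (act y (f z)) = v d \<otimes> act (x d) (f (y \<otimes> z))"
      using c vd fV(3) by (simp add: m act_distrib m_assoc)
    finally show "y \<otimes> z \<in> ?S" using c N(1) by (simp add: subgroup.m_closed)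
  qed
  have "Phi \<union> x ` {..<d} \<subseteq> ?S"
  proof
    fix y assume y: "y \<in> Phi \<union> x ` {..<d}"
    have yN: "y \<in> ?N" using y by (rule generate.incl)
    show "y \<in> ?S"
    proof (cases "y \<in> Phi")
      case True
      then have "f y = \<one>" using f(1) by (simp add: derivation_def)
      then show ?thesis using True yN act_Phi[OF True vd(2)] vd xc by simp
    next
      case False
      then obtain i where i: "i < d" "y = x i" using y by auto
      then show ?thesis using yN f(2) Suc.prems(4)[of i d] by simp
    qed
  qed
  then have "?N \<subseteq> ?S" using sS by (rule generate_subgroup_incl)
  then have compat: "f y \<otimes> act y (v d) = v d \<otimes> act (x d) (f y)" if "y \<in> ?N" for y using that by auto
  obtain F where F: "derivation V (generate G (insert (x d) ?N)) F" "\<forall>y\<in>?N. F y = f y" "F (x d) = v d"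
    using derivation_step[OF V N _ nd f(1) vd(1) Suc.prems(3)[of d] compat] xc by auto
  have "F (x i) = v i" if "i < Suc d" for i
  proof (cases "i = d")
    case False
    then have "i < d" using that by auto
    moreover have "x i \<in> ?N" using \<open>i < d\<close> by (intro generate.incl) auto
    ultimately show ?thesis using F(2) f(2) by simp
  qed (use F in auto)
  moreover have "generate G (Phi \<union> x ` {..<Suc d}) = generate G (insert (x d) ?N)"
    using generate_Suc[of Phi d x] Phi_carrier xc by auto
  ultimately show ?case using F(1) by auto
qed

text \<open>The cocycle identity makes \<open>f x \<otimes> x\<close> multiplicative in
  \<open>x\<close>, and applying the map twice gives the identity because \<open>f (f x)\<close> and
  the square of \<open>f x\<close> are trivial. Requiring \<open>f (f x) = \<one>\<close> instead of
  values in \<open>Phi\<close> also admits homomorphisms into \<open>Om\<close> whose values lie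
  outside \<open>Phi\<close>.\<close>

lemma derivation_automorphism:
  assumes closed: "\<And>x. x \<in> carrier G \<Longrightarrow> f x \<in> carrier G"
    and mult: "\<And>x y. x \<in> carrier G \<Longrightarrow> y \<in> carrier G \<Longrightarrow> f (x \<otimes> y) = f x \<otimes> act x (f y)"
    and sq: "\<And>x. x \<in> carrier G \<Longrightarrow> f x \<otimes> f x = \<one>"
    and ff: "\<And>x. x \<in> carrier G \<Longrightarrow> f (f x) = \<one>"
    and Phi: "\<And>x. x \<in> Phi \<Longrightarrow> f x = \<one>"
    and outer: "\<not> (\<exists>g\<in>carrier G. \<forall>x\<in>carrier G. f x = com g x)"
  shows "\<exists>\<alpha>\<in>carrier (AutoGroup G). \<alpha> \<notin> inner_auts G \<and>
              group.ord (AutoGroup G) \<alpha> = 2 \<and> (\<forall>x\<in>frattini G. \<alpha> x = x)"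
proof -
  define \<alpha> where "\<alpha> = (\<lambda>x\<in>carrier G. f x \<otimes> x)"
  have a: "\<alpha> x = f x \<otimes> x" if "x \<in> carrier G" for x using that by (simp add: \<alpha>_def)
  have ac: "\<alpha> x \<in> carrier G" if "x \<in> carrier G" for x using that a closed by simp
  have inv: "\<alpha> (\<alpha> x) = x" if x: "x \<in> carrier G" for x
  proof -
    have "f (f x \<otimes> x) = f x"
      using mult[OF closed[OF x] x] ff[OF x] closed[OF x] by (simp add: act_def m_assoc)
    then have "\<alpha> (\<alpha> x) = f x \<otimes> (f x \<otimes> x)" using x closed by (simp add: a)
    also have "\<dots> = (f x \<otimes> f x) \<otimes> x" using x closed by (simp add: m_assoc)
    finally show ?thesis using sq x by simp
  qed
  have bij: "\<alpha> \<in> Bij (carrier G)"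
    unfolding Bij_def
    by (auto intro!: bij_betw_byWitness[where f' = \<alpha>] simp: inv ac) (simp add: \<alpha>_def)
  have hom: "\<alpha> \<in> hom G G"
    by (rule homI) (simp_all add: a ac mult closed act_def words)
  have auto: "\<alpha> \<in> carrier (AutoGroup G)" using bij hom by (simp add: AutoGroup_def auto_def)
  interpret A: group "AutoGroup G" by (rule AutoGroup)
  have one: "\<one>\<^bsub>AutoGroup G\<^esub> = (\<lambda>x\<in>carrier G. x)" by (simp add: AutoGroup_def BijGroup_def)
  have "\<alpha> \<otimes>\<^bsub>AutoGroup G\<^esub> \<alpha> = compose (carrier G) \<alpha> \<alpha>"
    using bij by (simp add: AutoGroup_def BijGroup_def)
  also have "\<dots> = (\<lambda>x\<in>carrier G. x)" by (auto simp: compose_def inv)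
  finally have "\<alpha> \<otimes>\<^bsub>AutoGroup G\<^esub> \<alpha> = \<one>\<^bsub>AutoGroup G\<^esub>"
    by (simp add: one)
  then have "\<alpha> [^]\<^bsub>AutoGroup G\<^esub> (2::nat) = \<one>\<^bsub>AutoGroup G\<^esub>"
    using auto by (simp add: numeral_2_eq_2)
  then have dvd: "A.ord \<alpha> dvd 2" using auto A.pow_eq_id by blast
  have nid: "\<alpha> \<notin> inner_auts G"
  proof
    assume "\<alpha> \<in> inner_auts G"
    then obtain g where g: "g \<in> carrier G" "\<alpha> = (\<lambda>x\<in>carrier G. g \<otimes> x \<otimes> inv g)" by (auto simp: inner_auts_def)
    have "f x = com g x" if x: "x \<in> carrier G" for x
    proof -
      have "f x \<otimes> x = com g x \<otimes> x" using g x a[OF x] by (simp add: conj_com)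
      then show ?thesis using x closed g by simp
    qed
    then show False using outer g by blast
  qed
  \<comment> \<open>The identity is inner, as conjugation by \<open>\<one>\<close>.\<close>
  have "A.ord \<alpha> \<noteq> 1"
  proof
    assume "A.ord \<alpha> = 1"
    then have "\<alpha> = (\<lambda>x\<in>carrier G. \<one> \<otimes> x \<otimes> inv \<one>)"
      using A.ord_eq_1[OF auto] one by auto
    then have "\<alpha> \<in> inner_auts G" unfolding inner_auts_def using one_closed by blast
    then show False using nid by contradiction
  qed
  then have "A.ord \<alpha> = 2" using dvd two_is_prime_nat unfolding prime_nat_iff by blast
  moreover have "\<alpha> x = x" if "x \<in> frattini G" for x
  proof -
    have "x \<in> Phi" using that frattini_subset_Phi by auto
    then show ?thesis using Phi Phi_carrier by (auto simp: a)
  qed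
  ultimately show ?thesis using auto nid by blast
qed

end

section \<open>The subgroups of the second center\<close>

context class3_two_group
begin

definition Om :: "'a set" where
  "Om = {z \<in> center G. z \<otimes> z = \<one>}"

definition K :: "'a set" where
  "K = {k \<in> Z2. k \<otimes> k \<in> center G}"

definition L :: "'a set" where
  "L = {l \<in> Z2. l \<otimes> l = \<one>}"

definition W :: "'a set" where
  "W = {g \<in> carrier G. g \<otimes> g \<in> Z2}"

lemma Om_D: "z \<in> Om \<Longrightarrow> z \<in> center G" "z \<in> Om \<Longrightarrow> z \<in> carrier G" "z \<in> Om \<Longrightarrow> z \<otimes> z = \<one>"
  by (auto simp: Om_def centerD(1))

lemma K_D: "k \<in> K \<Longrightarrow> k \<in> Z2" "k \<in> K \<Longrightarrow> k \<in> carrier G" "k \<in> K \<Longrightarrow> k \<otimes> k \<in> center G"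
  by (auto simp: K_def Z2_carrier)

lemma L_D: "l \<in> L \<Longrightarrow> l \<in> Z2" "l \<in> L \<Longrightarrow> l \<in> carrier G" "l \<in> L \<Longrightarrow> l \<otimes> l = \<one>"
  by (auto simp: L_def Z2_carrier)

lemma act_central: "z \<in> center G \<Longrightarrow> x \<in> carrier G \<Longrightarrow> act x z = z"
  by (simp add: act_def conj_center)

lemma mult_square:
  assumes "g \<in> carrier G" "h \<in> carrier G"
  shows "(g \<otimes> h) \<otimes> (g \<otimes> h) = act g (com h g) \<otimes> (g \<otimes> g) \<otimes> (h \<otimes> h)"
  using assms by (simp add: act_def com_def words)

lemma Z2_normal: "s \<in> Z2 \<Longrightarrow> x \<in> carrier G \<Longrightarrow> act x s \<in> Z2"
  unfolding act_def
  by (rule conj_closed_of_com[OF subgroup_Z2]) (auto intro: com_in_Z2 Z2_carrier)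

lemma subgroup_Om: "subgroup Om G"
proof (rule subgroup_mult_closedI)
  show "\<one> \<in> Om" using subgroup.one_closed[OF subgroup_center] by (simp add: Om_def)
  fix u v assume u: "u \<in> Om" and v: "v \<in> Om"
  have "com v u = \<one>" using com_center(1) Om_D u v by blast
  then have "(u \<otimes> v) \<otimes> (u \<otimes> v) = \<one>"
    using mult_square[of u v] Om_D[OF u] Om_D[OF v] by simp
  then show "u \<otimes> v \<in> Om" using Om_D[OF u] Om_D[OF v] by (simp add: Om_def subgroup.m_closed[OF subgroup_center])
qed (use Om_D in auto)

lemma subgroup_K: "subgroup K G"
proof (rule subgroup_mult_closedI)
  show "\<one> \<in> K" using subgroup.one_closed[OF subgroup_center] subgroup.one_closed[OF subgroup_Z2] by (simp add: K_def)
  fix u v assume u: "u \<in> K" and v: "v \<in> K"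
  have "(u \<otimes> v) \<otimes> (u \<otimes> v) \<in> center G"
    using mult_square[of u v] K_D[OF u] K_D[OF v] com_Z2[of v u]
    by (simp add: act_central subgroup.m_closed[OF subgroup_center])
  then show "u \<otimes> v \<in> K" using K_D[OF u] K_D[OF v] by (simp add: K_def subgroup.m_closed[OF subgroup_Z2])
qed (use K_D in auto)

text \<open>All commutators lie in \<open>Z2\<close>, so squaring is a homomorphism modulo
  \<open>Z2\<close>.\<close>

lemma subgroup_W: "subgroup W G"
proof (rule subgroup_mult_closedI)
  show "\<one> \<in> W" using subgroup.one_closed[OF subgroup_Z2] by (simp add: W_def)
  fix u v assume u: "u \<in> W" and v: "v \<in> W"
  then have "(u \<otimes> v) \<otimes> (u \<otimes> v) \<in> Z2"
    using mult_square[of u v] Z2_normal[OF com_in_Z2[of v u], of u]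
    by (simp add: W_def subgroup.m_closed[OF subgroup_Z2])
  then show "u \<otimes> v \<in> W" using u v by (simp add: W_def)
qed (auto simp: W_def)

lemma com_square_left:
  assumes "g \<in> Z2" "y \<in> carrier G" shows "com (g \<otimes> g) y = com g y \<otimes> com g y"
  using com_left_mult_Z2[of g g y] assms Z2_carrier by blast

lemma com_K_Om: "k \<in> K \<Longrightarrow> y \<in> carrier G \<Longrightarrow> com k y \<in> Om"
  using com_square_left[of k y] com_center(1)[of "k \<otimes> k" y] K_D com_Z2 by (simp add: Om_def)

text \<open>With \<open>com_K_Om\<close> this characterizes \<open>K\<close> as the set of those
  \<open>g\<close> for which \<open>com g\<close> is a homomorphism into \<open>Om\<close>.\<close>

lemma K_of_com_Om:
  assumes g: "g \<in> carrier G" and com: "\<And>y. y \<in> carrier G \<Longrightarrow> com g y \<in> Om"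
  shows "g \<in> K"
proof -
  have gZ: "g \<in> Z2" using g com Om_D(1) by (auto simp: Z2_def)
  moreover have "g \<otimes> g \<in> center G"
    using com_square_left[OF gZ] com Om_D(3) g by (simp add: center_iff_com)
  ultimately show ?thesis by (simp add: K_def)
qed

text \<open>The map \<open>com k\<close> is a homomorphism into \<open>Om\<close>, where squares are
  trivial, so it kills all squares.\<close>

lemma K_commute_Phi: assumes k: "k \<in> K" and p: "p \<in> Phi" shows "k \<otimes> p = p \<otimes> k"
proof -
  have kc: "k \<in> carrier G" "k \<in> Z2" using K_D k by auto
  have "subgroup {p \<in> carrier G. com k p = \<one>} G"
    by (rule subgroup_mult_closedI) (use kc in \<open>auto simp: com_right_mult_Z2\<close>)
  then have "Phi \<subseteq> {p \<in> carrier G. com k p = \<one>}"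
    by (rule subset_Phi_induct) (use kc com_K_Om[OF k] Om_D(3) in \<open>auto simp: com_right_mult_Z2\<close>)
  then have "p \<in> carrier G" "com k p = \<one>" using p by auto
  then show ?thesis using kc com_eq_one by blast
qed

lemma L_subset_K: "L \<subseteq> K"
  by (auto simp: L_def K_def subgroup.one_closed[OF subgroup_center])

lemma Om_subset_L: "Om \<subseteq> L"
  using center_subset_Z2 by (auto simp: L_def Om_def)

lemma com_L_Om:
  assumes l: "l \<in> L" and y: "y \<in> carrier G" shows "com y l \<in> Om"
proof -
  have "com y l \<otimes> com y l = com y (l \<otimes> l)"
    using com_right_mult_Z2'[OF y, of l l] L_D[OF l] by simp
  then show ?thesis using L_D[OF l] y com_Z2_right by (simp add: Om_def)
qed

lemma center_of_com_gens:
  assumes "S \<subseteq> carrier G" "generate G S = carrier G" "g \<in> Z2" "\<And>s. s \<in> S \<Longrightarrow> com g s = \<one>"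
  shows "g \<in> center G"
proof -
  have "com g y = \<one>" if "y \<in> carrier G" for y
    by (rule generate_carrier_induct[OF assms(2) that])
      (use assms Z2_carrier in \<open>auto simp: com_right_mult_Z2\<close>)
  then show ?thesis using assms(3) by (simp add: center_iff_com Z2_carrier)
qed

lemma com_inv_mult_Z2:
  assumes "a \<in> Z2" "b \<in> Z2" "y \<in> carrier G"
  shows "com (inv a \<otimes> b) y = \<one> \<longleftrightarrow> com a y = com b y"
proof -
  have c: "a \<in> carrier G" "b \<in> carrier G" using assms Z2_carrier by auto
  have m: "inv a \<otimes> b \<in> Z2" using assms subgroup.m_closed[OF subgroup_Z2] subgroup.m_inv_closed[OF subgroup_Z2] by blast
  have "com b y = com (a \<otimes> (inv a \<otimes> b)) y" using c by (simp add: cancel_words)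
  also have "\<dots> = com (inv a \<otimes> b) y \<otimes> com a y" using c m assms by (intro com_left_mult_Z2) auto
  finally show ?thesis
    using r_cancel_one'[of "com a y" "com (inv a \<otimes> b) y"] c assms(3) by auto
qed

text \<open>The map with value \<open>\<one>\<close> on \<open>M\<close> and \<open>z\<close> on the
  other coset is a homomorphism into \<open>Om\<close>. As \<open>z\<close> is quantified after
  \<open>M\<close>, the value can be picked in dependence on \<open>M\<close>.\<close>

lemma index_two_hom:
  assumes u: "u \<in> carrier G" "u \<notin> Phi"
  obtains M where "subgroup M G" "Phi \<subseteq> M" "u \<notin> M" "carrier G = M \<union> {m \<otimes> u |m. m \<in> M}"
    "\<And>z a b. z \<in> Om \<Longrightarrow> a \<in> carrier G \<Longrightarrow> b \<in> carrier G \<Longrightarrow>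
       (if a \<otimes> b \<in> M then \<one> else z) = (if a \<in> M then \<one> else z) \<otimes> (if b \<in> M then \<one> else z)"
proof -
  obtain M where M: "subgroup M G" "Phi \<subseteq> M" "u \<notin> M" and dec: "carrier G = M \<union> {m \<otimes> u |m. m \<in> M}"
    using index_two_avoiding[OF subgroup_Phi subset_refl u] by blast
  have Mc: "m \<in> carrier G" if "m \<in> M" for m using M(1) that by (rule subgroup.mem_carrier)
  have dec': "y \<in> M \<or> (\<exists>m\<in>M. y = m \<otimes> u)" if "y \<in> carrier G" for y using that dec by auto
  have notM: "m \<otimes> u \<notin> M" if m: "m \<in> M" for m
  proof
    assume "m \<otimes> u \<in> M"
    then have "inv m \<otimes> (m \<otimes> u) \<in> M" using m M(1) by (blast intro: subgroup.m_closed subgroup.m_inv_closed)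
    then show False using M(3) Mc[OF m] u by (simp add: cancel_words)
  qed
  have hom: "(if a \<otimes> b \<in> M then \<one> else z) = (if a \<in> M then \<one> else z) \<otimes> (if b \<in> M then \<one> else z)"
    if z: "z \<in> Om" and a: "a \<in> carrier G" and b: "b \<in> carrier G" for z a b
  proof -
    define f where "f y = (if y \<in> M then \<one> else z)" for y
    have f1: "f y = \<one>" if "y \<in> M" for y using that by (simp add: f_def)
    have f2: "f (m \<otimes> u) = z" if "m \<in> M" for m using notM[OF that] by (simp add: f_def)
    have "f (a \<otimes> b) = f a \<otimes> f b"
    proof -
      consider "a \<in> M" "b \<in> M" | y where "a \<in> M" "y \<in> M" "b = y \<otimes> u"
        | m where "m \<in> M" "a = m \<otimes> u" "b \<in> M" | m y where "m \<in> M" "y \<in> M" "a = m \<otimes> u" "b = y \<otimes> u"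
        using dec'[OF a] dec'[OF b] by blast
      then show ?thesis
      proof cases
        case 1
        then show ?thesis using M(1) by (simp add: f1 subgroup.m_closed)
      next
        case (2 y)
        have "a \<otimes> b = (a \<otimes> y) \<otimes> u" using 2 Mc u by (simp add: m_assoc)
        moreover have "a \<otimes> y \<in> M" using 2 M(1) by (simp add: subgroup.m_closed)
        ultimately show ?thesis using 2 f1 f2 Om_D(2)[OF z] by simp
      next
        case (3 m)
        have "a \<otimes> b = (m \<otimes> (u \<otimes> b \<otimes> inv u)) \<otimes> u" using 3 Mc u by (simp add: words)
        moreover have "m \<otimes> (u \<otimes> b \<otimes> inv u) \<in> M"
          using 3 M(1) conj_closed_of_Phi[OF M(1,2) _ u(1), of b] by (simp add: subgroup.m_closed)
        ultimately show ?thesis using 3 f1 f2 Om_D(2)[OF z] by simp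
      next
        case (4 m y)
        have "a \<otimes> b = m \<otimes> ((u \<otimes> y \<otimes> inv u) \<otimes> (u \<otimes> u))" using 4 Mc u by (simp add: words)
        moreover have "m \<otimes> ((u \<otimes> y \<otimes> inv u) \<otimes> (u \<otimes> u)) \<in> M"
          using 4 M(1) conj_closed_of_Phi[OF M(1,2) _ u(1), of y] square_Phi[OF u(1)] M(2)
          by (simp add: subgroup.m_closed subset_iff)
        ultimately show ?thesis using 4 f1 f2 Om_D(3)[OF z] by simp
      qed
    qed
    then show ?thesis unfolding f_def .
  qed
  show thesis by (rule that[OF M dec hom])
qed

end

section \<open>A hypothetical counterexample, in which every derivation into \<open>V0\<close> is
  inner\<close>

locale all_inner = class3_two_group +
  fixes d :: nat and x :: "nat \<Rightarrow> 'a"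
  assumes independent: "independent Phi d x"
    and generating: "generate G (Phi \<union> x ` {..<d}) = carrier G"
    and Om_Phi: "Om \<subseteq> Phi"
    and card_Om: "4 \<le> card Om"
    and derivation_inner: "\<And>f. derivation V0 (carrier G) f \<Longrightarrow> \<exists>g\<in>carrier G. \<forall>y\<in>carrier G. f y = com g y"
begin

lemma x_carrier: "i < d \<Longrightarrow> x i \<in> carrier G"
  using independent by (simp add: independent_def)

lemma x_image: "x ` {..<d} \<subseteq> carrier G"
  using x_carrier by auto

lemma generate_x: "generate G (x ` {..<d}) = carrier G"
  by (rule generate_modulo_Phi[OF x_image generating])

lemma Om_V0: "Om \<subseteq> V0"
proof
  fix z assume z: "z \<in> Om"
  then have "z \<otimes> p = p \<otimes> z" if "p \<in> Phi" for p
    using centerD(2) Om_D(1) Phi_carrier that by blast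
  then show "z \<in> V0" using z Om_Phi Om_D(3) unfolding V0_def by blast
qed

text \<open>The prescribed values extend by \<open>exists_derivation\<close>. The result is also a
  derivation into \<open>V0\<close>, hence inner by assumption.\<close>

lemma inner_derivation:
  assumes V: "subgroup V G" "V \<subseteq> V0" "\<And>x v. x \<in> carrier G \<Longrightarrow> v \<in> V \<Longrightarrow> act x v \<in> V"
    and v: "\<And>i. i < d \<Longrightarrow> v i \<in> V" "\<And>i. i < d \<Longrightarrow> act (x i) (v i) = v i"
    "\<And>i j. i < j \<Longrightarrow> j < d \<Longrightarrow> v i \<otimes> act (x i) (v j) = v j \<otimes> act (x j) (v i)"
  shows "\<exists>g\<in>carrier G. (\<forall>i<d. com g (x i) = v i) \<and> (\<forall>y\<in>carrier G. com g y \<in> V) \<and> (\<forall>p\<in>Phi. com g p = \<one>)"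
proof -
  obtain f where f: "derivation V (carrier G) f" "\<And>i. i < d \<Longrightarrow> f (x i) = v i"
    using exists_derivation[OF V independent v] generating by auto
  have "derivation V0 (carrier G) f" using f(1) V(2) unfolding derivation_def by blast
  then obtain g where g: "g \<in> carrier G" "\<And>y. y \<in> carrier G \<Longrightarrow> f y = com g y" using derivation_inner by blast
  have "com g y \<in> V" if "y \<in> carrier G" for y
    using f(1) g(2)[OF that, symmetric] that unfolding derivation_def by simp
  moreover have "com g p = \<one>" if "p \<in> Phi" for p
    using f(1) g(2)[of p] that Phi_carrier unfolding derivation_def by force
  moreover have "com g (x i) = v i" if "i < d" for i
    using f(2)[OF that] g(2)[OF x_carrier[OF that]] by simp
  ultimately show ?thesis using g(1) by blast
qed

text \<open>The homomorphism with values \<open>\<one>\<close> and \<open>z\<close> from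
  \<open>index_two_hom\<close> is a derivation, since \<open>G\<close> acts trivially on
  \<open>Om\<close>. The element inducing it belongs to \<open>K\<close>.\<close>

lemma exists_K_separating:
  assumes u: "u \<in> carrier G" "u \<notin> Phi" and z: "z \<in> Om"
  shows "\<exists>k\<in>K. com k u = z \<and> (\<forall>y\<in>carrier G. com k y = \<one> \<or> com k y = z)"
proof -
  obtain M where M: "subgroup M G" "Phi \<subseteq> M" "u \<notin> M" "carrier G = M \<union> {m \<otimes> u |m. m \<in> M}"
    and hom: "\<And>z a b. z \<in> Om \<Longrightarrow> a \<in> carrier G \<Longrightarrow> b \<in> carrier G \<Longrightarrow>
       (if a \<otimes> b \<in> M then \<one> else z) = (if a \<in> M then \<one> else z) \<otimes> (if b \<in> M then \<one> else z)"
    by (rule index_two_hom[OF u]) (rule that)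
  define f where "f y = (if y \<in> M then \<one> else z)" for y
  have f1: "f y = \<one>" if "y \<in> M" for y using that by (simp add: f_def)
  have fOm: "f y \<in> Om" for y using z subgroup.one_closed[OF subgroup_Om] by (simp add: f_def)
  have fm: "f (a \<otimes> b) = f a \<otimes> f b" if "a \<in> carrier G" "b \<in> carrier G" for a b
    unfolding f_def by (rule hom[OF z that])
  have "derivation V0 (carrier G) f"
    unfolding derivation_def using fOm Om_V0 fm M(2) by (auto simp: act_central Om_D(1) f1 subset_iff)
  then obtain g where g: "g \<in> carrier G" "\<And>y. y \<in> carrier G \<Longrightarrow> f y = com g y" using derivation_inner by blast
  have "g \<in> K" using g fOm by (intro K_of_com_Om) (auto simp flip: g(2))
  moreover have "com g u = z" using g(2)[OF u(1)] M(3) by (simp add: f_def)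
  moreover have "com g y = \<one> \<or> com g y = z" if "y \<in> carrier G" for y
    using g(2)[OF that] by (metis f_def)
  ultimately show ?thesis by blast
qed

text \<open>If \<open>k \<in> K - Phi\<close>, some \<open>k1 \<in> K\<close> has all commutators in \<open>{\<one>, z1}\<close> and \<open>com k1 k = z1\<close>. Then \<open>k1\<close>
  is not in \<open>Phi\<close> either, so some \<open>k2 \<in> K\<close> has \<open>com k2 k1 = z2 \<noteq> z1\<close>.\<close>

lemma K_subset_Phi: "K \<subseteq> Phi"
proof (rule ccontr)
  assume "\<not> K \<subseteq> Phi"
  then obtain k where k: "k \<in> K" "k \<notin> Phi" by blast
  have "finite Om" using Om_D(2) by (intro finite_sub) auto
  have "\<not> Om \<subseteq> {\<one>}" 
    using card_mono[of "{\<one>}" Om] card_Om by auto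
  then obtain z1 where z1: "z1 \<in> Om" "z1 \<noteq> \<one>" by blast
  have "card {\<one>, z1} \<le> 2" by (rule card_2_iff[THEN iffD2, THEN eq_refl]) (use z1 in auto)
  then have "\<not> Om \<subseteq> {\<one>, z1}" 
    using card_mono[of "{\<one>, z1}" Om] card_Om by auto
  then obtain z2 where z2: "z2 \<in> Om" "z2 \<noteq> \<one>" "z2 \<noteq> z1" by blast
  obtain k1 where k1: "k1 \<in> K" "com k1 k = z1" "\<And>y. y \<in> carrier G \<Longrightarrow> com k1 y = \<one> \<or> com k1 y = z1"
    using exists_K_separating[OF K_D(2)[OF k(1)] k(2) z1(1)] by blast
  have "k1 \<notin> Phi"
  proof
    assume "k1 \<in> Phi"
    then have "k \<otimes> k1 = k1 \<otimes> k" by (rule K_commute_Phi[OF k(1)])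
    then have "com k1 k = \<one>" using K_D(2) k(1) k1(1) by (simp add: com_eq_one)
    then show False using k1(2) z1(2) by simp
  qed
  then obtain k2 where k2: "k2 \<in> K" "com k2 k1 = z2"
    using exists_K_separating[OF K_D(2)[OF k1(1)] _ z2(1)] by blast
  have "com k1 k2 = inv z2" using com_inverse[of k2 k1] k2 k1(1) K_D(2) by simp
  also have "\<dots> = z2" using Om_D[OF z2(1)] by (simp add: inv_equality)
  finally show False using k1(3)[of k2] K_D(2)[OF k2(1)] z2 by auto
qed

lemma K_commute: "a \<in> K \<Longrightarrow> b \<in> K \<Longrightarrow> a \<otimes> b = b \<otimes> a"
  using K_commute_Phi K_subset_Phi by blast

text \<open>\<open>K\<close> lies in \<open>Phi\<close> and centralizes it, so all elements of
  \<open>L\<close> are admissible as values of derivations.\<close>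

lemma L_V0: "L \<subseteq> V0"
proof
  fix l assume l: "l \<in> L"
  then have "l \<in> K" using L_subset_K by auto
  then show "l \<in> V0" using K_subset_Phi K_commute_Phi[of l] L_D(3)[OF l] unfolding V0_def by blast
qed

lemma L_commute: "a \<in> L \<Longrightarrow> b \<in> L \<Longrightarrow> a \<otimes> b = b \<otimes> a"
  using K_commute L_subset_K by blast

lemma L_mult: assumes "a \<in> L" "b \<in> L" shows "a \<otimes> b \<in> L"
proof -
  have "a \<otimes> b \<in> V0" using assms L_V0 subgroup.m_closed[OF subgroup_V0] by blast
  moreover have "a \<otimes> b \<in> Z2" using assms L_D(1) subgroup.m_closed[OF subgroup_Z2] by blast
  ultimately show ?thesis using V0_D(3) by (simp add: L_def)
qed

lemma subgroup_L: "subgroup L G"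
  by (rule subgroup_mult_closedI)
    (use L_D L_mult Om_subset_L subgroup.one_closed[OF subgroup_Om] in auto)

lemma act_L: assumes "y \<in> carrier G" "l \<in> L" shows "act y l \<in> L"
proof -
  have "act y l \<in> V0" using assms L_V0 act_V0 by blast
  moreover have "act y l \<in> Z2" using assms L_D(1) Z2_normal by blast
  ultimately show ?thesis using V0_D(3) by (simp add: L_def)
qed

text \<open>Commutation with the basis embeds \<open>K\<close> modulo the center into the
  \<open>d\<close>-tuples over \<open>Om\<close>. Every tuple occurs, because for central values the
  conditions of \<open>inner_derivation\<close> hold trivially.\<close>

lemma card_K: "card K = card (center G) * card Om ^ d"
proof -
  define \<phi> where "\<phi> k = (\<lambda>i\<in>{..<d}. com k (x i))" for k
  have "card K = card (center G) * card (\<phi> ` K)"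
  proof (rule card_quotient_image[OF finite_carrier subgroup_K subgroup_center])
    show "center G \<subseteq> K"
      using center_subset_Z2 subgroup.m_closed[OF subgroup_center] by (auto simp: K_def)
    fix a b assume ab: "a \<in> K" "b \<in> K"
    note Z = K_D(1)[OF ab(1)] K_D(1)[OF ab(2)]
    have "\<phi> a = \<phi> b \<longleftrightarrow> (\<forall>i<d. com a (x i) = com b (x i))"
      by (auto simp: \<phi>_def fun_eq_iff restrict_def)
    also have "\<dots> \<longleftrightarrow> (\<forall>i<d. com (inv a \<otimes> b) (x i) = \<one>)"
      using com_inv_mult_Z2[OF Z] x_carrier by simp
    also have "\<dots> \<longleftrightarrow> inv a \<otimes> b \<in> center G"
    proof
      assume "\<forall>i<d. com (inv a \<otimes> b) (x i) = \<one>"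
      then show "inv a \<otimes> b \<in> center G"
        using Z subgroup.m_closed[OF subgroup_Z2] subgroup.m_inv_closed[OF subgroup_Z2]
        by (intro center_of_com_gens[OF x_image generate_x]) auto
    qed (simp add: com_center x_carrier)
    finally show "\<phi> a = \<phi> b \<longleftrightarrow> inv a \<otimes> b \<in> center G" .
  qed
  also have "\<phi> ` K = ({..<d} \<rightarrow>\<^sub>E Om)"
  proof (intro equalityI subsetI)
    fix v assume "v \<in> \<phi> ` K"
    then show "v \<in> {..<d} \<rightarrow>\<^sub>E Om" using com_K_Om x_carrier unfolding \<phi>_def by (auto intro!: restrict_PiE_iff[THEN iffD2])
  next
    fix v assume v: "v \<in> {..<d} \<rightarrow>\<^sub>E Om"
    have vO: "v i \<in> Om" if "i < d" for i using v that by auto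
    have "\<exists>g\<in>carrier G. (\<forall>i<d. com g (x i) = v i) \<and> (\<forall>y\<in>carrier G. com g y \<in> Om) \<and> (\<forall>p\<in>Phi. com g p = \<one>)"
    proof (rule inner_derivation[OF subgroup_Om Om_V0])
      fix i j assume "i < j" "j < d"
      then have "v i \<in> Om" "v j \<in> Om" using vO by auto
      then show "v i \<otimes> act (x i) (v j) = v j \<otimes> act (x j) (v i)"
        using \<open>i < j\<close> \<open>j < d\<close> by (simp add: act_central Om_D x_carrier centerD(2))
    qed (auto simp: act_central Om_D vO x_carrier)
    then obtain g where g: "g \<in> carrier G" "\<And>i. i < d \<Longrightarrow> com g (x i) = v i" "\<And>y. y \<in> carrier G \<Longrightarrow> com g y \<in> Om"
      by blast
    have "\<phi> g = v" using g(2) v by (auto simp: \<phi>_def fun_eq_iff PiE_def extensional_def)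
    then show "v \<in> \<phi> ` K" using K_of_com_Om[OF g(1,3)] by blast
  qed
  also have "card ({..<d} \<rightarrow>\<^sub>E Om) = card Om ^ d" by (simp add: card_PiE)
  finally show ?thesis .
qed

lemma card_center_pos: "card (center G) > 0"
  using subgroup.one_closed[OF subgroup_center] finite_sub[OF subgroup.subset[OF subgroup_center]] by (auto simp: card_gt_0_iff)

text \<open>As \<open>K\<close> is abelian, squaring is a homomorphism on it, with kernel
  \<open>L\<close>. The left-hand side is \<open>card K\<close>.\<close>

lemma card_L: "card (center G) * card Om ^ d = card L * card ((\<lambda>k. k \<otimes> k) ` K)"
  unfolding card_K[symmetric]
proof (rule card_quotient_image[OF finite_carrier subgroup_K subgroup_L L_subset_K])
  fix a b assume ab: "a \<in> K" "b \<in> K"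
  have c: "a \<in> carrier G" "b \<in> carrier G" using K_D ab by auto
  define c where "c = inv a \<otimes> b"
  have cK: "c \<in> K" using ab subgroup.m_closed[OF subgroup_K] subgroup.m_inv_closed[OF subgroup_K] by (simp add: c_def)
  then have cc: "c \<in> carrier G" using K_D by auto
  have b: "b = a \<otimes> c" using c by (simp add: c_def cancel_words)
  have "com c a = \<one>" using K_commute[OF cK ab(1)] cc c by (simp add: com_eq_one)
  then have bb: "b \<otimes> b = (a \<otimes> a) \<otimes> (c \<otimes> c)"
    using mult_square[OF c(1) cc] c cc by (simp add: b)
  have "a \<otimes> a = b \<otimes> b \<longleftrightarrow> c \<otimes> c = \<one>"
    unfolding bb using l_cancel_one'[of "a \<otimes> a" "c \<otimes> c"] c cc by auto
  also have "\<dots> \<longleftrightarrow> c \<in> L" using K_D(1)[OF cK] by (simp add: L_def)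
  finally show "a \<otimes> a = b \<otimes> b \<longleftrightarrow> inv a \<otimes> b \<in> L" by (simp add: c_def)
qed

lemma squares_K: "(\<lambda>k. k \<otimes> k) ` K \<subseteq> center G"
  using K_D(3) by auto

lemma card_squares_K: "card ((\<lambda>k. k \<otimes> k) ` K) \<le> card (center G)"
  by (intro card_mono finite_sub squares_K subgroup.subset[OF subgroup_center])

lemma card_L_ge: "card Om ^ d \<le> card L"
proof -
  have "card (center G) * card Om ^ d \<le> card (center G) * card L"
    unfolding card_L using mult_le_mono2[OF card_squares_K, of "card L"] by (simp add: mult.commute)
  then show ?thesis using card_center_pos by simp
qed

text \<open>Equality in \<open>card_L_ge\<close> leaves no room in \<open>card_squares_K\<close>.
  This later supplies a square root in \<open>K\<close> for every central element.\<close>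

lemma squares_K_eq: assumes "card L = card Om ^ d" shows "(\<lambda>k. k \<otimes> k) ` K = center G"
proof (rule card_subset_eq[OF _ squares_K])
  show "finite (center G)" by (intro finite_sub subgroup.subset[OF subgroup_center])
  have "card Om ^ d \<noteq> 0" using card_Om by simp
  moreover have "card ((\<lambda>k. k \<otimes> k) ` K) * card Om ^ d = card (center G) * card Om ^ d"
    unfolding card_L by (simp only: assms mult.commute)
  ultimately show "card ((\<lambda>k. k \<otimes> k) ` K) = card (center G)"
    using mult_right_cancel by blast
qed

text \<open>All squares of elements of \<open>K\<close> are central, so counting involutions along a
  series with cyclic factors bounds \<open>K\<close> modulo the center. The series rises by
  \<open>d (d - 1) / 2\<close> commutators from the center to \<open>Y\<close>, the product of the
  center and the derived subgroup, and by \<open>d\<close> generators from \<open>Y\<close> to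
  \<open>G\<close>.\<close>

lemma card_K_le: "card K \<le> 2 ^ (d * (d + 1) div 2) * card (center G)"
proof -
  let ?P = "SIGMA j:{..<d}. {..<j}"
  define S where "S = (\<lambda>(j, i). com (x i) (x j)) ` ?P"
  have SZ2: "S \<subseteq> Z2" using x_carrier by (auto simp: S_def intro!: com_in_Z2)
  then have Sc: "S \<subseteq> carrier G" using Z2_carrier by auto
  have finS: "finite S" by (simp add: S_def)
  have Zc: "center G \<subseteq> carrier G" using subgroup.subset[OF subgroup_center] .
  define Y where "Y = generate G (center G \<union> S)"
  have Y: "subgroup Y G" "center G \<subseteq> Y" "S \<subseteq> Y"
    using Zc Sc by (auto simp: Y_def intro: generate_is_subgroup generate.incl)
  \<comment> \<open>Modulo the center commutators are bilinear, as \<open>com y (com u z)\<close> is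
    central; so the commutators of the generators suffice.\<close>
  have comX: "com u v \<in> Y" if u: "u \<in> carrier G" and v: "v \<in> carrier G" for u v
  proof -
    have step: "com u (y \<otimes> z) \<in> Y" if "u \<in> carrier G" "y \<in> carrier G" "z \<in> carrier G" "com u y \<in> Y" "com u z \<in> Y" for u y z
    proof -
      have "y \<otimes> com u z \<otimes> inv y = com y (com u z) \<otimes> com u z" using that by (simp add: conj_com)
      moreover have "com y (com u z) \<in> Y" using that Y(2) com_Z2_right[OF com_in_Z2] by blast
      ultimately show ?thesis using that Y(1) by (simp add: com_mult_right subgroup.m_closed)
    qed
    have inv: "com b a \<in> Y" if "com a b \<in> Y" "a \<in> carrier G" "b \<in> carrier G" for a b
      using subgroup.m_inv_closed[OF Y(1) that(1)] that by (simp add: com_inverse)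
    have one: "\<one> \<in> Y" using subgroup.one_closed[OF Y(1)] .
    have gens: "com (x i) (x j) \<in> Y" if "i < d" "j < d" for i j
    proof -
      have S: "com (x i) (x j) \<in> Y" if "i < j" "j < d" for i j
        using Y(3) that by (force simp: S_def)
      consider "i < j" | "i = j" | "j < i" by linarith
      then show ?thesis
        using S that inv[OF S] x_carrier one by cases auto
    qed
    have 1: "com (x i) v \<in> Y" if "i < d" "v \<in> carrier G" for i v
      by (rule generate_carrier_induct[OF generate_x that(2)])
        (use that gens x_carrier one step in auto)
    show ?thesis
      by (rule generate_carrier_induct[OF generate_x v])
        (use u 1 inv x_carrier one step in auto)
  qed
  \<comment> \<open>All subgroups met here lie between the center and \<open>Z2\<close>, hence are
    normal.\<close>
  have card1: "card (K \<inter> Y) \<le> 2 ^ card S * card (K \<inter> center G)"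
    unfolding Y_def
  proof (rule card_involutions_generate[OF finite_carrier subgroup_center finS Sc])
    fix T n g assume T: "T \<subseteq> S" and n: "n \<in> generate G (center G \<union> T)" and g: "g \<in> carrier G"
    have sub: "subgroup (generate G (center G \<union> T)) G" using T Sc Zc by (intro generate_is_subgroup) auto
    have "generate G (center G \<union> T) \<subseteq> Z2"
      using T SZ2 center_subset_Z2 by (intro generate_subgroup_incl[OF _ subgroup_Z2]) auto
    then show "g \<otimes> n \<otimes> inv g \<in> generate G (center G \<union> T)"
      using com_Z2_right by (intro conj_closed_of_com[OF sub _ n g]) (auto intro!: generate.incl)
  qed (use K_D subgroup_K in auto)
  \<comment> \<open>All subgroups met here contain \<open>Y\<close> and with it every commutator,
    hence are normal.\<close>
  have card2: "card (K \<inter> generate G (Y \<union> x ` {..<d})) \<le> 2 ^ card (x ` {..<d}) * card (K \<inter> Y)"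
  proof (rule card_involutions_generate[OF finite_carrier Y(1) _ x_image])
    fix T n g assume T: "T \<subseteq> x ` {..<d}" and n: "n \<in> generate G (Y \<union> T)" and g: "g \<in> carrier G"
    have sub: "subgroup (generate G (Y \<union> T)) G"
      using T x_image subgroup.subset[OF Y(1)] by (intro generate_is_subgroup) auto
    show "g \<otimes> n \<otimes> inv g \<in> generate G (Y \<union> T)"
      using comX g subgroup.mem_carrier[OF sub] by (intro conj_closed_of_com[OF sub _ n g]) (auto intro!: generate.incl)
  qed (use K_D Y subgroup_K in auto)
  have "carrier G \<subseteq> generate G (Y \<union> x ` {..<d})"
    using mono_generate[of "x ` {..<d}" "Y \<union> x ` {..<d}"] generate_x by auto
  then have KX: "K \<inter> generate G (Y \<union> x ` {..<d}) = K" using K_D by auto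
  have "card (x ` {..<d}) \<le> d" using card_image_le[of "{..<d}" x] by simp
  moreover have "card S \<le> card ?P" unfolding S_def by (intro card_image_le) auto
  moreover have "card ?P = \<Sum>{..<d}" by (simp add: card_SigmaI)
  moreover have "\<Sum>{..<d} + d = d * (d + 1) div 2" by (induction d) auto
  ultimately have le: "card (x ` {..<d}) + card S \<le> d * (d + 1) div 2" by linarith
  have "card K \<le> 2 ^ card (x ` {..<d}) * card (K \<inter> Y)" using card2 KX by simp
  also have "\<dots> \<le> 2 ^ card (x ` {..<d}) * (2 ^ card S * card (K \<inter> center G))"
    using card1 by (rule mult_le_mono2)
  also have "\<dots> = 2 ^ (card (x ` {..<d}) + card S) * card (K \<inter> center G)" by (simp add: power_add)
  also have "\<dots> \<le> 2 ^ (d * (d + 1) div 2) * card (center G)"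
    using le by (intro mult_le_mono power_increasing card_mono finite_sub Zc) auto
  finally show ?thesis .
qed

lemma card_Om_power_le: "card Om ^ d \<le> 2 ^ (d * (d + 1) div 2)"
  using card_K_le card_center_pos unfolding card_K by simp

end

section \<open>Counting derivations\<close>

text \<open>The hypotheses close up to \<open>a \<le> b * c \<le> B * C \<le> a\<close>, and
  positivity of \<open>a\<close> makes every factor cancellable.\<close>

lemma mult_le_tight:
  fixes a b c B C :: nat
  assumes "a \<le> b * c" "b \<le> B" "c \<le> C" "B * C \<le> a" "0 < a"
  shows "b = B" "c = C" "b * c = a"
proof -
  have pos: "0 < b" "0 < c" "0 < B" "0 < C" using assms by (auto intro!: Nat.gr0I)
  have le: "B * C \<le> b * c" using assms by linarith
  show b: "b = B"
  proof (rule ccontr)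
    assume "b \<noteq> B"
    then have "b * C < B * C" using assms(2) pos by simp
    moreover have "b * c \<le> b * C" using assms(3) by simp
    ultimately show False using le by linarith
  qed
  show c: "c = C"
  proof (rule ccontr)
    assume "c \<noteq> C"
    then have "B * c < B * C" using assms(3) pos by simp
    then show False using le b by simp
  qed
  show "b * c = a" using assms b c by simp
qed

context class3_two_group
begin

definition coset_Z2 :: "'a \<Rightarrow> 'a set" where
  "coset_Z2 g = (\<lambda>s. g \<otimes> s) ` Z2"

lemma coset_Z2_eq:
  assumes g: "g \<in> carrier G" and h: "h \<in> carrier G"
  shows "coset_Z2 g = coset_Z2 h \<longleftrightarrow> inv g \<otimes> h \<in> Z2"
proof
  assume eq: "coset_Z2 g = coset_Z2 h"
  have "h \<in> coset_Z2 h" using h subgroup.one_closed[OF subgroup_Z2] by (force simp: coset_Z2_def)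
  then obtain s where "s \<in> Z2" "h = g \<otimes> s" using eq by (auto simp: coset_Z2_def)
  then show "inv g \<otimes> h \<in> Z2" using g Z2_carrier by (simp add: cancel_words)
next
  assume s: "inv g \<otimes> h \<in> Z2"
  let ?s = "inv g \<otimes> h"
  have h': "h = g \<otimes> ?s" using g h by (simp add: cancel_words)
  show "coset_Z2 g = coset_Z2 h"
  proof (intro equalityI subsetI)
    fix y assume "y \<in> coset_Z2 g"
    then obtain t where t: "t \<in> Z2" "y = g \<otimes> t" by (auto simp: coset_Z2_def)
    have "y = h \<otimes> (inv ?s \<otimes> t)" using t g h Z2_carrier by (simp add: words)
    moreover have "inv ?s \<otimes> t \<in> Z2" using s t subgroup_Z2 by (blast intro: subgroup.m_closed subgroup.m_inv_closed)
    ultimately show "y \<in> coset_Z2 h" by (auto simp: coset_Z2_def)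
  next
    fix y assume "y \<in> coset_Z2 h"
    then obtain t where t: "t \<in> Z2" "y = h \<otimes> t" by (auto simp: coset_Z2_def)
    have "y = g \<otimes> (?s \<otimes> t)" using t g h Z2_carrier by (simp add: words)
    moreover have "?s \<otimes> t \<in> Z2" using s t subgroup_Z2 by (blast intro: subgroup.m_closed)
    ultimately show "y \<in> coset_Z2 g" by (auto simp: coset_Z2_def)
  qed
qed

lemma Z2_subset_W: "Z2 \<subseteq> W"
  using subgroup.m_closed[OF subgroup_Z2] Z2_carrier by (auto simp: W_def)

text \<open>This is \<open>card_involutions_generate\<close> for the abelian group
  \<open>G / Z2\<close>. The set \<open>S\<close> generates modulo \<open>Z2\<close> only, which
  \<open>Z2_subset_Phi\<close> exploits.\<close>

lemma card_cosets_W: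
  assumes S: "finite S" "S \<subseteq> carrier G" "generate G (Z2 \<union> S) = carrier G"
  shows "card (coset_Z2 ` W) \<le> 2 ^ card S"
proof -
  have Wc: "W \<subseteq> carrier G" by (auto simp: W_def)
  have Zc: "Z2 \<subseteq> carrier G" using Z2_carrier by auto
  have pos: "card Z2 > 0" using finite_sub[OF Zc] subgroup.one_closed[OF subgroup_Z2] by (auto simp: card_gt_0_iff)
  have "card (W \<inter> generate G (Z2 \<union> S)) \<le> 2 ^ card S * card (W \<inter> Z2)"
  proof (rule card_involutions_generate[OF finite_carrier subgroup_Z2 S(1,2)])
    fix T n g assume T: "T \<subseteq> S" and n: "n \<in> generate G (Z2 \<union> T)" and g: "g \<in> carrier G"
    have sub: "subgroup (generate G (Z2 \<union> T)) G" using T S Zc by (intro generate_is_subgroup) auto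
    show "g \<otimes> n \<otimes> inv g \<in> generate G (Z2 \<union> T)"
      using g subgroup.mem_carrier[OF sub] com_in_Z2
      by (intro conj_closed_of_com[OF sub _ n g]) (auto intro!: generate.incl)
  qed (rule subgroup_W, simp add: W_def)
  then have "card W \<le> 2 ^ card S * card Z2"
    using S(3) Wc Z2_subset_W by (simp add: Int_absorb1 Int_absorb2)
  moreover have "card W = card Z2 * card (coset_Z2 ` W)"
    using Wc by (intro card_quotient_image[OF finite_carrier subgroup_W subgroup_Z2 Z2_subset_W] coset_Z2_eq) auto
  ultimately show ?thesis using pos by (simp add: mult.commute)
qed

end

context all_inner
begin

text \<open>A pair \<open>(j, j)\<close> stands for the condition coming from the square of
  \<open>x j\<close>, a pair \<open>(j, i)\<close> with \<open>i < j\<close> for the one coming from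
  the commutation of \<open>x i\<close> and \<open>x j\<close>.\<close>

abbreviation Q :: "(nat \<times> nat) set" where
  "Q \<equiv> SIGMA j:{..<d}. {..j}"

text \<open>The obstruction to the existence of a derivation with values \<open>l i\<close> at the generators \<open>x i\<close>.\<close>

definition obstruction :: "(nat \<Rightarrow> 'a) \<Rightarrow> nat \<times> nat \<Rightarrow> 'a" where
  "obstruction l = (\<lambda>(j, i)\<in>Q. if i = j then com (x j) (l j) else com (x i) (l j) \<otimes> com (x j) (l i))"

abbreviation T :: "(nat \<Rightarrow> 'a) set" where
  "T \<equiv> {..<d} \<rightarrow>\<^sub>E L"

text \<open>The kernel of \<open>obstruction\<close>; its members are the tuples that
  \<open>exists_inducing\<close> realizes by inner derivations.\<close>

definition T0 :: "(nat \<Rightarrow> 'a) set" where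
  "T0 = {l \<in> T. \<forall>q\<in>Q. obstruction l q = \<one>}"

lemma card_Q: "2 * card Q = d * (d + 1)"
proof -
  have "card Q = (\<Sum>j<d. Suc j)" by (simp add: card_SigmaI)
  moreover have "2 * (\<Sum>j<d. Suc j) = d * (d + 1)" by (induction d) auto
  ultimately show ?thesis by simp
qed

lemma T_D: "l \<in> T \<Longrightarrow> i < d \<Longrightarrow> l i \<in> L"
  using PiE_mem[of l "{..<d}" "\<lambda>_. L" i] by simp

lemma finite_T: "finite T"
  by (intro finite_PiE finite_sub) (auto dest: L_D)

text \<open>On \<open>L\<close> each map \<open>com y\<close> is a homomorphism into the central
  group \<open>Om\<close>, so \<open>obstruction\<close> is a homomorphism from \<open>T\<close> to
  the families over \<open>Om\<close> indexed by \<open>Q\<close>.\<close>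

lemma obstruction_mult:
  assumes "a \<in> T" "b \<in> T" "q \<in> Q"
  shows "obstruction (\<lambda>i\<in>{..<d}. a i \<otimes> b i) q = obstruction a q \<otimes> obstruction b q"
proof -
  obtain j i where q: "q = (j, i)" "j < d" "i \<le> j" using assms(3) by auto
  have L: "a i \<in> L" "b i \<in> L" "a j \<in> L" "b j \<in> L" using T_D assms(1,2) q by simp_all
  have xs: "x i \<in> carrier G" "x j \<in> carrier G" using x_carrier q by auto
  have m: "com y (u \<otimes> v) = com y u \<otimes> com y v" if "u \<in> L" "v \<in> L" "y \<in> carrier G" for u v y
    using com_right_mult_Z2' that L_D by blast
  have "(p \<otimes> q) \<otimes> (r \<otimes> s) = (p \<otimes> r) \<otimes> (q \<otimes> s)" if "p \<in> Om" "q \<in> Om" "r \<in> Om" "s \<in> Om" for p q r s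
  proof -
    note c = Om_D(2)[OF that(1)] Om_D(2)[OF that(2)] Om_D(2)[OF that(3)] Om_D(2)[OF that(4)]
    have "(p \<otimes> q) \<otimes> (r \<otimes> s) = p \<otimes> (q \<otimes> r) \<otimes> s" using c by (simp add: m_assoc)
    also have "q \<otimes> r = r \<otimes> q" using Om_D(1)[OF that(2)] c(3) by (rule centerD(2))
    finally show ?thesis using c by (simp add: m_assoc)
  qed
  note shuffle = this[OF com_L_Om com_L_Om com_L_Om com_L_Om]
  show ?thesis
    using q L xs by (auto simp: obstruction_def m shuffle)
qed

lemma obstruction_Om: assumes "l \<in> T" "q \<in> Q" shows "obstruction l q \<in> Om"
proof -
  obtain j i where q: "q = (j, i)" "j < d" "i \<le> j" using assms(2) by auto
  have "l i \<in> L" "l j \<in> L" using T_D[OF assms(1)] q by simp_all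
  then show ?thesis
    using q x_carrier com_L_Om by (auto simp: obstruction_def intro!: subgroup.m_closed[OF subgroup_Om])
qed

lemma T_mult: "a \<in> T \<Longrightarrow> b \<in> T \<Longrightarrow> (\<lambda>i\<in>{..<d}. a i \<otimes> b i) \<in> T"
  by (auto intro!: restrict_PiE_iff[THEN iffD2] L_mult)

lemma inj_on_translate: assumes "a \<in> T" shows "inj_on (\<lambda>l. \<lambda>i\<in>{..<d}. l i \<otimes> a i) T"
proof (rule inj_onI)
  fix l m assume l: "l \<in> T" and m: "m \<in> T" and eq: "(\<lambda>i\<in>{..<d}. l i \<otimes> a i) = (\<lambda>i\<in>{..<d}. m i \<otimes> a i)"
  show "l = m"
  proof (rule PiE_ext[OF l m])
    fix i assume i: "i \<in> {..<d}"
    have "l i \<otimes> a i = m i \<otimes> a i" using fun_cong[OF eq, of i] i by simp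
    moreover have "l i \<in> carrier G" "a i \<in> carrier G" "m i \<in> carrier G" using l m assms i L_D(2) by auto
    ultimately show "l i = m i" by simp
  qed
qed

text \<open>No fibre of a homomorphism exceeds the kernel: multiplication by \<open>a\<close>, which
  is its own inverse, carries the fibre of \<open>a\<close> into \<open>T0\<close>.\<close>

lemma card_T: "card T \<le> card T0 * card (obstruction ` T)"
proof (rule card_le_fibres[OF finite_T])
  fix a assume a: "a \<in> T"
  show "card {l \<in> T. obstruction l = obstruction a} \<le> card T0"
  proof (rule card_inj_on_le)
    show "inj_on (\<lambda>l. \<lambda>i\<in>{..<d}. l i \<otimes> a i) {l \<in> T. obstruction l = obstruction a}"
      using inj_on_translate[OF a] by (rule inj_on_subset) auto
    show "(\<lambda>l. \<lambda>i\<in>{..<d}. l i \<otimes> a i) ` {l \<in> T. obstruction l = obstruction a} \<subseteq> T0"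
    proof clarify
      fix l assume l: "l \<in> T" "obstruction l = obstruction a"
      show "(\<lambda>i\<in>{..<d}. l i \<otimes> a i) \<in> T0"
        unfolding T0_def
        using T_mult[OF l(1) a] obstruction_mult[OF l(1) a] l(2) Om_D(3)[OF obstruction_Om[OF a]] by auto
    qed
    show "finite T0" using finite_T by (simp add: T0_def)
  qed
qed

text \<open>The diagonal entries say that \<open>x i\<close> fixes \<open>l i\<close>. The others
  say that \<open>com (x i) (l j)\<close> and \<open>com (x j) (l i)\<close> agree, as they have
  order at most 2. Since these are central and \<open>L\<close> is abelian, this is the symmetry
  demanded by \<open>inner_derivation\<close>.\<close>

lemma exists_inducing:
  assumes l: "l \<in> T0"
  shows "\<exists>g\<in>carrier G. (\<forall>i<d. com g (x i) = l i) \<and> (\<forall>y\<in>carrier G. com g y \<in> L) \<and> (\<forall>p\<in>Phi. com g p = \<one>)"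
proof (rule inner_derivation[OF subgroup_L L_V0])
  have T: "l \<in> T" and ob: "\<And>q. q \<in> Q \<Longrightarrow> obstruction l q = \<one>" using l by (auto simp: T0_def)
  fix i assume i: "i < d"
  show li: "l i \<in> L" using T_D[OF T] i by simp
  have "com (x i) (l i) = \<one>" using ob[of "(i, i)"] i by (simp add: obstruction_def)
  then show "act (x i) (l i) = l i" using x_carrier[OF i] L_D(2)[OF li] by (simp add: act_com)
next
  have T: "l \<in> T" and ob: "\<And>q. q \<in> Q \<Longrightarrow> obstruction l q = \<one>" using l by (auto simp: T0_def)
  fix i j assume ij: "i < j" "j < d"
  have L: "l i \<in> L" "l j \<in> L" using T_D[OF T] ij by simp_all
  note c = L_D(2)[OF L(1)] L_D(2)[OF L(2)]
  have xs: "x i \<in> carrier G" "x j \<in> carrier G" using x_carrier ij by auto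
  have O: "com (x i) (l j) \<in> Om" "com (x j) (l i) \<in> Om" using com_L_Om L xs by auto
  have "com (x i) (l j) \<otimes> com (x j) (l i) = \<one>" using ob[of "(j, i)"] ij by (simp add: obstruction_def)
  then have "com (x i) (l j) = com (x j) (l i)"
    using Om_D[OF O(2)] Om_D[OF O(1)] by (metis inv_equality)
  moreover have "l i \<otimes> (z \<otimes> l j) = l j \<otimes> (z \<otimes> l i)" if z: "z \<in> Om" for z
  proof -
    have "l i \<otimes> (z \<otimes> l j) = z \<otimes> (l i \<otimes> l j)" using Om_D[OF z] c centerD(2)[of z "l i"] by (simp flip: m_assoc)
    also have "l i \<otimes> l j = l j \<otimes> l i" using L by (rule L_commute)
    also have "z \<otimes> (l j \<otimes> l i) = l j \<otimes> (z \<otimes> l i)" using Om_D[OF z] c centerD(2)[of z "l j"] by (simp flip: m_assoc)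
    finally show ?thesis .
  qed
  ultimately show "l i \<otimes> act (x i) (l j) = l j \<otimes> act (x j) (l i)"
    using xs c O by (simp add: act_com)
qed (rule act_L)

definition inducing :: "(nat \<Rightarrow> 'a) \<Rightarrow> 'a" where
  "inducing l = (SOME g. g \<in> carrier G \<and> (\<forall>i<d. com g (x i) = l i) \<and> (\<forall>y\<in>carrier G. com g y \<in> L) \<and> (\<forall>p\<in>Phi. com g p = \<one>))"

lemma inducing:
  assumes "l \<in> T0"
  shows "inducing l \<in> carrier G" "\<And>i. i < d \<Longrightarrow> com (inducing l) (x i) = l i"
    "\<And>y. y \<in> carrier G \<Longrightarrow> com (inducing l) y \<in> L" "\<And>p. p \<in> Phi \<Longrightarrow> com (inducing l) p = \<one>"
proof -
  have "inducing l \<in> carrier G \<and> (\<forall>i<d. com (inducing l) (x i) = l i) \<and>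
     (\<forall>y\<in>carrier G. com (inducing l) y \<in> L) \<and> (\<forall>p\<in>Phi. com (inducing l) p = \<one>)"
    unfolding inducing_def by (rule someI_ex) (use exists_inducing[OF assms] in \<open>simp only: Bex_def\<close>)
  then show "inducing l \<in> carrier G" "\<And>i. i < d \<Longrightarrow> com (inducing l) (x i) = l i"
    "\<And>y. y \<in> carrier G \<Longrightarrow> com (inducing l) y \<in> L" "\<And>p. p \<in> Phi \<Longrightarrow> com (inducing l) p = \<one>"
    by auto
qed

text \<open>Since \<open>g\<close> centralizes \<open>Phi\<close> and thereby
  \<open>com g y\<close>, the commutator of \<open>g \<otimes> g\<close> with \<open>y\<close> is
  the square of \<open>com g y\<close>, which is trivial.\<close>

lemma square_central:
  assumes g: "g \<in> carrier G" and L: "\<And>y. y \<in> carrier G \<Longrightarrow> com g y \<in> L"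
    and P: "\<And>p. p \<in> Phi \<Longrightarrow> com g p = \<one>"
  shows "g \<otimes> g \<in> center G"
proof -
  have "com (g \<otimes> g) y = \<one>" if y: "y \<in> carrier G" for y
  proof -
    have "com g y \<in> L" using L y .
    then have "com g y \<in> Phi" using L_V0 V0_D(1) by blast
    then have "act g (com g y) = com g y" using P g y by (simp add: act_com)
    then have "com (g \<otimes> g) y = com g y \<otimes> com g y" using g y by (simp add: com_mult_left act_def)
    then show ?thesis using L_D(3)[OF \<open>com g y \<in> L\<close>] by simp
  qed
  then show ?thesis using g by (simp add: center_iff_com)
qed

lemma inducing_W: assumes "l \<in> T0" shows "inducing l \<in> W"
  using square_central[OF inducing(1,3,4)[OF assms]] inducing(1)[OF assms] center_subset_Z2
  by (auto simp: W_def)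

text \<open>If the elements inducing \<open>l\<close> and \<open>a\<close> differ by
  \<open>s\<close> in \<open>Z2\<close>, then \<open>l i \<otimes> a i = com s (x i)\<close> is
  central of order at most 2. So a fibre is no larger than the set of \<open>d\<close>-tuples over
  \<open>Om\<close>.\<close>

lemma card_T0: "card T0 \<le> card Om ^ d * card ((\<lambda>l. coset_Z2 (inducing l)) ` T0)"
proof (rule card_le_fibres)
  show "finite T0" using finite_T by (simp add: T0_def)
  fix a assume a: "a \<in> T0"
  let ?F = "{l \<in> T0. coset_Z2 (inducing l) = coset_Z2 (inducing a)}"
  have aT: "a \<in> T" using a by (simp add: T0_def)
  have "card ?F \<le> card ({..<d} \<rightarrow>\<^sub>E Om)"
  proof (rule card_inj_on_le)
    show "inj_on (\<lambda>l. \<lambda>i\<in>{..<d}. l i \<otimes> a i) ?F"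
      using inj_on_translate[OF aT] by (rule inj_on_subset) (auto simp: T0_def)
    show "(\<lambda>l. \<lambda>i\<in>{..<d}. l i \<otimes> a i) ` ?F \<subseteq> {..<d} \<rightarrow>\<^sub>E Om"
    proof (intro image_subsetI restrict_PiE_iff[THEN iffD2] ballI)
      fix l i assume l: "l \<in> ?F" and i: "i \<in> {..<d}"
      have lT: "l \<in> T0" using l by simp
      define s where "s = inv (inducing a) \<otimes> inducing l"
      have s: "s \<in> Z2" using l coset_Z2_eq[OF inducing(1)[OF a] inducing(1)[OF lT]] by (simp add: s_def)
      have eq: "inducing l = inducing a \<otimes> s" using inducing(1)[OF a] inducing(1)[OF lT] by (simp add: s_def cancel_words)
      have li: "l i \<in> L" "a i \<in> L" using lT a i by (auto simp: T0_def)
      have xi: "x i \<in> carrier G" using i x_carrier by simp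
      have "l i = com s (x i) \<otimes> a i"
        using inducing(2)[OF lT, of i] inducing(2)[OF a, of i] i com_left_mult_Z2[OF inducing(1)[OF a] s xi]
        by (simp add: eq)
      then have "l i \<otimes> a i = com s (x i)"
        using L_D[OF li(2)] Z2_carrier[OF s] xi by (simp add: m_assoc)
      then have "l i \<otimes> a i \<in> center G" using com_Z2[OF s xi] by simp
      then show "l i \<otimes> a i \<in> Om" using L_D(3)[OF L_mult[OF li]] by (simp add: Om_def)
    qed
    show "finite ({..<d} \<rightarrow>\<^sub>E Om)" by (intro finite_PiE finite_sub) (auto dest: Om_D)
  qed
  then show "card ?F \<le> card Om ^ d" by (simp add: card_PiE)
qed

lemma carrier_generate_Z2_x: "generate G (Z2 \<union> x ` {..<d}) = carrier G"
proof (rule equalityI)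
  show "generate G (Z2 \<union> x ` {..<d}) \<subseteq> carrier G"
    using Z2_carrier x_image by (intro generate_incl) auto
  show "carrier G \<subseteq> generate G (Z2 \<union> x ` {..<d})"
    using mono_generate[of "x ` {..<d}" "Z2 \<union> x ` {..<d}"] generate_x by auto
qed

text \<open>After cancelling, the claim is \<open>2 ^ d \<le> card Om ^ e\<close> with
  \<open>e = d (d - 3) / 2\<close>. It follows from \<open>4 \<le> card Om\<close>, since
  \<open>d \<le> d (d - 3)\<close> for \<open>4 \<le> d\<close>.\<close>

lemma two_power_le: assumes "4 \<le> d"
  shows "card Om ^ d * 2 ^ d * card Om ^ card Q \<le> card Om ^ (d * d)"
proof -
  have Q: "2 * card Q = d * (d + 1)" by (rule card_Q)
  define e where "e = d * d - d - card Q"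
  obtain c where c: "d = c + 4" using assms by (metis add.commute le_Suc_ex)
  have e: "2 * e = d * c + d" unfolding e_def using Q by (simp add: c algebra_simps)
  have dd: "d * d = d + e + card Q" using e Q by (simp add: c algebra_simps)
  have "(2::nat) ^ d \<le> 2 ^ (2 * e)" using e by (intro power_increasing) auto
  also have "\<dots> = 4 ^ e" by (simp add: power_mult)
  also have "\<dots> \<le> card Om ^ e" using card_Om by (rule power_mono) simp
  finally have "card Om ^ d * 2 ^ d * card Om ^ card Q \<le> card Om ^ d * card Om ^ e * card Om ^ card Q"
    by (intro mult_le_mono) auto
  then show ?thesis by (simp add: dd power_add)
qed

text \<open>Write \<open>o\<close> for \<open>card Om\<close>. The numbers
  \<open>o ^ (d * d)\<close>, \<open>card L ^ d = card T\<close>, \<open>card T0\<close> times the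
  number of obstructions, and \<open>o ^ d * 2 ^ d * o ^ card Q\<close> increase weakly in this
  order, and the last is at most the first by \<open>two_power_le\<close>. Hence all are equal, and
  so are both sides of each estimate behind them.\<close>

lemma tight:
  assumes d: "4 \<le> d"
  shows "obstruction ` T = (Q \<rightarrow>\<^sub>E Om)" "card L = card Om ^ d"
    "card (coset_Z2 ` W) = 2 ^ d" "(\<lambda>l. coset_Z2 (inducing l)) ` T0 = coset_Z2 ` W"
proof -
  let ?o = "card Om"
  let ?c = "card ((\<lambda>l. coset_Z2 (inducing l)) ` T0)"
  have opos: "?o > 0" using card_Om by simp
  have finW: "finite (coset_Z2 ` W)" by (intro finite_imageI finite_sub) (auto simp: W_def)
  have sub: "(\<lambda>l. coset_Z2 (inducing l)) ` T0 \<subseteq> coset_Z2 ` W" using inducing_W by auto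
  have cW: "?c \<le> card (coset_Z2 ` W)" by (rule card_mono[OF finW sub])
  have "card (coset_Z2 ` W) \<le> 2 ^ card (x ` {..<d})"
    by (rule card_cosets_W) (use x_image carrier_generate_Z2_x in auto)
  also have "\<dots> \<le> 2 ^ d" using card_image_le[of "{..<d}" x] by (intro power_increasing) auto
  finally have W2: "card (coset_Z2 ` W) \<le> 2 ^ d" .
  have t0: "card T0 \<le> ?o ^ d * 2 ^ d"
    using card_T0 mult_le_mono2[of ?c "2 ^ d" "?o ^ d"] cW W2 by linarith
  have finO: "finite (Q \<rightarrow>\<^sub>E Om)" by (intro finite_PiE finite_sub) (auto dest: Om_D)
  have obs: "obstruction ` T \<subseteq> (Q \<rightarrow>\<^sub>E Om)"
  proof (intro image_subsetI PiE_I)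
    fix l q assume "l \<in> T" "q \<notin> Q" then show "obstruction l q = undefined" unfolding obstruction_def by (rule_tac restrict_apply[THEN trans]) simp
  qed (rule obstruction_Om)
  have cO: "card (Q \<rightarrow>\<^sub>E Om) = ?o ^ card Q" by (rule card_PiE[THEN trans]) auto
  have ob: "card (obstruction ` T) \<le> ?o ^ card Q" using card_mono[OF finO obs] cO by simp
  have LT: "card T = card L ^ d" by (simp add: card_PiE)
  have "?o ^ (d * d) \<le> card L ^ d" using power_mono[OF card_L_ge, of d] by (simp add: power_mult)
  then have chain: "?o ^ (d * d) \<le> card T0 * card (obstruction ` T)" using card_T LT by linarith
  note tight = mult_le_tight[OF chain t0 ob two_power_le[OF d]]
  have T0: "card T0 = ?o ^ d * 2 ^ d" and obe: "card (obstruction ` T) = ?o ^ card Q"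
    and prod: "card T0 * card (obstruction ` T) = ?o ^ (d * d)" using tight opos by auto
  show "obstruction ` T = (Q \<rightarrow>\<^sub>E Om)" by (rule card_subset_eq[OF finO obs]) (simp add: obe cO)
  have "card L ^ d \<le> (?o ^ d) ^ d" using card_T LT prod by (simp add: power_mult)
  then have "card L \<le> ?o ^ d" using d by (subst (asm) power_mono_iff) auto
  then show "card L = ?o ^ d" using card_L_ge by simp
  have "?o ^ d * 2 ^ d \<le> ?o ^ d * ?c" using card_T0 T0 by simp
  then have c2: "2 ^ d \<le> ?c" using opos by simp
  then show "card (coset_Z2 ` W) = 2 ^ d" using cW W2 by linarith
  then have "?c = card (coset_Z2 ` W)" using c2 cW by linarith
  then show "(\<lambda>l. coset_Z2 (inducing l)) ` T0 = coset_Z2 ` W" by (rule card_subset_eq[OF finW sub])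
qed

text \<open>If \<open>Z2\<close> had elements outside \<open>Phi\<close>, fewer than
  \<open>d\<close> elements would generate \<open>G\<close> modulo \<open>Z2\<close>. Then
  \<open>G / Z2\<close> would have fewer than \<open>2 ^ d\<close> elements of order at most 2,
  against \<open>tight\<close>.\<close>

lemma Z2_subset_Phi: assumes d: "4 \<le> d" shows "Z2 \<subseteq> Phi"
proof (rule ccontr)
  assume nsub: "\<not> Z2 \<subseteq> Phi"
  let ?N = "generate G (Phi \<union> Z2)"
  have c: "Phi \<union> Z2 \<subseteq> carrier G" using Phi_carrier Z2_carrier by auto
  have N: "subgroup ?N G" "Phi \<subseteq> ?N" using c by (auto intro: generate_is_subgroup generate.incl)
  obtain e y where y: "independent ?N e y" "generate G (?N \<union> y ` {..<e}) = carrier G" "card (carrier G) = 2 ^ e * card ?N"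
    using exists_basis[OF N] by blast
  have yc: "y ` {..<e} \<subseteq> carrier G" using y(1) by (auto simp: independent_def)
  have "Phi \<subset> ?N" using nsub by (auto intro: generate.incl)
  then have less: "card Phi < card ?N" using finite_sub[OF subgroup.subset[OF N(1)]] by (rule psubset_card_mono[rotated])
  have "card (carrier G) = 2 ^ d * card Phi"
    using card_independent[OF subgroup_Phi subset_refl independent] generating by simp
  then have "2 ^ e * card ?N = 2 ^ d * card Phi" using y(3) by simp
  then have "(2::nat) ^ e * card Phi < 2 ^ d * card Phi" using less mult_strict_left_mono[of "card Phi" "card ?N" "2 ^ e"] by simp
  then have "(2::nat) ^ e < 2 ^ d" by simp
  have "generate G (Phi \<union> (Z2 \<union> y ` {..<e})) = carrier G"
    using generate_idem_Un[OF c yc] y(2) by (simp add: Un_assoc)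
  moreover have "Z2 \<union> y ` {..<e} \<subseteq> carrier G" using Z2_carrier yc by blast
  ultimately have "generate G (Z2 \<union> y ` {..<e}) = carrier G"
    by (rule generate_modulo_Phi[rotated])
  from card_cosets_W[OF finite_imageI[OF finite_lessThan] yc this]
  have "card (coset_Z2 ` W) \<le> 2 ^ card (y ` {..<e})" .
  also have "\<dots> \<le> 2 ^ e" using card_image_le[of "{..<e}" y] by (intro power_increasing) auto
  also have "\<dots> < 2 ^ d" by fact
  finally show False using tight(3)[OF d] by simp
qed

end

section \<open>Commutators with powers, modulo the center\<close>

context class3_two_group
begin

text \<open>The map \<open>com s\<close> is a homomorphism into the abelian group
  \<open>center G\<close>, so it kills commutators.\<close>

lemma com_Z2_com:
  assumes "s \<in> Z2" "u \<in> carrier G" "y \<in> carrier G"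
  shows "com s (com u y) = \<one>"
proof -
  note c = com_Z2[OF assms(1,2)] com_Z2[OF assms(1,3)]
  have m: "com s (a \<otimes> b) = com s a \<otimes> com s b" if "a \<in> carrier G" "b \<in> carrier G" for a b
    using com_right_mult_Z2[OF assms(1)] that by blast
  have "com s (com u y) \<otimes> com s (y \<otimes> u) = com s (com u y \<otimes> (y \<otimes> u))"
    using assms by (simp add: m)
  also have "com u y \<otimes> (y \<otimes> u) = u \<otimes> y" using assms by (simp add: com_def words)
  also have "com s (u \<otimes> y) = com s u \<otimes> com s y" using assms by (simp add: m)
  also have "\<dots> = com s y \<otimes> com s u" using c centerD by blast
  also have "\<dots> = com s (y \<otimes> u)" using assms by (simp add: m)
  finally show ?thesis using assms Z2_carrier by simp
qed

text \<open>Conjugating \<open>com u y\<close> by a power of \<open>y\<close> changes it only by a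
  central factor.\<close>

lemma com_power_modulo_center:
  assumes "u \<in> carrier G" "y \<in> carrier G"
  shows "\<exists>z\<in>center G. com u (y [^] (n::nat)) = com u y [^] n \<otimes> z"
proof (induction n)
  case 0
  show ?case using assms subgroup.one_closed[OF subgroup_center] by (intro bexI[of _ \<one>]) auto
next
  case (Suc n)
  then obtain z where z: "z \<in> center G" "com u (y [^] n) = com u y [^] n \<otimes> z" by blast
  note zc = centerD(1)[OF z(1)]
  let ?t = "com (y [^] n) (com u y)"
  have t: "?t \<in> center G" using assms com_Z2_right[OF com_in_Z2] by simp
  note tc = centerD(1)[OF t]
  have "com u (y [^] Suc n) = com u (y [^] n) \<otimes> (y [^] n \<otimes> com u y \<otimes> inv (y [^] n))"
    using assms by (simp add: com_mult_right)
  also have "\<dots> = (com u y [^] n \<otimes> z) \<otimes> (?t \<otimes> com u y)"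
    using assms z by (simp add: conj_com)
  also have "\<dots> = com u y [^] n \<otimes> ((z \<otimes> ?t) \<otimes> com u y)"
    using assms zc tc by (simp add: m_assoc)
  also have "(z \<otimes> ?t) \<otimes> com u y = com u y \<otimes> (z \<otimes> ?t)"
    using assms subgroup.m_closed[OF subgroup_center z(1) t] by (intro centerD(2)) auto
  finally have "com u (y [^] Suc n) = com u y [^] Suc n \<otimes> (z \<otimes> ?t)"
    using assms zc tc by (simp add: m_assoc)
  then show ?case using subgroup.m_closed[OF subgroup_center z(1) t] by blast
qed

text \<open>Modulo the center the two factors are the \<open>n\<close>-th powers of
  \<open>com u y\<close> and of its inverse \<open>com y u\<close>.\<close>

lemma com_power_swap_central:
  assumes "u \<in> carrier G" "y \<in> carrier G"
  shows "com u (y [^] (n::nat)) \<otimes> com y (u [^] n) \<in> center G"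
proof -
  obtain z where z: "z \<in> center G" "com u (y [^] n) = com u y [^] n \<otimes> z"
    using com_power_modulo_center[OF assms] by blast
  obtain w where w: "w \<in> center G" "com y (u [^] n) = com y u [^] n \<otimes> w"
    using com_power_modulo_center[OF assms(2,1)] by blast
  have "com y u [^] n = inv (com u y [^] n)"
    using assms by (simp add: nat_pow_inv flip: com_inverse[of u y])
  then have "com u (y [^] n) \<otimes> com y (u [^] n) = com u y [^] n \<otimes> (z \<otimes> inv (com u y [^] n)) \<otimes> w"
    using z w assms centerD(1)[OF z(1)] centerD(1)[OF w(1)] by (simp add: m_assoc)
  also have "z \<otimes> inv (com u y [^] n) = inv (com u y [^] n) \<otimes> z"
    using z(1) assms by (intro centerD(2)) auto
  finally have "com u (y [^] n) \<otimes> com y (u [^] n) = z \<otimes> w"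
    using assms centerD(1)[OF z(1)] centerD(1)[OF w(1)] by (simp add: words)
  then show ?thesis using subgroup.m_closed[OF subgroup_center z(1) w(1)] by simp
qed

lemma com_power_self: "u \<in> carrier G \<Longrightarrow> com u (u [^] (n::nat)) = \<one>"
  using nat_pow_Suc2[of u n] by (simp add: com_eq_one)

end

section \<open>Exclusion of four or more generators\<close>

context all_inner
begin

text \<open>By \<open>tight\<close> the coset of \<open>w\<close> contains an element
  \<open>g\<close> inducing a derivation into \<open>L\<close>. Its square is central, hence equal
  to \<open>k \<otimes> k\<close> for some \<open>k\<close> in \<open>K\<close>. As \<open>g\<close>
  commutes with \<open>k\<close>, which lies in \<open>Phi\<close>, dividing by \<open>k\<close>
  makes the square trivial; this changes commutators only by factors in \<open>Om\<close>.\<close>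

lemma involution_in_coset:
  assumes d: "4 \<le> d" and w: "w \<in> W"
  shows "\<exists>v\<in>carrier G. inv w \<otimes> v \<in> Z2 \<and> v \<otimes> v = \<one> \<and> (\<forall>y\<in>carrier G. com v y \<in> L) \<and> (\<forall>p\<in>Phi. com v p = \<one>)"
proof -
  have wc: "w \<in> carrier G" using w by (simp add: W_def)
  obtain l where l: "l \<in> T0" "coset_Z2 w = coset_Z2 (inducing l)"
    using tight(4)[OF d] w by blast
  define g where "g = inducing l"
  note g = inducing[OF l(1), folded g_def]
  have "g \<otimes> g \<in> center G" using square_central[OF g(1,3,4)] .
  then obtain k where k: "k \<in> K" "g \<otimes> g = k \<otimes> k" using squares_K_eq[OF tight(2)[OF d]] by blast
  have kc: "k \<in> carrier G" using K_D k by auto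
  have ik: "inv k \<in> K" "inv k \<in> Phi" "inv k \<in> Z2" "inv k \<in> carrier G"
    using subgroup.m_inv_closed[OF subgroup_K k(1)] K_subset_Phi K_D by auto
  define v where "v = g \<otimes> inv k"
  have vc: "v \<in> carrier G" using g(1) kc by (simp add: v_def)
  have "com g (inv k) = \<one>" using g(4)[OF ik(2)] .
  then have "com (inv k) g = \<one>" using com_inverse[of g "inv k"] g(1) ik(4) by simp
  then have "v \<otimes> v = (g \<otimes> g) \<otimes> (inv k \<otimes> inv k)"
    using mult_square[OF g(1) ik(4)] g(1) kc by (simp add: v_def)
  also have "\<dots> = \<one>" using kc by (simp add: k(2) words)
  finally have vv: "v \<otimes> v = \<one>" .
  have comv: "com v y = com (inv k) y \<otimes> com g y" if "y \<in> carrier G" for y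
    unfolding v_def using com_left_mult_Z2[OF g(1) ik(3) that] .
  have "com v y \<in> L" if "y \<in> carrier G" for y
    using comv[OF that] com_K_Om[OF ik(1) that] g(3)[OF that] Om_subset_L L_mult by auto
  moreover have "com v p = \<one>" if p: "p \<in> Phi" for p
  proof -
    have pc: "p \<in> carrier G" using p Phi_carrier by auto
    have "com (inv k) p = \<one>" using K_commute_Phi[OF ik(1) p] ik(4) pc by (simp add: com_eq_one)
    then show ?thesis using comv[OF pc] g(4)[OF p] by simp
  qed
  moreover have "inv w \<otimes> v \<in> Z2"
  proof -
    have "inv w \<otimes> g \<in> Z2" using l(2) coset_Z2_eq[OF wc g(1)] by (simp add: g_def)
    moreover have "inv w \<otimes> v = (inv w \<otimes> g) \<otimes> inv k" using wc g(1) kc by (simp add: v_def m_assoc)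
    ultimately show ?thesis using ik(3) subgroup.m_closed[OF subgroup_Z2] by simp
  qed
  ultimately show ?thesis using vc vv by blast
qed

text \<open>\<open>P i\<close> is the last power \<open>x i ^ (2 ^ b)\<close> before all of them lie in \<open>Z2\<close>, and \<open>v i\<close> is an involution
  in its coset. Modulo the center, \<open>com (x i) (P j)\<close> and \<open>com (x j) (P i)\<close> are inverse powers of
  \<open>com (x i) (x j)\<close>; hence the obstruction \<open>c\<close> of \<open>v\<close> has values in \<open>Om\<close> and is cancelled by that of
  some \<open>l\<close>.\<close>

lemma d_less_4: "d < 4"
proof (rule ccontr)
  assume "\<not> d < 4"
  then have d: "4 \<le> d" by simp
  note ZP = Z2_subset_Phi[OF d]
  have notZ2: "\<not> carrier G \<subseteq> Z2"
  proof
    assume "carrier G \<subseteq> Z2"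
    then have "x 0 \<in> Phi" using x_carrier[of 0] d ZP by auto
    then have "x 0 \<in> generate G (Phi \<union> x ` {..<0})" by (auto intro: generate.incl)
    moreover have "0 < d" using d by simp
    ultimately show False using independent unfolding independent_def by blast
  qed
  have x_notZ2: "\<not> x ` {..<d} \<subseteq> Z2"
    using generate_subgroup_incl[OF _ subgroup_Z2] generate_x notZ2 by metis
  obtain n :: nat where n: "\<And>y. y \<in> carrier G \<Longrightarrow> y [^] ((2::nat) ^ n) = \<one>" using pow_order_two by metis
  define a where "a = (LEAST a. \<forall>i<d. x i [^] ((2::nat) ^ a) \<in> Z2)"
  have a: "\<forall>i<d. x i [^] ((2::nat) ^ a) \<in> Z2"
    unfolding a_def by (rule LeastI[of _ n]) (simp add: n x_carrier subgroup.one_closed[OF subgroup_Z2])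
  have "a \<noteq> 0"
  proof
    assume "a = 0"
    then have "x ` {..<d} \<subseteq> Z2" using a x_carrier by auto
    then show False using x_notZ2 by contradiction
  qed
  then obtain b where b: "a = Suc b" using not0_implies_Suc by blast
  define N where "N = (2::nat) ^ b"
  define P where "P i = x i [^] N" for i
  have PZ: "\<not> (\<forall>i<d. P i \<in> Z2)"
    using not_less_Least[of b "\<lambda>a. \<forall>i<d. x i [^] ((2::nat) ^ a) \<in> Z2"] b unfolding a_def P_def N_def by simp
  have Pc: "P i \<in> carrier G" if "i < d" for i using x_carrier[OF that] by (simp add: P_def)
  have PW: "P i \<in> W" if "i < d" for i
  proof -
    have "P i \<otimes> P i = x i [^] ((2::nat) ^ a)" using x_carrier[OF that] by (simp add: P_def N_def b nat_pow_mult mult_2)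
    then show ?thesis using a that Pc by (simp add: W_def)
  qed
  have "\<forall>i. \<exists>v. i < d \<longrightarrow> v \<in> carrier G \<and> inv (P i) \<otimes> v \<in> Z2 \<and> v \<otimes> v = \<one> \<and> (\<forall>y\<in>carrier G. com v y \<in> L) \<and> (\<forall>p\<in>Phi. com v p = \<one>)"
    using involution_in_coset[OF d PW] by blast
  then obtain v where "\<forall>i. i < d \<longrightarrow> v i \<in> carrier G \<and> inv (P i) \<otimes> v i \<in> Z2 \<and> v i \<otimes> v i = \<one> \<and>
      (\<forall>y\<in>carrier G. com (v i) y \<in> L) \<and> (\<forall>p\<in>Phi. com (v i) p = \<one>)"
    by (elim exE[OF choice]) (rule that)
  then have v: "\<And>i. i < d \<Longrightarrow> v i \<in> carrier G" "\<And>i. i < d \<Longrightarrow> inv (P i) \<otimes> v i \<in> Z2"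
    "\<And>i. i < d \<Longrightarrow> v i \<otimes> v i = \<one>" "\<And>i y. i < d \<Longrightarrow> y \<in> carrier G \<Longrightarrow> com (v i) y \<in> L"
    "\<And>i p. i < d \<Longrightarrow> p \<in> Phi \<Longrightarrow> com (v i) p = \<one>" by blast+
  define s where "s i = inv (P i) \<otimes> v i" for i
  have s: "s i \<in> Z2" "v i = P i \<otimes> s i" if "i < d" for i
    using v(1,2)[OF that] Pc[OF that] by (simp_all add: s_def cancel_words)
  \<comment> \<open>For \<open>b = 0\<close> one has \<open>v i = x i \<otimes> s i\<close>. This
    element centralizes \<open>Phi\<close>, and \<open>s i\<close> commutes with commutators, so
    each \<open>x i\<close> would commute with all commutators and \<open>G\<close> would equal
    \<open>Z2\<close>.\<close>
  have "b \<noteq> 0"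
  proof
    assume "b = 0"
    then have Px: "P i = x i" if "i < d" for i using x_carrier[OF that] by (simp add: P_def N_def)
    have "com u y \<in> center G" if u: "u \<in> carrier G" and y: "y \<in> carrier G" for u y
    proof (rule center_of_com_gens[OF x_image generate_x com_in_Z2[OF u y]])
      fix t assume "t \<in> x ` {..<d}"
      then obtain i where i: "i < d" "t = x i" by auto
      have c: "com u y \<in> carrier G" "com u y \<in> Phi" using u y com_Phi by auto
      have "com (s i) (com u y) \<otimes> com (x i) (com u y) = com (v i) (com u y)"
        using com_left_mult_Z2[OF x_carrier[OF i(1)] s(1)[OF i(1)] c(1)] s(2)[OF i(1)] Px[OF i(1)] by simp
      also have "\<dots> = \<one>" using v(5)[OF i(1) c(2)] .
      finally have "com (x i) (com u y) = \<one>"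
        using com_Z2_com[OF s(1)[OF i(1)] u y] x_carrier[OF i(1)] c by simp
      then show "com (com u y) t = \<one>"
        using com_inverse[of "x i" "com u y"] x_carrier[OF i(1)] c i by simp
    qed
    then have "carrier G \<subseteq> Z2" by (auto simp: Z2_def)
    then show False using notZ2 by contradiction
  qed
  then obtain b' where b': "b = Suc b'" using not0_implies_Suc by blast
  \<comment> \<open>With \<open>b\<close> positive, \<open>P i\<close> is a square, so
    \<open>v i\<close> lies in \<open>Phi\<close>; this makes it admissible as a value of a
    derivation.\<close>
  have vV: "v i \<in> V0" if i: "i < d" for i
  proof -
    have "P i = x i [^] ((2::nat) ^ b') \<otimes> x i [^] ((2::nat) ^ b')"
      using x_carrier[OF i] by (simp add: P_def N_def b' nat_pow_mult mult_2)
    then have "P i \<in> Phi" using square_Phi x_carrier[OF i] by simp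
    then have "v i \<in> Phi" using s[OF i] ZP subgroup.m_closed[OF subgroup_Phi] by auto
    moreover have "v i \<otimes> p = p \<otimes> v i" if p: "p \<in> Phi" for p
      using v(5)[OF i p] v(1)[OF i] p Phi_carrier by (simp add: com_eq_one subset_iff)
    ultimately show ?thesis using v(3)[OF i] unfolding V0_def by blast
  qed
  have comL: "com (x i) (v j) \<in> L" if "i < d" "j < d" for i j
    using subgroup.m_inv_closed[OF subgroup_L v(4)[OF that(2) x_carrier[OF that(1)]]]
    by (simp add: com_inverse v(1) x_carrier that)
  have comv: "com (x i) (v j) = com (x i) (P j) \<otimes> com (x i) (s j)" "com (x i) (s j) \<in> center G" if "i < d" "j < d" for i j
    using com_right_mult_Z2'[OF x_carrier[OF that(1)] Pc[OF that(2)] s(1)[OF that(2)]] s[OF that(2)]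
      com_Z2_right[OF s(1)[OF that(2)] x_carrier[OF that(1)]] by simp_all
  define c where "c = (\<lambda>(j, i)\<in>Q. if i = j then com (x j) (v j) else com (x i) (v j) \<otimes> com (x j) (v i))"
  have cOm: "c q \<in> Om" if q: "q \<in> Q" for q
  proof -
    obtain j i where ji: "q = (j, i)" "j < d" "i \<le> j" using q by auto
    then have id: "i < d" by simp
    note xc = x_carrier[OF ji(2)] x_carrier[OF id]
    show ?thesis
    proof (cases "i = j")
      case True
      have "com (x j) (v j) = com (x j) (s j)"
        using comv[OF ji(2,2)] centerD(1)[OF comv(2)[OF ji(2,2)]] xc by (simp add: P_def com_power_self)
      then have "com (x j) (v j) \<in> center G" using comv(2)[OF ji(2,2)] by simp
      then have "com (x j) (v j) \<in> Om" using L_D(3)[OF comL[OF ji(2,2)]] by (simp add: Om_def)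
      then show ?thesis using ji True by (simp add: c_def)
    next
      case False
      let ?p = "com (x i) (P j)" and ?q = "com (x j) (P i)"
      let ?z = "com (x i) (s j)" and ?w = "com (x j) (s i)"
      note z = comv(2)[OF id ji(2)] and w = comv(2)[OF ji(2) id]
      have pq: "?p \<in> carrier G" "?q \<in> carrier G" using xc Pc ji(2) id by auto
      have "com (x i) (v j) \<otimes> com (x j) (v i) = ?p \<otimes> (?z \<otimes> ?q) \<otimes> ?w"
        using comv(1)[OF id ji(2)] comv(1)[OF ji(2) id] pq centerD(1)[OF z] centerD(1)[OF w] by (simp add: m_assoc)
      also have "?z \<otimes> ?q = ?q \<otimes> ?z" using z pq by (intro centerD(2))
      also have "?p \<otimes> (?q \<otimes> ?z) \<otimes> ?w = (?p \<otimes> ?q) \<otimes> (?z \<otimes> ?w)"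
        using pq centerD(1)[OF z] centerD(1)[OF w] by (simp add: m_assoc)
      finally have eq: "com (x i) (v j) \<otimes> com (x j) (v i) = (?p \<otimes> ?q) \<otimes> (?z \<otimes> ?w)" .
      have "?p \<otimes> ?q \<in> center G" unfolding P_def by (rule com_power_swap_central[OF xc(2,1)])
      then have "com (x i) (v j) \<otimes> com (x j) (v i) \<in> center G"
        unfolding eq by (rule subgroup.m_closed[OF subgroup_center _ subgroup.m_closed[OF subgroup_center z w]])
      then have "com (x i) (v j) \<otimes> com (x j) (v i) \<in> Om"
        using L_D(3)[OF L_mult[OF comL[OF id ji(2)] comL[OF ji(2) id]]] by (simp add: Om_def)
      then show ?thesis using ji False by (simp add: c_def)
    qed
  qed
  have "c \<in> Q \<rightarrow>\<^sub>E Om"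
  proof (rule PiE_I[OF cOm])
    fix q assume "q \<notin> Q" then show "c q = undefined" unfolding c_def by (rule_tac restrict_apply[THEN trans]) simp
  qed
  \<comment> \<open>By \<open>tight\<close> every family over \<open>Om\<close> is the obstruction
    of a tuple over \<open>L\<close>. As the entries of \<open>c\<close> have order at most 2,
    multiplying \<open>v\<close> by \<open>l\<close> makes the obstruction trivial.\<close>
  then obtain l where l: "l \<in> T" "obstruction l = c"
    unfolding tight(1)[OF d, symmetric] by (elim imageE) (rule that, simp_all)
  have lL: "l i \<in> L" if "i < d" for i by (rule T_D[OF l(1) that])
  have lV: "l i \<in> V0" if "i < d" for i using lL[OF that] L_V0 by auto
  define w where "w i = v i \<otimes> l i" for i
  have wV: "w i \<in> V0" if "i < d" for i
    unfolding w_def using vV[OF that] lV[OF that] by (rule subgroup.m_closed[OF subgroup_V0])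
  have comw: "com (x i) (w j) = com (x i) (v j) \<otimes> com (x i) (l j)" if "i < d" "j < d" for i j
    unfolding w_def using com_right_mult_Z2' x_carrier[OF that(1)] v(1)[OF that(2)] L_D(1)[OF lL[OF that(2)]] by blast
  have comwL: "com (x i) (w j) \<in> L" if "i < d" "j < d" for i j
    unfolding comw[OF that] using comL[OF that] com_L_Om[OF lL[OF that(2)] x_carrier[OF that(1)]] Om_subset_L L_mult by auto
  have comw_self: "com (x i) (w i) = \<one>" if i: "i < d" for i
  proof -
    have q: "(i, i) \<in> Q" using i by simp
    have "com (x i) (v i) = com (x i) (l i)"
      using fun_cong[OF l(2), of "(i, i)"] q by (simp add: c_def obstruction_def)
    then show ?thesis using comw[OF i i] L_D(3)[OF comL[OF i i]] by simp
  qed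
  have comw_sym: "com (x i) (w j) = com (x j) (w i)" if ij: "i < j" "j < d" for i j
  proof -
    have i: "i < d" using ij by simp
    have q: "(j, i) \<in> Q" using ij by simp
    have eq: "com (x i) (v j) \<otimes> com (x j) (v i) = com (x i) (l j) \<otimes> com (x j) (l i)"
      using fun_cong[OF l(2), of "(j, i)"] q ij by (simp add: c_def obstruction_def)
    note O = com_L_Om[OF lL[OF ij(2)] x_carrier[OF i]] com_L_Om[OF lL[OF i] x_carrier[OF ij(2)]]
    note Lc = L_D(2)[OF comL[OF i ij(2)]] L_D(2)[OF comL[OF ij(2) i]]
    have "com (x i) (w j) \<otimes> com (x j) (w i) = com (x i) (v j) \<otimes> (com (x i) (l j) \<otimes> com (x j) (v i)) \<otimes> com (x j) (l i)"
      unfolding comw[OF i ij(2)] comw[OF ij(2) i] using Om_D(2)[OF O(1)] Om_D(2)[OF O(2)] Lc by (simp add: m_assoc)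
    also have "com (x i) (l j) \<otimes> com (x j) (v i) = com (x j) (v i) \<otimes> com (x i) (l j)"
      using Om_D(1)[OF O(1)] Lc(2) by (rule centerD(2))
    also have "com (x i) (v j) \<otimes> (com (x j) (v i) \<otimes> com (x i) (l j)) \<otimes> com (x j) (l i)
        = (com (x i) (v j) \<otimes> com (x j) (v i)) \<otimes> (com (x i) (l j) \<otimes> com (x j) (l i))"
      using Om_D(2)[OF O(1)] Om_D(2)[OF O(2)] Lc by (simp add: m_assoc)
    also have "\<dots> = \<one>"
      unfolding eq using Om_D(3)[OF subgroup.m_closed[OF subgroup_Om O]] .
    finally have "com (x i) (w j) = inv (com (x j) (w i))"
      using L_D(2)[OF comwL[OF i ij(2)]] L_D(2)[OF comwL[OF ij(2) i]] by (simp add: inv_equality)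
    also have "\<dots> = com (x j) (w i)"
      using L_D[OF comwL[OF ij(2) i]] by (simp add: inv_equality)
    finally show ?thesis .
  qed
  \<comment> \<open>The module is \<open>V0\<close> this time, because the \<open>w i\<close> do not
    all lie in \<open>Z2\<close>, let alone in \<open>L\<close>.\<close>
  have "\<exists>g\<in>carrier G. (\<forall>i<d. com g (x i) = w i) \<and> (\<forall>y\<in>carrier G. com g y \<in> V0) \<and> (\<forall>p\<in>Phi. com g p = \<one>)"
  proof (rule inner_derivation[OF subgroup_V0 subset_refl act_V0 wV])
    fix i assume i: "i < d"
    show "act (x i) (w i) = w i" using comw_self[OF i] x_carrier[OF i] V0_D(2)[OF wV[OF i]] by (simp add: act_com)
  next
    fix i j assume ij: "i < j" "j < d"
    then have i: "i < d" by simp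
    define t where "t = com (x j) (w i)"
    have t: "t \<in> V0" using comwL[OF ij(2) i] L_V0 by (auto simp: t_def)
    note c = V0_D(2)[OF t] V0_D(2)[OF wV[OF i]] V0_D(2)[OF wV[OF ij(2)]]
    have "w i \<otimes> (t \<otimes> w j) = (w i \<otimes> t) \<otimes> w j" using c by (simp add: m_assoc)
    also have "w i \<otimes> t = t \<otimes> w i" using V0_commute[OF wV[OF i] t] .
    also have "(t \<otimes> w i) \<otimes> w j = w j \<otimes> (t \<otimes> w i)"
      using V0_commute[OF subgroup.m_closed[OF subgroup_V0 t wV[OF i]] wV[OF ij(2)]] .
    finally have "w i \<otimes> (t \<otimes> w j) = w j \<otimes> (t \<otimes> w i)" .
    then show "w i \<otimes> act (x i) (w j) = w j \<otimes> act (x j) (w i)"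
      using comw_sym[OF ij] x_carrier[OF i] x_carrier[OF ij(2)] c by (simp add: act_com t_def)
  qed
  then obtain g where g: "g \<in> carrier G" "\<And>i. i < d \<Longrightarrow> com g (x i) = w i" by blast
  \<comment> \<open>Values of an inner derivation are commutators, hence lie in \<open>Z2\<close>.
    As \<open>w i\<close> and \<open>P i\<close> differ by an element of \<open>Z2\<close>, this
    contradicts the minimality of \<open>a\<close>.\<close>
  have "P i \<in> Z2" if i: "i < d" for i
  proof -
    have wZ: "w i \<in> Z2" using g(2)[OF i] com_in_Z2[OF g(1) x_carrier[OF i]] by simp
    have "P i = w i \<otimes> inv (s i \<otimes> l i)"
      using s[OF i] Z2_carrier[OF s(1)[OF i]] L_D(2)[OF lL[OF i]] Pc[OF i] by (simp add: w_def words)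
    then show ?thesis
      using wZ s(1)[OF i] L_D(1)[OF lL[OF i]] subgroup_Z2 by (auto intro!: subgroup.m_closed subgroup.m_inv_closed)
  qed
  then show False using PZ by blast
qed

end

section \<open>The rank of the center and bounds for the number of generators\<close>

context class3_two_group
begin

lemma min_gens_attained: "\<exists>S. S \<subseteq> carrier G \<and> finite S \<and> card S = min_gens G \<and> generate G S = carrier G"
proof -
  have "generate G (carrier G) = carrier G"
    using generateI[OF subgroup_self, of "carrier G"] by auto
  then have "\<exists>n S. S \<subseteq> carrier G \<and> finite S \<and> card S = n \<and> generate G S = carrier G"
    using finite_carrier by blast
  then show ?thesis unfolding min_gens_def by (rule LeastI_ex)
qed

lemma cyclic_of_min_gens: assumes "min_gens G \<le> 1" shows "cyclic_group G"
proof -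
  obtain S where S: "S \<subseteq> carrier G" "finite S" "card S \<le> 1" "generate G S = carrier G"
    using min_gens_attained assms by auto
  \<comment> \<open>When \<open>S\<close> is empty, the identity serves as generator.\<close>
  obtain g where g: "g \<in> carrier G" "S \<subseteq> {g}"
  proof (cases "S = {}")
    case True
    then show ?thesis using that[OF one_closed] by simp
  next
    case False
    then obtain g where gS: "g \<in> S" by blast
    have "h = g" if "h \<in> S" for h using card_le_Suc0_iff_eq[OF S(2)] S(3) gS that by simp
    then show ?thesis using that[of g] gS S(1) by blast
  qed
  have "carrier G \<subseteq> generate G {g}" using mono_generate[OF g(2)] S(4) by simp
  moreover have "generate G {g} \<subseteq> carrier G" using g(1) by (intro generate_incl) simp
  ultimately have "generate G {g} = carrier G" by (rule equalityI[rotated])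
  then show ?thesis using g(1) unfolding cyclic_group_def subgroup_generated_def by (intro bexI[of _ g]) auto
qed

text \<open>This makes the basis theorem \<open>min_gens_eq\<close> available for the center, whose
  commutators are all trivial.\<close>

lemma center_is_class3_two_group: "class3_two_group (G\<lparr>carrier := center G\<rparr>)"
proof -
  interpret H: group "G\<lparr>carrier := center G\<rparr>" by (rule subgroup_imp_group[OF subgroup_center])
  show ?thesis
  proof
    show "finite (carrier (G\<lparr>carrier := center G\<rparr>))" using finite_sub[OF subgroup.subset[OF subgroup_center]] by simp
    obtain n where "order G = 2 ^ n" using order_two_power by blast
    moreover have "card (center G) dvd order G" using lagrange[OF subgroup_center] by (metis dvd_triv_right)
    ultimately have "\<exists>m. card (center G) = 2 ^ m" using divides_primepow_nat[OF two_is_prime_nat] by auto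
    then show "\<exists>n. order (G\<lparr>carrier := center G\<rparr>) = 2 ^ n" by (simp add: order_def)
  next
    fix u y z
    assume "u \<in> carrier (G\<lparr>carrier := center G\<rparr>)" "y \<in> carrier (G\<lparr>carrier := center G\<rparr>)" "z \<in> carrier (G\<lparr>carrier := center G\<rparr>)"
    moreover have "center (G\<lparr>carrier := center G\<rparr>) = center G" by (auto simp: center_def)
    ultimately show "H.com (H.com u y) z \<in> center (G\<lparr>carrier := center G\<rparr>)" using H.com_closed by auto
  qed
qed

text \<open>Squaring on the abelian group \<open>center G\<close> is a homomorphism with kernel
  \<open>Om\<close>, and its image is the subgroup \<open>Phi\<close> formed inside the center. So
  \<open>Om\<close> has as many elements as the center modulo its squares.\<close>

lemma card_Om_eq: "card Om = 2 ^ min_gens (G\<lparr>carrier := center G\<rparr>)"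
proof -
  let ?H = "G\<lparr>carrier := center G\<rparr>"
  interpret H: class3_two_group ?H by (rule center_is_class3_two_group)
  let ?sq = "\<lambda>z. z \<otimes> z"
  have Zc: "center G \<subseteq> carrier G" by (rule subgroup.subset[OF subgroup_center])
  have sq: "(u \<otimes> v) \<otimes> (u \<otimes> v) = (u \<otimes> u) \<otimes> (v \<otimes> v)" if "u \<in> center G" "v \<in> center G" for u v
    using mult_square[of u v] com_center(1)[OF that(2)] centerD(1) that by simp
  have "subgroup (?sq ` center G) ?H"
  proof (rule H.subgroup_mult_closedI)
    show "\<one>\<^bsub>?H\<^esub> \<in> ?sq ` center G"
      using subgroup.one_closed[OF subgroup_center] by (intro image_eqI[of _ _ \<one>]) auto
    show "?sq ` center G \<subseteq> carrier ?H" using subgroup.m_closed[OF subgroup_center] by auto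
    fix p q assume "p \<in> ?sq ` center G" "q \<in> ?sq ` center G"
    then obtain u v where "u \<in> center G" "v \<in> center G" "p = u \<otimes> u" "q = v \<otimes> v" by auto
    then show "p \<otimes>\<^bsub>?H\<^esub> q \<in> ?sq ` center G"
      using sq[of u v] subgroup.m_closed[OF subgroup_center, of u v] by (intro image_eqI[of _ _ "u \<otimes> v"]) auto
  qed
  then have "H.Phi \<subseteq> ?sq ` center G" by (rule H.subset_Phi_induct) auto
  moreover have "?sq ` center G \<subseteq> H.Phi" using H.square_Phi by auto
  ultimately have Phi: "H.Phi = ?sq ` center G" by auto
  have "card (center G) = card Om * card (?sq ` center G)"
  proof (rule card_quotient_image[OF finite_carrier subgroup_center subgroup_Om])
    show "Om \<subseteq> center G" using Om_D by auto
    fix a b assume ab: "a \<in> center G" "b \<in> center G"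
    define c where "c = inv a \<otimes> b"
    have c: "c \<in> center G" using ab subgroup_center by (auto simp: c_def intro: subgroup.m_closed subgroup.m_inv_closed)
    have cc: "a \<in> carrier G" "b \<in> carrier G" "c \<in> carrier G" using ab c centerD(1) by auto
    have "b = a \<otimes> c" using cc by (simp add: c_def cancel_words)
    then have "b \<otimes> b = (a \<otimes> a) \<otimes> (c \<otimes> c)" using sq[OF ab(1) c] by simp
    then have "a \<otimes> a = b \<otimes> b \<longleftrightarrow> c \<otimes> c = \<one>" using l_cancel_one'[of "a \<otimes> a" "c \<otimes> c"] cc by auto
    also have "\<dots> \<longleftrightarrow> c \<in> Om" using c by (simp add: Om_def)
    finally show "a \<otimes> a = b \<otimes> b \<longleftrightarrow> inv a \<otimes> b \<in> Om" by (simp add: c_def)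
  qed
  moreover obtain e y where "card (carrier ?H) = 2 ^ e * card H.Phi"
    using H.exists_basis[OF H.subgroup_Phi subset_refl] by metis
  moreover from this have "min_gens ?H = e" by (rule H.min_gens_eq)
  moreover have "card H.Phi \<noteq> 0"
    using H.finite_sub[OF H.Phi_carrier] subgroup.one_closed[OF H.subgroup_Phi] by auto
  ultimately show ?thesis by (simp add: Phi)
qed

text \<open>If some \<open>z\<close> in \<open>Om\<close> were outside \<open>Phi\<close>, a
  homomorphism into \<open>Om\<close> that is nontrivial at \<open>z\<close> would be a derivation
  and not inner, since \<open>com g z\<close> is trivial for all \<open>g\<close>. Its value
  \<open>w\<close> is taken inside its kernel \<open>M\<close>, so that \<open>f (f y)\<close> is
  trivial.\<close>

lemma Om_subset_Phi:
  assumes card: "4 \<le> card Om"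
    and none: "\<not> (\<exists>\<alpha>\<in>carrier (AutoGroup G). \<alpha> \<notin> inner_auts G \<and>
              group.ord (AutoGroup G) \<alpha> = 2 \<and> (\<forall>x\<in>frattini G. \<alpha> x = x))"
  shows "Om \<subseteq> Phi"
proof (rule ccontr)
  assume "\<not> Om \<subseteq> Phi"
  then obtain z where z: "z \<in> Om" "z \<notin> Phi" by blast
  have zc: "z \<in> carrier G" using Om_D z by auto
  obtain M where M: "subgroup M G" "Phi \<subseteq> M" "z \<notin> M" and dec: "carrier G = M \<union> {m \<otimes> z |m. m \<in> M}"
    and hom: "\<And>z a b. z \<in> Om \<Longrightarrow> a \<in> carrier G \<Longrightarrow> b \<in> carrier G \<Longrightarrow>
       (if a \<otimes> b \<in> M then \<one> else z) = (if a \<in> M then \<one> else z) \<otimes> (if b \<in> M then \<one> else z)"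
    by (rule index_two_hom[OF zc z(2)]) (rule that)
  have "card {\<one>, z} \<le> 2" by (simp add: card_insert_if)
  then have "\<not> Om \<subseteq> {\<one>, z}" using card_mono[of "{\<one>, z}" Om] card by auto
  then obtain u where u: "u \<in> Om" "u \<noteq> \<one>" "u \<noteq> z" by blast
  \<comment> \<open>As \<open>M\<close> has index two and misses \<open>z\<close>, one of
    \<open>u\<close> and \<open>u \<otimes> z\<close> belongs to it, and neither is trivial.\<close>
  have "\<exists>w\<in>Om. w \<in> M \<and> w \<noteq> \<one>"
  proof (cases "u \<in> M")
    case True then show ?thesis using u by blast
  next
    case False
    have "u \<in> M \<union> {m \<otimes> z |m. m \<in> M}" using Om_D(2)[OF u(1)] dec by simp
    then obtain m where m: "m \<in> M" "u = m \<otimes> z" using False by auto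
    have mc: "m \<in> carrier G" using m M(1) by (rule_tac subgroup.mem_carrier)
    then have "m = u \<otimes> z" using Om_D[OF z(1)] by (simp add: m(2) m_assoc)
    then have "m \<in> Om" using subgroup.m_closed[OF subgroup_Om u(1) z(1)] by simp
    moreover have "m \<noteq> \<one>" using m u(3) zc by auto
    ultimately show ?thesis using m by blast
  qed
  then obtain w where w: "w \<in> Om" "w \<in> M" "w \<noteq> \<one>" by blast
  define f where "f y = (if y \<in> M then \<one> else w)" for y
  have fOm: "f y \<in> Om" for y using w subgroup.one_closed[OF subgroup_Om] by (simp add: f_def)
  note none[unfolded not_def, rule_format]
  moreover have "\<exists>\<alpha>\<in>carrier (AutoGroup G). \<alpha> \<notin> inner_auts G \<and>
              group.ord (AutoGroup G) \<alpha> = 2 \<and> (\<forall>x\<in>frattini G. \<alpha> x = x)"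
  proof (rule derivation_automorphism[of f])
    show "f y \<in> carrier G" for y using fOm Om_D(2) by blast
    show "f (a \<otimes> b) = f a \<otimes> act a (f b)" if "a \<in> carrier G" "b \<in> carrier G" for a b
      using hom[OF w(1) that] act_central[OF Om_D(1)[OF fOm] that(1)] by (simp add: f_def)
    show "f y \<otimes> f y = \<one>" for y using Om_D(3)[OF fOm] .
    show "f (f y) = \<one>" for y using w(2) subgroup.one_closed[OF M(1)] by (simp add: f_def)
    show "f y = \<one>" if "y \<in> Phi" for y using that M(2) by (auto simp: f_def)
    show "\<not> (\<exists>g\<in>carrier G. \<forall>y\<in>carrier G. f y = com g y)"
    proof
      assume "\<exists>g\<in>carrier G. \<forall>y\<in>carrier G. f y = com g y"
      then obtain g where "g \<in> carrier G" "f z = com g z" using zc by blast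
      then have "f z = \<one>" using com_center(2)[OF Om_D(1)[OF z(1)]] by simp
      then show False using M(3) w(3) by (simp add: f_def)
    qed
  qed
  ultimately show False by blast
qed

text \<open>In the absence of the desired automorphism, a basis modulo \<open>Phi\<close> turns
  \<open>G\<close> into an instance of \<open>all_inner\<close>; derivations are inner there by
  \<open>derivation_automorphism\<close>. The trivial group is excluded by the size of
  \<open>Om\<close>.\<close>

lemma min_gens_bound:
  assumes card: "4 \<le> card Om"
    and none: "\<not> (\<exists>\<alpha>\<in>carrier (AutoGroup G). \<alpha> \<notin> inner_auts G \<and>
              group.ord (AutoGroup G) \<alpha> = 2 \<and> (\<forall>x\<in>frattini G. \<alpha> x = x))"
  shows "min_gens G < 4" "min_gens G \<noteq> 0" "card Om ^ min_gens G \<le> 2 ^ (min_gens G * (min_gens G + 1) div 2)"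
proof -
  obtain d x where basis: "independent Phi d x" "generate G (Phi \<union> x ` {..<d}) = carrier G" "card (carrier G) = 2 ^ d * card Phi"
    by (rule exists_basis[OF subgroup_Phi subset_refl])
  interpret all_inner G d x
  proof
    show "Om \<subseteq> Phi" by (rule Om_subset_Phi[OF card none])
    fix f assume f: "derivation V0 (carrier G) f"
    have fV: "f y \<in> V0" if "y \<in> carrier G" for y using f that by (simp add: derivation_def)
    show "\<exists>g\<in>carrier G. \<forall>y\<in>carrier G. f y = com g y"
    proof (rule ccontr)
      assume outer: "\<not> ?thesis"
      have "\<exists>\<alpha>\<in>carrier (AutoGroup G). \<alpha> \<notin> inner_auts G \<and>
              group.ord (AutoGroup G) \<alpha> = 2 \<and> (\<forall>x\<in>frattini G. \<alpha> x = x)"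
        by (rule derivation_automorphism[OF _ _ _ _ _ outer])
          (use f fV V0_D in \<open>auto simp: derivation_def\<close>)
      then show False using none by contradiction
    qed
  qed (use basis card in auto)
  have d: "min_gens G = d" by (rule min_gens_eq[OF basis(3)])
  show "min_gens G < 4" using d_less_4 d by simp
  show "card Om ^ min_gens G \<le> 2 ^ (min_gens G * (min_gens G + 1) div 2)" using card_Om_power_le d by simp
  show "min_gens G \<noteq> 0"
  proof
    assume "min_gens G = 0"
    then have "generate G {} = carrier G" using generate_x d by simp
    then have "carrier G = {\<one>}" using generate_empty by simp
    then have "Om \<subseteq> {\<one>}" using Om_D(2) by auto
    then show False using card_mono[of "{\<one>}" Om] card by simp
  qed
qed

end

section \<open>Comparison of the ranks of \<open>G\<close> and of its center\<close>

theorem theorem4p5: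
  fixes G :: "('a, 'b) monoid_scheme" (structure)
  assumes "group G"
    and "finite (carrier G)"
    and "\<exists>n. order G = 2 ^ n"
    and "nilpotent_of_class G 3"
  shows "(min_gens G \<noteq> 3 \<and> \<not> cyclic_group (G\<lparr>carrier := center G\<rparr>) \<longrightarrow>
           (\<exists>\<alpha>\<in>carrier (AutoGroup G). \<alpha> \<notin> inner_auts G \<and>
              group.ord (AutoGroup G) \<alpha> = 2 \<and> (\<forall>x\<in>frattini G. \<alpha> x = x)))
       \<and> (min_gens G = 3 \<and> min_gens (G\<lparr>carrier := center G\<rparr>) > 2 \<longrightarrow>
           (\<exists>\<alpha>\<in>carrier (AutoGroup G). \<alpha> \<notin> inner_auts G \<and>
              group.ord (AutoGroup G) \<alpha> = 2 \<and> (\<forall>x\<in>frattini G. \<alpha> x = x)))"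
    (is "(?A \<longrightarrow> ?concl) \<and> (?B \<longrightarrow> ?concl)")
proof -
  interpret group G by fact
  have step: "com y z \<in> lower_central G (Suc i)" if "y \<in> lower_central G i" "z \<in> carrier G" for y z i
    unfolding lower_central.simps com_def using that by (intro generate.incl) blast
  have "lower_central G 3 = {\<one>}" using assms(4) by (simp add: nilpotent_of_class_def)
  \<comment> \<open>As \<open>lower_central\<close> starts at index 0, index 3 is reached by three
    nested commutators; their triviality says that \<open>com (com u y) z\<close> is
    central.\<close>
  then have com4: "com (com (com u y) z) t = \<one>"
    if "u \<in> carrier G" "y \<in> carrier G" "z \<in> carrier G" "t \<in> carrier G" for u y z t
    using step[OF step[OF step[of u 0 y]]] that by (simp add: numeral_3_eq_3)
  interpret class3_two_group G
    by standard (use assms com4 in \<open>auto simp: center_iff_com\<close>)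
  interpret Z: class3_two_group "G\<lparr>carrier := center G\<rparr>" by (rule center_is_class3_two_group)
  define d where "d = min_gens G"
  define m where "m = min_gens (G\<lparr>carrier := center G\<rparr>)"
  \<comment> \<open>The third bound of \<open>min_gens_bound\<close> is compared on exponents of 2.
    As \<open>d\<close> is positive, the resulting inequality says
    \<open>2 * m \<le> d + 1\<close>.\<close>
  have main: "d \<noteq> 0 \<and> d < 4 \<and> m * d \<le> d * (d + 1) div 2" if m: "2 \<le> m" and none: "\<not> ?concl"
  proof -
    have "(2::nat) ^ 2 \<le> 2 ^ m" using m by (intro power_increasing) auto
    then have c: "4 \<le> card Om" by (simp add: card_Om_eq m_def)
    have "(2::nat) ^ (m * d) \<le> 2 ^ (d * (d + 1) div 2)"
      using min_gens_bound(3)[OF c none] by (simp add: card_Om_eq power_mult d_def m_def)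
    then have "m * d \<le> d * (d + 1) div 2" by (simp only: power_increasing_iff[of "2::nat"] one_less_numeral_iff semiring_norm)
    then show ?thesis using min_gens_bound(1,2)[OF c none] by (simp add: d_def)
  qed
  have "?concl" if A: ?A
  proof (rule ccontr)
    assume none: "\<not> ?concl"
    have m: "2 \<le> m" using A Z.cyclic_of_min_gens by (force simp: m_def)
    \<comment> \<open>For \<open>d \<le> 2\<close> the bound would give \<open>m < 2\<close>, which
      a center that is not cyclic rules out.\<close>
    have "d = 1 \<or> d = 2" using main[OF m none] A by (auto simp: d_def)
    then show False using main[OF m none] m by auto
  qed
  moreover have "?concl" if B: ?B
  proof (rule ccontr)
    assume none: "\<not> ?concl"
    have m: "2 < m" "d = 3" using B by (auto simp: m_def d_def)
    \<comment> \<open>For \<open>d = 3\<close> the bound would give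
      \<open>m \<le> 2\<close>.\<close>
    then show False using main[OF _ none] by simp
  qed
  ultimately show ?thesis by blast
qed

end
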